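(* Let $\{X_i\}_{i\ge1}$ be an i.i.d. sequence of real random variables with mean $\mathbb E[X_1]=\mu$ and variance $\mathrm{Var}(X_1)=\sigma^2\in(0,\infty)$. Define, for $t\ge0$, $$Z_1(t)=\sum_{i=1}^{\lfloor t\rfloor}X_i,\qquad Z_2(t)=\sum_{i=1}^{\lfloor t\rfloor}\Big(X_i-\frac{Z_1(t)}{\lfloor t\rfloor}\Big)^2\ \ (t\ge1),\qquad Z_2(t)=0\ \ (0\le t<1).$$ Then $(Z_1,Z_2)$ satisfies the functional limit condition with parameters $(\mu,h,\ell,Y_1,Y_2)$ where $h=\frac12$, $\ell\equiv1$, $Y_1(t)=\sigma B(t)$ and $Y_2(t)=\sigma^2t$, $B$ being a standard Brownian motion. Moreover, the no-early-stopping condition holds for $Z_2$ with exponent $\nu$ (with $h=\frac12$ and $\ell\equiv1$) for every $0<\nu<2$.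
   Context: Topologies. Write $\mathbb D=D([0,\infty),\mathbb R)$ and $\mathbb D_+=D([0,\infty),\mathbb R_+)$ for càdlàg paths. For a càdlàg $x$ on $[0,T]$, its completed graph is $\Gamma_x=\{(t,z): t\in[0,T],\ z$ between $x(t-)$ and $x(t)$ inclusive$\}$, with $x(0-):=x(0)$. The $M_2$ topology on $D([0,T],\mathbb R)$ is induced by the Hausdorff distance between completed graphs. Convergence on $[0,\infty)$ means convergence of the restrictions to $[0,T]$ for every continuity point $T$ of the limit. $\mathrm{WM}_2$ denotes the product of the univariate $M_2$ topologies over the two coordinates. Functional limit condition with parameters $(\mu,h,\ell,Y_1,Y_2)$. $Z_1,Z_2$ are processes with sample paths in $\mathbb D$ and $\mathbb D_+$, $Z_1(0)=0$ a.s.; $\mu,h\in\mathbb R$; $\ell$ is an eventually positive function slowly varying at infinity; $Y_1\in\mathbb D$, $Y_2\in\mathbb D_+$ are processes such that, as $\varepsilon\to0^+$, $$\Big(\varepsilon^h\ell(\varepsilon^{-1})\big(Z_1(\tfrac{\cdot}{\varepsilon})-\tfrac{\cdot}{\varepsilon}\mu\big),\ \varepsilon^h\ell(\varepsilon^{-1})\sqrt{Z_2(\tfrac{\cdot}{\varepsilon})}\Big)\Rightarrow\big(Y_1(\cdot),\sqrt{Y_2(\cdot)}\big)\quad\text{weakly in }\mathrm{WM}_2.$$ Let $\mathbb F^Y$ be the usual augmentation of the natural filtration of $(Y_1,Y_2)$. Moreover: (a) $0<h<1$; (b) as $t\to\infty$, $(Z_1(t)-\mu t)/t\to0$ and $Z_2(t)/t^2\to0$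 a.s.; (c) for every $a>0$, $(Y_1(a\,\cdot),Y_2(a\,\cdot))\overset d=(a^hY_1(\cdot),a^{2h}Y_2(\cdot))$; (d) $Y_1$ is quasi-left-continuous with respect to $\mathbb F^Y$: for every finite $\mathbb F^Y$-predictable stopping time $\tau$, $\mathbb P(\Delta Y_1(\tau)=0)=1$; (e) almost surely $Y_2(t)>0$ for every $t>0$, and $Y_2$ has no negative jumps. Time scale. $A(x):=x^{1-h}\ell(x)$ and $a_\varepsilon:=A^{\leftarrow}(\varepsilon^{-1})$, where $A^{\leftarrow}$ is an asymptotic inverse of $A$ (so $A(A^\leftarrow(x))\sim x$ as $x\to\infty$). No-early-stopping condition for $Z_2$ with exponent $\nu$: for every $K>0$, $$\lim_{\eta\downarrow0}\limsup_{\varepsilon\downarrow0}\mathbb P\Big(\inf_{n\in\mathbb N:\ \varepsilon^{-\nu}\le n\le\eta a_\varepsilon}\frac{\sqrt{Z_2(n)}}{n}\le K\varepsilon\Big)=0.$$ *)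

theory Defs
  imports "HOL-Probability.Probability" "HOL-Library.Landau_Symbols"
begin

section \<open>Cadlag paths and the M2 topology\<close>

definition left_lim :: "(real \<Rightarrow> real) \<Rightarrow> real \<Rightarrow> real" where
  "left_lim x t = (if t \<le> 0 then x 0 else Lim (at_left t) x)"

definition jump :: "(real \<Rightarrow> real) \<Rightarrow> real \<Rightarrow> real" where
  "jump x t = x t - left_lim x t"

text \<open>Paths are functions on \<open>[0,\<infinity>)\<close>, represented extensionally (\<open>undefined\<close> at negative times).\<close>

definition cadlag_paths :: "(real \<Rightarrow> real) set" where
  "cadlag_paths = {x \<in> extensional {0..}.
     (\<forall>t\<ge>0. (x \<longlongrightarrow> x t) (at_right t)) \<and> (\<forall>t>0. \<exists>l. (x \<longlongrightarrow> l) (at_left t))}"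

definition nonneg_cadlag_paths :: "(real \<Rightarrow> real) set" where
  "nonneg_cadlag_paths = {x \<in> cadlag_paths. \<forall>t\<ge>0. 0 \<le> x t}"

definition completed_graph :: "real \<Rightarrow> (real \<Rightarrow> real) \<Rightarrow> (real \<times> real) set" where
  "completed_graph T x = {(t, z). 0 \<le> t \<and> t \<le> T \<and> z \<in> closed_segment (left_lim x t) (x t)}"

definition hausdorff_distance :: "'a::metric_space set \<Rightarrow> 'a set \<Rightarrow> real" where
  "hausdorff_distance A B = max (SUP a\<in>A. infdist a B) (SUP b\<in>B. infdist b A)"

definition m2_dist :: "real \<Rightarrow> (real \<Rightarrow> real) \<Rightarrow> (real \<Rightarrow> real) \<Rightarrow> real" where
  "m2_dist T x y = hausdorff_distance (completed_graph T x) (completed_graph T y)"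

definition m2_converges :: "(nat \<Rightarrow> real \<Rightarrow> real) \<Rightarrow> (real \<Rightarrow> real) \<Rightarrow> bool" where
  "m2_converges xs x \<longleftrightarrow>
     (\<forall>T>0. isCont x T \<longrightarrow> (\<lambda>n. m2_dist T (xs n) x) \<longlonglongrightarrow> 0)"

text \<open>The M2 topology on \<open>D([0,\<infinity>))\<close> is given by its convergent sequences. That convergence is
  metrizable (by \<open>\<integral> exp (-T) min 1 (m2_dist T x y) dT\<close>), so its topology consists of the
  sequentially open sets.\<close>

definition m2_topology :: "(real \<Rightarrow> real) topology" where
  "m2_topology = topology (\<lambda>U. U \<subseteq> cadlag_paths \<and>
     (\<forall>x\<in>U. \<forall>xs. range xs \<subseteq> cadlag_paths \<and> m2_converges xs x \<longrightarrow>
        (\<forall>\<^sub>F n in sequentially. xs n \<in> U)))"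

lemma openin_m2_topology:
  "openin m2_topology U \<longleftrightarrow> U \<subseteq> cadlag_paths \<and>
     (\<forall>x\<in>U. \<forall>xs. range xs \<subseteq> cadlag_paths \<and> m2_converges xs x \<longrightarrow>
        (\<forall>\<^sub>F n in sequentially. xs n \<in> U))"
proof -
  have "istopology (\<lambda>U. U \<subseteq> cadlag_paths \<and>
     (\<forall>x\<in>U. \<forall>xs. range xs \<subseteq> cadlag_paths \<and> m2_converges xs x \<longrightarrow>
        (\<forall>\<^sub>F n in sequentially. xs n \<in> U)))" (is "istopology ?P")
    unfolding istopology_def
  proof (rule conjI; rule allI)
    fix S
    show "\<forall>T. ?P S \<longrightarrow> ?P T \<longrightarrow> ?P (S \<inter> T)"
      by (simp add: eventually_conj_iff) blast
  next
    fix \<K>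
    show "(\<forall>S\<in>\<K>. ?P S) \<longrightarrow> ?P (\<Union>\<K>)"
    proof (intro conjI ballI allI impI)
      assume K: "\<forall>S\<in>\<K>. ?P S"
      then show "\<Union>\<K> \<subseteq> cadlag_paths" by blast
    next
      assume K: "\<forall>S\<in>\<K>. ?P S"
      fix x xs assume "x \<in> \<Union>\<K>" and xs: "range xs \<subseteq> cadlag_paths \<and> m2_converges xs x"
      then obtain S where S: "S \<in> \<K>" "x \<in> S" by blast
      have "?P S" using K S(1) by (rule bspec)
      with S(2) xs have "\<forall>\<^sub>F n in sequentially. xs n \<in> S" by blast
      then show "\<forall>\<^sub>F n in sequentially. xs n \<in> \<Union>\<K>"
        by (rule eventually_mono) (use S in blast)
    qed
  qed
  then show ?thesis unfolding m2_topology_def by (subst topology_inverse') auto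
qed

lemma topspace_m2_topology: "topspace m2_topology = cadlag_paths"
proof
  show "topspace m2_topology \<subseteq> cadlag_paths"
    using openin_topspace[of m2_topology] unfolding openin_m2_topology by blast
  have "openin m2_topology cadlag_paths"
    unfolding openin_m2_topology by (auto intro!: always_eventually)
  then show "cadlag_paths \<subseteq> topspace m2_topology" by (rule openin_subset)
qed

abbreviation wm2_topology :: "((real \<Rightarrow> real) \<times> (real \<Rightarrow> real)) topology" where
  "wm2_topology \<equiv> prod_topology m2_topology m2_topology"

section \<open>Weak convergence and processes\<close>

definition borel_of :: "'a topology \<Rightarrow> 'a measure" where
  "borel_of T = sigma (topspace T) {U. openin T U}"

definition converges_weakly ::
    "'b topology \<Rightarrow> 'a measure \<Rightarrow> ('i \<Rightarrow> 'a \<Rightarrow> 'b) \<Rightarrow> 'c measure \<Rightarrow> ('c \<Rightarrow> 'b) \<Rightarrow> 'i filter \<Rightarrow> bool" where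
  "converges_weakly T M X N Y F \<longleftrightarrow>
     (\<forall>\<^sub>F i in F. X i \<in> M \<rightarrow>\<^sub>M borel_of T) \<and> Y \<in> N \<rightarrow>\<^sub>M borel_of T \<and>
     (\<forall>f. continuous_map T euclideanreal f \<and> bounded (f ` topspace T) \<longrightarrow>
        ((\<lambda>i. \<integral>\<omega>. f (X i \<omega>) \<partial>M) \<longlongrightarrow> (\<integral>\<omega>. f (Y \<omega>) \<partial>N)) F)"

definition path :: "(real \<Rightarrow> 'a \<Rightarrow> 'b) \<Rightarrow> 'a \<Rightarrow> real \<Rightarrow> 'b" where
  "path Z \<omega> = (\<lambda>t\<in>{0..}. Z t \<omega>)"

definition process_in :: "'a measure \<Rightarrow> (real \<Rightarrow> real) set \<Rightarrow> (real \<Rightarrow> 'a \<Rightarrow> real) \<Rightarrow> bool" where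
  "process_in M S Z \<longleftrightarrow>
     (\<forall>t\<ge>0. Z t \<in> borel_measurable M) \<and> (\<forall>\<omega>\<in>space M. path Z \<omega> \<in> S)"

definition same_law ::
    "'a measure \<Rightarrow> (real \<Rightarrow> 'a \<Rightarrow> 'b::topological_space) \<Rightarrow> 'c measure \<Rightarrow> (real \<Rightarrow> 'c \<Rightarrow> 'b) \<Rightarrow> bool" where
  "same_law M Z N W \<longleftrightarrow>
     distr M (\<Pi>\<^sub>M t\<in>{0..}. borel) (path Z) = distr N (\<Pi>\<^sub>M t\<in>{0..}. borel) (path W)"

section \<open>Filtrations and predictable times\<close>

definition natural_filtration ::
    "'a measure \<Rightarrow> (real \<Rightarrow> 'a \<Rightarrow> 'b::topological_space) \<Rightarrow> real \<Rightarrow> 'a measure" where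
  "natural_filtration M Y t =
     sigma (space M) {Y s -` B \<inter> space M |s B. 0 \<le> s \<and> s \<le> t \<and> B \<in> sets borel}"

text \<open>Completion by the subsets of null sets, followed by passage to the right limits.\<close>

definition usual_augmentation ::
    "'a measure \<Rightarrow> (real \<Rightarrow> 'a measure) \<Rightarrow> real \<Rightarrow> 'a measure" where
  "usual_augmentation M F t =
     sigma (space M)
       (\<Inter>u\<in>{t<..}. sigma_sets (space M) (sets (F u) \<union> null_sets (completion M)))"

definition predictable_sigma :: "'a set \<Rightarrow> (real \<Rightarrow> 'a measure) \<Rightarrow> ('a \<times> real) measure" where
  "predictable_sigma \<Omega> F =
     sigma (\<Omega> \<times> {0..})
       ({A \<times> {0} |A. A \<in> sets (F 0)} \<union>
        {A \<times> {s<..t} |A s t. 0 \<le> s \<and> s < t \<and> A \<in> sets (F s)})"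

text \<open>A time is predictable if its stochastic interval \<open>[\<tau>,\<infinity>)\<close> is a predictable set.\<close>

definition finite_predictable_time ::
    "'a set \<Rightarrow> (real \<Rightarrow> 'a measure) \<Rightarrow> ('a \<Rightarrow> real) \<Rightarrow> bool" where
  "finite_predictable_time \<Omega> F \<tau> \<longleftrightarrow>
     (\<forall>\<omega>\<in>\<Omega>. 0 \<le> \<tau> \<omega>) \<and> stopping_time F \<tau> \<and>
     {(\<omega>, t). \<omega> \<in> \<Omega> \<and> \<tau> \<omega> \<le> t} \<in> sets (predictable_sigma \<Omega> F)"

definition quasi_left_continuous ::
    "'a measure \<Rightarrow> (real \<Rightarrow> 'a measure) \<Rightarrow> (real \<Rightarrow> 'a \<Rightarrow> real) \<Rightarrow> bool" where
  "quasi_left_continuous M F Y \<longleftrightarrow>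
     (\<forall>\<tau>. finite_predictable_time (space M) F \<tau> \<longrightarrow>
        (AE \<omega> in M. jump (path Y \<omega>) (\<tau> \<omega>) = 0))"

section \<open>The functional limit condition\<close>

definition slowly_varying :: "(real \<Rightarrow> real) \<Rightarrow> bool" where
  "slowly_varying L \<longleftrightarrow>
     (\<exists>x0. L \<in> borel_measurable (restrict_space borel {x0..})) \<and>
     (\<forall>c>0. ((\<lambda>x. L (c * x) / L x) \<longlongrightarrow> 1) at_top)"

definition functional_limit_condition ::
    "'a measure \<Rightarrow> (real \<Rightarrow> 'a \<Rightarrow> real) \<Rightarrow> (real \<Rightarrow> 'a \<Rightarrow> real) \<Rightarrow>
     real \<Rightarrow> real \<Rightarrow> (real \<Rightarrow> real) \<Rightarrow>
     'b measure \<Rightarrow> (real \<Rightarrow> 'b \<Rightarrow> real) \<Rightarrow> (real \<Rightarrow> 'b \<Rightarrow> real) \<Rightarrow> bool" where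
  "functional_limit_condition M Z1 Z2 \<mu> h L N Y1 Y2 \<longleftrightarrow>
     prob_space M \<and> prob_space N \<and>
     process_in M cadlag_paths Z1 \<and> process_in M nonneg_cadlag_paths Z2 \<and>
     (AE \<omega> in M. Z1 0 \<omega> = 0) \<and>
     (\<forall>\<^sub>F x in at_top. 0 < L x) \<and> slowly_varying L \<and>
     process_in N cadlag_paths Y1 \<and> process_in N nonneg_cadlag_paths Y2 \<and>
     converges_weakly wm2_topology
       M (\<lambda>\<epsilon> \<omega>.
           (\<lambda>t\<in>{0..}. \<epsilon> powr h * L (1 / \<epsilon>) * (Z1 (t / \<epsilon>) \<omega> - t / \<epsilon> * \<mu>),
            \<lambda>t\<in>{0..}. \<epsilon> powr h * L (1 / \<epsilon>) * sqrt (Z2 (t / \<epsilon>) \<omega>)))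
       N (\<lambda>\<omega>. (path Y1 \<omega>, \<lambda>t\<in>{0..}. sqrt (Y2 t \<omega>)))
       (at_right 0) \<and>
     0 < h \<and> h < 1 \<and>
     (AE \<omega> in M. ((\<lambda>t. (Z1 t \<omega> - \<mu> * t) / t) \<longlongrightarrow> 0) at_top \<and>
                  ((\<lambda>t. Z2 t \<omega> / t\<^sup>2) \<longlongrightarrow> 0) at_top) \<and>
     (\<forall>a>0. same_law N (\<lambda>t \<omega>. (Y1 (a * t) \<omega>, Y2 (a * t) \<omega>))
                     N (\<lambda>t \<omega>. (a powr h * Y1 t \<omega>, a powr (2 * h) * Y2 t \<omega>))) \<and>
     quasi_left_continuous N
       (usual_augmentation N (natural_filtration N (\<lambda>t \<omega>. (Y1 t \<omega>, Y2 t \<omega>)))) Y1 \<and>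
     (AE \<omega> in N. (\<forall>t>0. 0 < Y2 t \<omega>) \<and> (\<forall>t\<ge>0. 0 \<le> jump (path Y2 \<omega>) t))"

section \<open>The no-early-stopping condition\<close>

definition time_scale :: "real \<Rightarrow> (real \<Rightarrow> real) \<Rightarrow> real \<Rightarrow> real" where
  "time_scale h L x = x powr (1 - h) * L x"

text \<open>Divergence of \<open>g\<close> is part of the notion because \<open>A\<close> is only meaningful near \<open>\<infinity>\<close>.\<close>

definition asymptotic_inverse :: "(real \<Rightarrow> real) \<Rightarrow> (real \<Rightarrow> real) \<Rightarrow> bool" where
  "asymptotic_inverse A g \<longleftrightarrow>
     filterlim g at_top at_top \<and> (\<lambda>x. A (g x)) \<sim>[at_top] (\<lambda>x. x)"

text \<open>\<open>Ainv\<close> stands for the asymptotic inverse of the time scale, so that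
  \<open>a\<^sub>\<epsilon> = Ainv (1 / \<epsilon>)\<close>. The infimum is taken in \<^typ>\<open>ereal\<close>, so that over an empty range
  of \<open>n\<close> it is \<open>\<infinity>\<close>.\<close>

definition no_early_stopping ::
    "'a measure \<Rightarrow> (real \<Rightarrow> 'a \<Rightarrow> real) \<Rightarrow> (real \<Rightarrow> real) \<Rightarrow> real \<Rightarrow> bool" where
  "no_early_stopping M Z2 Ainv \<nu> \<longleftrightarrow>
     (\<forall>K>0. ((\<lambda>\<eta>. Limsup (at_right 0) (\<lambda>\<epsilon>. ereal (measure M {\<omega> \<in> space M.
          (INF n\<in>{n::nat. \<epsilon> powr (-\<nu>) \<le> real n \<and> real n \<le> \<eta> * Ainv (1 / \<epsilon>)}.
             ereal (sqrt (Z2 (real n) \<omega>) / real n)) \<le> ereal (K * \<epsilon>)})))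
        \<longlongrightarrow> 0) (at_right 0))"

section \<open>Brownian motion and sample statistics\<close>

definition standard_brownian_motion :: "'a measure \<Rightarrow> (real \<Rightarrow> 'a \<Rightarrow> real) \<Rightarrow> bool" where
  "standard_brownian_motion M B \<longleftrightarrow>
     prob_space M \<and>
     (\<forall>t\<ge>0. B t \<in> borel_measurable M) \<and>
     (AE \<omega> in M. B 0 \<omega> = 0) \<and>
     (\<forall>s t. 0 \<le> s \<and> s < t \<longrightarrow>
        distributed M lborel (\<lambda>\<omega>. B t \<omega> - B s \<omega>) (normal_density 0 (sqrt (t - s)))) \<and>
     (\<forall>(ts :: nat \<Rightarrow> real) n. 0 \<le> ts 0 \<and> mono ts \<longrightarrow>
        prob_space.indep_vars M (\<lambda>_. borel) (\<lambda>i \<omega>. B (ts (Suc i)) \<omega> - B (ts i) \<omega>) {..<n}) \<and>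
     (\<forall>\<omega>\<in>space M. continuous_on {0..} (\<lambda>t. B t \<omega>))"

definition sum_process :: "(nat \<Rightarrow> 'a \<Rightarrow> real) \<Rightarrow> real \<Rightarrow> 'a \<Rightarrow> real" where
  "sum_process X t \<omega> = (\<Sum>i=1..nat \<lfloor>t\<rfloor>. X i \<omega>)"

definition centered_square_process :: "(nat \<Rightarrow> 'a \<Rightarrow> real) \<Rightarrow> real \<Rightarrow> 'a \<Rightarrow> real" where
  "centered_square_process X t \<omega> =
     (if t < 1 then 0
      else \<Sum>i=1..nat \<lfloor>t\<rfloor>. (X i \<omega> - sum_process X t \<omega> / of_int \<lfloor>t\<rfloor>)\<^sup>2)"

end

theory Submission
  imports Defs
begin

text \<open>
  A function that is continuous for the topology \<open>WM\<^sub>2\<close> is sequentially continuous for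
  locally uniform convergence, hence both it and its negative are increasing limits of functions
  that are Lipschitz for a metric of locally uniform convergence. So it suffices to prove
  convergence of expectations of bounded Lipschitz functions, and these tolerate perturbations
  that are small in probability.
  Up to such perturbations, \<open>Z\<^sub>2\<close> can be replaced by its deterministic limit (strong law for
  the truncated squares, Markov's inequality for the remainder), and the centred walk by a step
  function that is constant on blocks of length \<open>1/m\<close> (Ottaviani's inequality, with the fourth
  moment of the Gaussian limit beating the number of blocks). For fixed \<open>m\<close> the block increments
  are independent and converge in law by the central limit theorem. Skorohod's representation of
  each of them on the line turns this into pointwise convergence on a finite product space, and
  \<open>m \<rightarrow> \<infinity>\<close> recovers Brownian motion by continuity of its paths.

  For the no-early-stopping condition, \<open>Z\<^sub>2(n) / n\<close> is almost surely eventually larger than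
  \<open>\<sigma>\<^sup>2/2\<close>, whereas early stopping forces it below a constant multiple of \<open>K\<^sup>2 \<eta>\<close> at some
  \<open>n \<ge> \<epsilon>\<^sup>-\<^sup>\<nu>\<close>.
\<close>

section \<open>Locally uniform convergence and the M2 topology\<close>

text \<open>The first obstacle is the target space. Functions continuous for the product of the M2
  topologies are accessible only along convergent sequences, and measurability is demanded for the
  Borel sets of that topology, with no countable base at hand. Sequential lower semicontinuity
  serves both needs: it holds for indicators of open sets and for continuous functions of either
  sign, and Lipschitz envelopes then reduce measurability and convergence alike to one class of
  functionals.

  The second obstacle is that the increments come with two moments only. Chebyshev's inequality
  bounds the probability of a large oscillation over a block of length 1/m by a multiple of 1/m, and
  the m blocks per unit of time use this up entirely. Hence m is fixed, each block is passed to its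
  Gaussian limit, and only there is a higher moment taken. The same shortage is why the squares are
  truncated before a law of large numbers is applied to them.\<close>

text \<open>The element \<open>1\<close> caps the distance, since two paths may admit no \<open>\<delta>\<close> at all.\<close>

definition unif_dist :: "(real \<Rightarrow> real) \<Rightarrow> (real \<Rightarrow> real) \<Rightarrow> real" where
  "unif_dist x y = Inf (insert 1 {\<delta>. 0 < \<delta> \<and> (\<forall>t\<in>{0..1 / \<delta>}. \<bar>x t - y t\<bar> \<le> \<delta>)})"

lemma unif_dist_bdd: "bdd_below (insert 1 {\<delta>::real. 0 < \<delta> \<and> P \<delta>})"
  by (rule bdd_belowI[of _ 0]) auto

lemma unif_dist_nonneg: "0 \<le> unif_dist x y"
  unfolding unif_dist_def by (rule cInf_greatest) auto

lemma unif_dist_le_1: "unif_dist x y \<le> 1"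
  unfolding unif_dist_def by (rule cInf_lower[OF _ unif_dist_bdd]) auto

lemma unif_dist_le:
  assumes "0 < \<delta>" "\<And>t. 0 \<le> t \<Longrightarrow> t \<le> 1 / \<delta> \<Longrightarrow> \<bar>x t - y t\<bar> \<le> \<delta>"
  shows "unif_dist x y \<le> \<delta>"
  unfolding unif_dist_def by (rule cInf_lower[OF _ unif_dist_bdd]) (use assms in auto)

lemma unif_dist_less:
  assumes "unif_dist x y < e" "e \<le> 1" "0 \<le> t" "t \<le> 1 / e"
  shows "\<bar>x t - y t\<bar> \<le> e"
proof -
  have e: "0 < e" using assms(1) unif_dist_nonneg[of x y] by linarith
  obtain d where d: "d \<in> insert 1 {\<delta>. 0 < \<delta> \<and> (\<forall>t\<in>{0..1 / \<delta>}. \<bar>x t - y t\<bar> \<le> \<delta>)}" "d < e"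
    using assms(1) unfolding unif_dist_def
    by (subst (asm) cInf_less_iff[OF _ unif_dist_bdd]) auto
  \<comment> \<open>The cap 1 is excluded as a witness because \<open>d < e\<close> and
    \<open>e \<le> 1\<close>.\<close>
  then have "0 < d" "\<forall>t\<in>{0..1 / d}. \<bar>x t - y t\<bar> \<le> d" using assms(2) by auto
  moreover have "t \<le> 1 / d"
    using assms(4) d(2) \<open>0 < d\<close> e by (meson frac_le less_eq_real_def order_trans zero_le_one)
  ultimately have "\<bar>x t - y t\<bar> \<le> d" using assms(3) by auto
  then show ?thesis using d(2) by linarith
qed

lemma unif_dist_sym: "unif_dist x y = unif_dist y x"
  unfolding unif_dist_def by (simp add: abs_minus_commute)

lemma unif_dist_refl [simp]: "unif_dist x x = 0"
proof (rule antisym[OF field_le_epsilon unif_dist_nonneg])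
  fix e :: real assume "0 < e"
  then show "unif_dist x x \<le> 0 + e" by (intro unif_dist_le) auto
qed

text \<open>Windows shrink as tolerances grow: \<open>[0, 1 / (a + b)]\<close> lies in both
  \<open>[0, 1 / a]\<close> and \<open>[0, 1 / b]\<close>, so on it the tolerances add. Once their
  sum exceeds 1 the cap settles the claim.\<close>

lemma unif_dist_triangle: "unif_dist x z \<le> unif_dist x y + unif_dist y z"
proof (rule field_le_epsilon)
  fix e :: real assume e: "0 < e"
  define a where "a = unif_dist x y + e / 2"
  define b where "b = unif_dist y z + e / 2"
  have ab: "unif_dist x y < a" "unif_dist y z < b" "0 < a" "0 < b"
    using e unif_dist_nonneg[of x y] unif_dist_nonneg[of y z] by (auto simp: a_def b_def)
  show "unif_dist x z \<le> unif_dist x y + unif_dist y z + e"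
  proof (cases "a + b \<le> 1")
    case True
    have "unif_dist x z \<le> a + b"
    proof (rule unif_dist_le)
      fix t assume t: "0 \<le> t" "t \<le> 1 / (a + b)"
      have "1 / (a + b) \<le> 1 / a" "1 / (a + b) \<le> 1 / b" using ab by (auto intro!: divide_left_mono)
      then have "\<bar>x t - y t\<bar> \<le> a" "\<bar>y t - z t\<bar> \<le> b"
        using t ab True by (auto intro!: unif_dist_less[of x y] unif_dist_less[of y z])
      then show "\<bar>x t - z t\<bar> \<le> a + b" by linarith
    qed (use ab in auto)
    then show ?thesis by (simp add: a_def b_def)
  next
    case False
    then show ?thesis using unif_dist_le_1[of x z] by (simp add: a_def b_def)
  qed
qed

text \<open>In \<open>unif_dist\<close> one number is both the tolerance and the inverse length of
  the window. A \<open>d\<close> that is at most \<open>e\<close> and whose inverse is at least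
  \<open>T\<close> separates the two roles.\<close>

lemma unif_dist_tendsto_0_iff:
  "((\<lambda>i. unif_dist (xs i) x) \<longlongrightarrow> 0) F \<longleftrightarrow>
     (\<forall>T e. 0 < e \<longrightarrow> (\<forall>\<^sub>F i in F. \<forall>t. 0 \<le> t \<and> t \<le> T \<longrightarrow> \<bar>xs i t - x t\<bar> \<le> e))"
proof safe
  fix T e :: real assume lim: "((\<lambda>i. unif_dist (xs i) x) \<longlongrightarrow> 0) F" and e: "0 < e"
  define d where "d = min (min e 1) (1 / max 1 T)"
  have d: "0 < d" "d \<le> 1" "d \<le> e" using e by (auto simp: d_def)
  have "T \<le> max 1 T" by simp
  also have "\<dots> = 1 / (1 / max 1 T)" by simp
  also have "\<dots> \<le> 1 / d" using d by (intro divide_left_mono) (auto simp: d_def)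
  finally have T: "T \<le> 1 / d" .
  have "\<forall>\<^sub>F i in F. unif_dist (xs i) x < d"
    using lim d(1) by (rule order_tendstoD(2))
  then show "\<forall>\<^sub>F i in F. \<forall>t. 0 \<le> t \<and> t \<le> T \<longrightarrow> \<bar>xs i t - x t\<bar> \<le> e"
    by (rule eventually_mono) (use d T in \<open>auto intro: order_trans[OF unif_dist_less]\<close>)
next
  assume *: "\<forall>T e. 0 < e \<longrightarrow> (\<forall>\<^sub>F i in F. \<forall>t. 0 \<le> t \<and> t \<le> T \<longrightarrow> \<bar>xs i t - x t\<bar> \<le> e)"
  show "((\<lambda>i. unif_dist (xs i) x) \<longlongrightarrow> 0) F"
  proof (rule tendstoI)
    fix e :: real assume "0 < e"
    then have "0 < e / 2" by simp
    then have "\<forall>\<^sub>F i in F. \<forall>t. 0 \<le> t \<and> t \<le> 1 / (e / 2) \<longrightarrow> \<bar>xs i t - x t\<bar> \<le> e / 2"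
      using * by blast
    then show "\<forall>\<^sub>F i in F. dist (unif_dist (xs i) x) 0 < e"
    proof (rule eventually_mono)
      fix i assume "\<forall>t. 0 \<le> t \<and> t \<le> 1 / (e / 2) \<longrightarrow> \<bar>xs i t - x t\<bar> \<le> e / 2"
      then have "unif_dist (xs i) x \<le> e / 2" using \<open>0 < e\<close> by (intro unif_dist_le) auto
      then show "dist (unif_dist (xs i) x) 0 < e"
        using \<open>0 < e\<close> unif_dist_nonneg[of "xs i" x] by (simp add: dist_real_def)
    qed
  qed
qed

section \<open>Uniform closeness controls the Hausdorff distance of completed graphs\<close>

lemma left_lim_tendsto:
  assumes "x \<in> cadlag_paths" "0 < t"
  shows "(x \<longlongrightarrow> left_lim x t) (at_left t)"
proof -
  obtain l where l: "(x \<longlongrightarrow> l) (at_left t)"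
    using assms unfolding cadlag_paths_def by blast
  then have "Lim (at_left t) x = l" by (intro tendsto_Lim) auto
  then show ?thesis using l assms by (simp add: left_lim_def)
qed

lemma left_lim_diff_le:
  assumes x: "x \<in> cadlag_paths" and y: "y \<in> cadlag_paths"
    and d: "\<And>s. 0 \<le> s \<Longrightarrow> s \<le> T \<Longrightarrow> \<bar>x s - y s\<bar> \<le> \<delta>" and t: "0 \<le> t" "t \<le> T"
  shows "\<bar>left_lim x t - left_lim y t\<bar> \<le> \<delta>"
proof (cases "t = 0")
  case True
  then show ?thesis using d[of 0] t by (simp add: left_lim_def)
next
  case False
  with t have "0 < t" by simp
  have "((\<lambda>s. \<bar>x s - y s\<bar>) \<longlongrightarrow> \<bar>left_lim x t - left_lim y t\<bar>) (at_left t)"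
    by (intro tendsto_intros left_lim_tendsto x y \<open>0 < t\<close>)
  moreover have "\<forall>\<^sub>F s in at_left t. \<bar>x s - y s\<bar> \<le> \<delta>"
    unfolding eventually_at_left_field using \<open>0 < t\<close> t d by (intro exI[of _ 0]) auto
  ultimately show ?thesis by (rule tendsto_upperbound) auto
qed

text \<open>A point of one graph is matched with the point of the other that has the same time and
  the same convex parameter \<open>u\<close> on its vertical segment. The time components cancel,
  and the rest is a convex combination of two differences that are each at most \<delta>.\<close>

lemma infdist_completed_graph_le:
  assumes x: "x \<in> cadlag_paths" and y: "y \<in> cadlag_paths"
    and d: "\<And>s. 0 \<le> s \<Longrightarrow> s \<le> T \<Longrightarrow> \<bar>x s - y s\<bar> \<le> \<delta>" and a: "a \<in> completed_graph T x"
  shows "infdist a (completed_graph T y) \<le> \<delta>"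
proof -
  obtain t z where tz: "a = (t, z)" "0 \<le> t" "t \<le> T" "z \<in> closed_segment (left_lim x t) (x t)"
    using a unfolding completed_graph_def by auto
  obtain u where u: "0 \<le> u" "u \<le> 1" "z = (1 - u) * left_lim x t + u * x t"
    using tz(4) by (auto simp: in_segment)
  define w where "w = (1 - u) * left_lim y t + u * y t"
  have "w \<in> closed_segment (left_lim y t) (y t)"
    using u by (auto simp: in_segment w_def)
  then have "(t, w) \<in> completed_graph T y" using tz unfolding completed_graph_def by auto
  then have "infdist a (completed_graph T y) \<le> dist a (t, w)" by (rule infdist_le)
  also have "\<dots> = \<bar>(1 - u) * (left_lim x t - left_lim y t) + u * (x t - y t)\<bar>"
    by (simp add: tz(1) dist_prod_def dist_real_def u(3) w_def algebra_simps)
  also have "\<dots> \<le> (1 - u) * \<bar>left_lim x t - left_lim y t\<bar> + u * \<bar>x t - y t\<bar>"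
    using u by (intro order_trans[OF abs_triangle_ineq]) (simp add: abs_mult)
  also have "\<dots> \<le> (1 - u) * \<delta> + u * \<delta>"
    using u d tz left_lim_diff_le[OF x y d tz(2,3)] by (intro add_mono mult_left_mono) auto
  finally show ?thesis by (simp add: algebra_simps)
qed

text \<open>The suprema in the Hausdorff distance are real-valued, hence informative only for
  bounded families. Uniform closeness supplies the bound, and so the nonnegativity is obtained
  together with the upper estimate.\<close>

lemma m2_dist_bounds:
  assumes x: "x \<in> cadlag_paths" and y: "y \<in> cadlag_paths" and T: "0 \<le> T"
    and d: "\<And>s. 0 \<le> s \<Longrightarrow> s \<le> T \<Longrightarrow> \<bar>x s - y s\<bar> \<le> \<delta>"
  shows "0 \<le> m2_dist T x y" "m2_dist T x y \<le> \<delta>"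
proof -
  have ne: "(0, x 0) \<in> completed_graph T x" for x
    using T by (auto simp: completed_graph_def)
  have d': "\<bar>y s - x s\<bar> \<le> \<delta>" if "0 \<le> s" "s \<le> T" for s
    using d[OF that] by (simp add: abs_minus_commute)
  have le: "infdist a (completed_graph T y) \<le> \<delta>" if "a \<in> completed_graph T x" for a
    by (rule infdist_completed_graph_le[OF x y d that])
  have le': "infdist a (completed_graph T x) \<le> \<delta>" if "a \<in> completed_graph T y" for a
    by (rule infdist_completed_graph_le[OF y x d' that])
  have "0 \<le> infdist (0, x 0) (completed_graph T y)" by (rule infdist_nonneg)
  also have "\<dots> \<le> (SUP a\<in>completed_graph T x. infdist a (completed_graph T y))"
    by (rule cSUP_upper[OF ne bdd_aboveI2[where M = \<delta>]]) (rule le)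
  finally show "0 \<le> m2_dist T x y"
    unfolding m2_dist_def hausdorff_distance_def by (simp add: max.coboundedI1)
  have "completed_graph T x \<noteq> {}" for x using ne by blast
  then show "m2_dist T x y \<le> \<delta>"
    unfolding m2_dist_def hausdorff_distance_def
    by (intro max.boundedI cSUP_least) (auto intro: le le')
qed

lemma m2_converges_if_unif_dist:
  assumes "\<And>n. xs n \<in> cadlag_paths" "x \<in> cadlag_paths" "(\<lambda>n. unif_dist (xs n) x) \<longlonglongrightarrow> 0"
  shows "m2_converges xs x"
  unfolding m2_converges_def
proof (intro allI impI)
  fix T :: real assume T: "0 < T"
  show "(\<lambda>n. m2_dist T (xs n) x) \<longlonglongrightarrow> 0"
  proof (rule LIMSEQ_I)
    fix r :: real assume r: "0 < r"
    then have "\<forall>\<^sub>F n in sequentially. \<forall>t. 0 \<le> t \<and> t \<le> T \<longrightarrow> \<bar>xs n t - x t\<bar> \<le> r / 2"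
      using assms(3)[unfolded unif_dist_tendsto_0_iff, rule_format, of "r / 2"] by simp
    then have "\<forall>\<^sub>F n in sequentially. norm (m2_dist T (xs n) x - 0) < r"
    proof (rule eventually_mono)
      fix n assume "\<forall>t. 0 \<le> t \<and> t \<le> T \<longrightarrow> \<bar>xs n t - x t\<bar> \<le> r / 2"
      then show "norm (m2_dist T (xs n) x - 0) < r"
        using m2_dist_bounds[OF assms(1,2), where \<delta> = "r / 2", of T n] T r by auto
    qed
    then show "\<exists>no. \<forall>n\<ge>no. norm (m2_dist T (xs n) x - 0) < r"
      by (simp add: eventually_sequentially)
  qed
qed

section \<open>Lipschitz functionals of pairs of paths and weak convergence\<close>

type_synonym path_pair = "(real \<Rightarrow> real) \<times> (real \<Rightarrow> real)"

abbreviation path_pairs :: "path_pair set" where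
  "path_pairs \<equiv> cadlag_paths \<times> cadlag_paths"

definition pair_dist ::
    "path_pair \<Rightarrow> path_pair \<Rightarrow> real" where
  "pair_dist p q = unif_dist (fst p) (fst q) + unif_dist (snd p) (snd q)"

lemma pair_dist_nonneg: "0 \<le> pair_dist p q"
  by (simp add: pair_dist_def unif_dist_nonneg)

lemma pair_dist_refl [simp]: "pair_dist p p = 0"
  by (simp add: pair_dist_def)

lemma pair_dist_sym: "pair_dist p q = pair_dist q p"
  by (simp add: pair_dist_def unif_dist_sym)

lemma pair_dist_triangle: "pair_dist p r \<le> pair_dist p q + pair_dist q r"
  unfolding pair_dist_def
  using unif_dist_triangle[of "fst p" "fst r" "fst q"] unif_dist_triangle[of "snd p" "snd r" "snd q"]
  by linarith

text \<open>Open sets are by definition the sequentially open ones, so the convergence that defines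
  them implies convergence in the topology.\<close>

lemma limitin_m2_topology:
  assumes "\<And>n. xs n \<in> cadlag_paths" "x \<in> cadlag_paths" "(\<lambda>n. unif_dist (xs n) x) \<longlonglongrightarrow> 0"
  shows "limitin m2_topology xs x sequentially"
proof -
  have "range xs \<subseteq> cadlag_paths \<and> m2_converges xs x"
    using assms m2_converges_if_unif_dist[OF assms] by blast
  then show ?thesis
    unfolding limitin_def topspace_m2_topology openin_m2_topology using assms(2) by blast
qed

lemma limitin_wm2_topology:
  assumes "\<And>n. ps n \<in> path_pairs" "p \<in> path_pairs" "(\<lambda>n. pair_dist (ps n) p) \<longlonglongrightarrow> 0"
  shows "limitin wm2_topology ps p sequentially"
proof -
  have "(\<lambda>n. unif_dist (fst (ps n)) (fst p)) \<longlonglongrightarrow> 0"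
    by (rule tendsto_sandwich[OF _ _ tendsto_const assms(3)])
       (auto simp: pair_dist_def unif_dist_nonneg)
  moreover have "(\<lambda>n. unif_dist (snd (ps n)) (snd p)) \<longlonglongrightarrow> 0"
    by (rule tendsto_sandwich[OF _ _ tendsto_const assms(3)])
       (auto simp: pair_dist_def unif_dist_nonneg)
  ultimately show ?thesis
    using assms(1,2) by (auto simp: limitin_pairwise o_def mem_Times_iff intro!: limitin_m2_topology)
qed

text \<open>All conditions are confined to \<open>path_pairs\<close>: the test functions of weak
  convergence are controlled on the space of the topology only and may be arbitrary outside
  it.\<close>

definition bounded_lipschitz :: "(path_pair \<Rightarrow> real) \<Rightarrow> real \<Rightarrow> real \<Rightarrow> bool" where
  "bounded_lipschitz g C L \<longleftrightarrow> 0 \<le> L \<and> (\<forall>p\<in>path_pairs. \<bar>g p\<bar> \<le> C) \<and>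
     (\<forall>p\<in>path_pairs. \<forall>q\<in>path_pairs. \<bar>g p - g q\<bar> \<le> L * pair_dist p q)"

lemma bounded_lipschitzD:
  assumes "bounded_lipschitz g C L"
  shows "0 \<le> L" "p \<in> path_pairs \<Longrightarrow> \<bar>g p\<bar> \<le> C"
    "p \<in> path_pairs \<Longrightarrow> q \<in> path_pairs \<Longrightarrow> \<bar>g p - g q\<bar> \<le> L * pair_dist p q"
  using assms unfolding bounded_lipschitz_def by blast+

text \<open>The Lipschitz envelope (Pasch-Hausdorff regularization): for bounded \<open>f\<close> it
  is the largest minorant of \<open>f\<close> on \<open>path_pairs\<close> with Lipschitz constant
  \<open>k\<close>.\<close>

definition inf_convolution ::
    "(path_pair \<Rightarrow> real) \<Rightarrow> nat \<Rightarrow> path_pair \<Rightarrow> real" where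
  "inf_convolution f k p = (INF q\<in>path_pairs. f q + real k * pair_dist p q)"

lemma inf_convolution_bdd:
  assumes "\<And>q. q \<in> path_pairs \<Longrightarrow> \<bar>f q\<bar> \<le> C"
  shows "bdd_below ((\<lambda>q. f q + real k * pair_dist p q) ` path_pairs)"
proof (rule bdd_belowI2)
  fix q assume "q \<in> path_pairs"
  then have "- C \<le> f q" using assms[of q] by linarith
  then show "- C \<le> f q + real k * pair_dist p q"
    using mult_nonneg_nonneg[OF of_nat_0_le_iff[of k] pair_dist_nonneg[of p q]] by linarith
qed

lemma inf_convolution_le:
  assumes f: "\<And>q. q \<in> path_pairs \<Longrightarrow> \<bar>f q\<bar> \<le> C" and p: "p \<in> path_pairs"
  shows "inf_convolution f k p \<le> f p"
  unfolding inf_convolution_def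
  using cINF_lower[OF inf_convolution_bdd[OF f, where k = k and p = p] p] by simp

lemma inf_convolution_ge:
  assumes f: "\<And>q. q \<in> path_pairs \<Longrightarrow> \<bar>f q\<bar> \<le> C" and p: "p \<in> path_pairs"
  shows "- C \<le> inf_convolution f k p"
  unfolding inf_convolution_def
proof (rule cINF_greatest)
  fix q assume "q \<in> path_pairs"
  then have "- C \<le> f q" using f[of q] by linarith
  then show "- C \<le> f q + real k * pair_dist p q"
    using mult_nonneg_nonneg[OF of_nat_0_le_iff[of k] pair_dist_nonneg[of p q]] by linarith
qed (use p in blast)

lemma inf_convolution_lipschitz:
  assumes f: "\<And>q. q \<in> path_pairs \<Longrightarrow> \<bar>f q\<bar> \<le> C"
  shows "bounded_lipschitz (inf_convolution f k) C (real k)"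
proof -
  have le: "inf_convolution f k p \<le> inf_convolution f k r + real k * pair_dist p r"
    if p: "p \<in> path_pairs" and r: "r \<in> path_pairs" for p r
  proof -
    have "inf_convolution f k p - real k * pair_dist p r \<le> inf_convolution f k r"
      unfolding inf_convolution_def[of f k r]
    proof (rule cINF_greatest)
      fix q assume q: "q \<in> path_pairs"
      have "inf_convolution f k p \<le> f q + real k * pair_dist p q"
        unfolding inf_convolution_def by (rule cINF_lower[OF inf_convolution_bdd[OF f] q])
      also have "\<dots> \<le> f q + real k * (pair_dist p r + pair_dist r q)"
        by (intro add_mono mult_left_mono pair_dist_triangle) auto
      finally show "inf_convolution f k p - real k * pair_dist p r \<le> f q + real k * pair_dist r q"
        by (simp add: algebra_simps)
    qed (use p in blast)
    then show ?thesis by simp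
  qed
  have "\<bar>inf_convolution f k p\<bar> \<le> C" if "p \<in> path_pairs" for p
    using inf_convolution_le[of f C p k] inf_convolution_ge[of f C p k] f[of p] f that by force
  moreover have "\<bar>inf_convolution f k p - inf_convolution f k r\<bar> \<le> real k * pair_dist p r"
    if "p \<in> path_pairs" "r \<in> path_pairs" for p r
    using le[OF that] le[OF that(2,1)] pair_dist_sym[of p r] by auto
  ultimately show ?thesis unfolding bounded_lipschitz_def by auto
qed

text \<open>Sequences are taken for \<open>pair_dist\<close> rather than for the M2 topology, since
  this is the metric in which the envelopes are Lipschitz.\<close>

definition lower_semicont :: "(path_pair \<Rightarrow> real) \<Rightarrow> bool" where
  "lower_semicont f \<longleftrightarrow> (\<forall>p ps c. p \<in> path_pairs \<and> range ps \<subseteq> path_pairs \<and>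
     (\<lambda>n. pair_dist (ps n) p) \<longlonglongrightarrow> 0 \<and> c < f p \<longrightarrow> (\<forall>\<^sub>F n in sequentially. c < f (ps n)))"

text \<open>If the envelopes stayed \<open>e\<close> below \<open>f p\<close> for arbitrarily large
  \<open>k\<close>, their near-minimisers would approach \<open>p\<close> while \<open>f\<close>
  remained below \<open>f p - e / 2\<close> along them, which contradicts lower
  semicontinuity.\<close>

lemma inf_convolution_tendsto:
  assumes f: "\<And>q. q \<in> path_pairs \<Longrightarrow> \<bar>f q\<bar> \<le> C" and p: "p \<in> path_pairs" and lsc: "lower_semicont f"
  shows "(\<lambda>k. inf_convolution f k p) \<longlonglongrightarrow> f p"
proof (rule ccontr)
  assume "\<not> ?thesis"
  then obtain e where e: "0 < e" "\<not> (\<forall>\<^sub>F k in sequentially. dist (inf_convolution f k p) (f p) < e)"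
    unfolding tendsto_iff by blast
  have *: "\<exists>k\<ge>n. inf_convolution f k p \<le> f p - e" for n
  proof -
    obtain k where "k \<ge> n" "\<not> dist (inf_convolution f k p) (f p) < e"
      using e(2) unfolding eventually_sequentially by blast
    then show ?thesis
      using inf_convolution_le[of f C p k, OF f p] by (intro exI[of _ k]) (auto simp: dist_real_def)
  qed
  have "\<exists>q. q \<in> path_pairs \<and> f q < f p - e / 2 \<and> real n * pair_dist p q \<le> 2 * C" for n
  proof -
    obtain k where k: "k \<ge> n" "inf_convolution f k p \<le> f p - e" using * by blast
    then have "inf_convolution f k p < f p - e / 2" using e by linarith
    then obtain q where q: "q \<in> path_pairs" "f q + real k * pair_dist p q < f p - e / 2"
      unfolding inf_convolution_def
      by (subst (asm) cINF_less_iff[OF _ inf_convolution_bdd[OF f]]) (use p in auto)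
    have "real n * pair_dist p q \<le> real k * pair_dist p q"
      using k by (intro mult_right_mono pair_dist_nonneg) auto
    moreover have "f q < f p - e / 2"
      using q(2) mult_nonneg_nonneg[OF of_nat_0_le_iff[of k] pair_dist_nonneg[of p q]] by linarith
    \<comment> \<open>A near-minimiser cannot pay more for its distance than the oscillation of
      \<open>f\<close>, so the distance is at most \<open>2 * C / n\<close>.\<close>
    moreover have "real k * pair_dist p q \<le> 2 * C"
      using q(2) f[OF q(1)] f[OF p] e(1) by linarith
    ultimately show ?thesis using q(1) by (intro exI[of _ q]) auto
  qed
  then obtain qs where qs: "\<And>n. qs n \<in> path_pairs" "\<And>n. f (qs n) < f p - e / 2"
      "\<And>n. real n * pair_dist p (qs n) \<le> 2 * C" by metis
  have "(\<lambda>n. pair_dist (qs n) p) \<longlonglongrightarrow> 0"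
  proof (rule tendsto_sandwich[OF _ _ tendsto_const])
    show "(\<lambda>n. 2 * C / real n) \<longlonglongrightarrow> 0" by (rule lim_const_over_n)
    show "\<forall>\<^sub>F n in sequentially. pair_dist (qs n) p \<le> 2 * C / real n"
      using eventually_gt_at_top[of 0]
      by eventually_elim (use qs(3) in \<open>auto simp: field_simps pair_dist_sym\<close>)
  qed (auto simp: pair_dist_nonneg)
  then have "\<forall>\<^sub>F n in sequentially. f p - e / 2 < f (qs n)"
    using lsc[unfolded lower_semicont_def, rule_format, of p qs "f p - e / 2"] p qs(1) e(1) by auto
  then show False using qs(2) by (auto simp: eventually_sequentially dest: less_asym)
qed

lemma lower_semicont_indicator_open:
  assumes "openin wm2_topology U"
  shows "lower_semicont (indicator U)"
  unfolding lower_semicont_def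
proof (intro allI impI, elim conjE)
  fix p ps c assume p: "p \<in> path_pairs" "range ps \<subseteq> path_pairs" "(\<lambda>n. pair_dist (ps n) p) \<longlonglongrightarrow> 0"
    and c: "c < (indicator U p :: real)"
  show "\<forall>\<^sub>F n in sequentially. c < indicator U (ps n)"
  proof (cases "p \<in> U")
    case True
    have "limitin wm2_topology ps p sequentially"
      using p by (intro limitin_wm2_topology) auto
    then have "\<forall>\<^sub>F n in sequentially. ps n \<in> U" using True assms by (auto simp: limitin_def)
    then show ?thesis by (rule eventually_mono) (use c True in auto)
  next
    case False
    then have "c < 0" using c by simp
    then have "c < indicator U (ps n)" for n
      by (rule order.strict_trans2) (rule indicator_pos_le)
    then show ?thesis by simp
  qed
qed

lemma lower_semicont_continuous:
  assumes "continuous_map wm2_topology euclideanreal f"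
  shows "lower_semicont f"
  unfolding lower_semicont_def
proof (intro allI impI, elim conjE)
  fix p ps c assume p: "p \<in> path_pairs" "range ps \<subseteq> path_pairs" "(\<lambda>n. pair_dist (ps n) p) \<longlonglongrightarrow> 0"
    and c: "c < f p"
  have "limitin wm2_topology ps p sequentially"
    using p by (intro limitin_wm2_topology) auto
  then have "limitin euclideanreal (f \<circ> ps) (f p) sequentially"
    using continuous_map_limit[OF assms] by blast
  then have "(f \<circ> ps) \<longlonglongrightarrow> f p" by simp
  then show "\<forall>\<^sub>F n in sequentially. c < f (ps n)"
    using c by (auto dest: order_tendstoD(1) simp: o_def)
qed

lemma measurable_lower_semicont:
  fixes W :: "'a \<Rightarrow> path_pair"
  assumes W: "\<And>\<omega>. \<omega> \<in> space M \<Longrightarrow> W \<omega> \<in> path_pairs"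
    and meas: "\<And>g C L. bounded_lipschitz g C L \<Longrightarrow> (\<lambda>\<omega>. g (W \<omega>)) \<in> borel_measurable M"
    and f: "\<And>q. q \<in> path_pairs \<Longrightarrow> \<bar>f q\<bar> \<le> C" and lsc: "lower_semicont f"
  shows "(\<lambda>\<omega>. f (W \<omega>)) \<in> borel_measurable M"
proof (rule borel_measurable_LIMSEQ_real)
  show "(\<lambda>k. inf_convolution f k (W \<omega>)) \<longlonglongrightarrow> f (W \<omega>)" if "\<omega> \<in> space M" for \<omega>
    by (rule inf_convolution_tendsto[OF f W[OF that] lsc])
  show "(\<lambda>\<omega>. inf_convolution f k (W \<omega>)) \<in> borel_measurable M" for k
    by (rule meas[OF inf_convolution_lipschitz[OF f]])
qed

text \<open>One open set is treated at a time: its indicator is lower semicontinuous, hence along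
  \<open>W\<close> a pointwise limit of Lipschitz functionals, whose measurability is given. No
  structure of the whole sigma-algebra enters.\<close>

lemma measurable_borel_of_wm2:
  fixes W :: "'a \<Rightarrow> path_pair"
  assumes W: "\<And>\<omega>. \<omega> \<in> space M \<Longrightarrow> W \<omega> \<in> path_pairs"
    and meas: "\<And>g C L. bounded_lipschitz g C L \<Longrightarrow> (\<lambda>\<omega>. g (W \<omega>)) \<in> borel_measurable M"
  shows "W \<in> M \<rightarrow>\<^sub>M borel_of wm2_topology"
  unfolding borel_of_def
proof (rule measurable_measure_of)
  show "{U. openin wm2_topology U} \<subseteq> Pow (topspace wm2_topology)"
  proof
    fix U assume "U \<in> {U. openin wm2_topology U}"
    then show "U \<in> Pow (topspace wm2_topology)" by (intro PowI openin_subset) (rule CollectD)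
  qed
  show "W \<in> space M \<rightarrow> topspace wm2_topology"
    using W by (auto simp: topspace_m2_topology)
  fix U assume "U \<in> {U. openin wm2_topology U}"
  then have "lower_semicont (indicator U)" by (simp add: lower_semicont_indicator_open)
  then have "(\<lambda>\<omega>. indicator U (W \<omega>) :: real) \<in> borel_measurable M"
    by (intro measurable_lower_semicont[where C = 1 and W = W, OF W meas]) (auto split: split_indicator)
  then have "(\<lambda>\<omega>. indicator U (W \<omega>) :: real) -` {1} \<inter> space M \<in> sets M"
    by (rule measurable_sets) auto
  also have "(\<lambda>\<omega>. indicator U (W \<omega>) :: real) -` {1} \<inter> space M = W -` U \<inter> space M"
    by (auto simp: indicator_def split: if_splits)
  finally show "W -` U \<inter> space M \<in> sets M" .
qed

text \<open>The open-set half of the portmanteau theorem, for functionals. Some minorant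
  \<open>?f k\<close> already integrates above \<open>c\<close> against the limit; its expectations
  converge, and passing from \<open>?f k\<close> back to \<open>f\<close> only increases
  them.\<close>

lemma liminf_expectation_lower_semicont:
  fixes W :: "'i \<Rightarrow> 'a \<Rightarrow> path_pair"
    and V :: "'b \<Rightarrow> path_pair"
  assumes "prob_space M" "prob_space N"
    and W: "\<forall>\<^sub>F i in F. (\<forall>\<omega>\<in>space M. W i \<omega> \<in> path_pairs) \<and>
        (\<forall>g C L. bounded_lipschitz g C L \<longrightarrow> (\<lambda>\<omega>. g (W i \<omega>)) \<in> borel_measurable M)"
    and V: "\<And>\<omega>. \<omega> \<in> space N \<Longrightarrow> V \<omega> \<in> path_pairs"
    and mV: "\<And>g C L. bounded_lipschitz g C L \<Longrightarrow> (\<lambda>\<omega>. g (V \<omega>)) \<in> borel_measurable N"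
    and lim: "\<And>g C L. bounded_lipschitz g C L \<Longrightarrow>
        ((\<lambda>i. \<integral>\<omega>. g (W i \<omega>) \<partial>M) \<longlongrightarrow> (\<integral>\<omega>. g (V \<omega>) \<partial>N)) F"
    and f: "\<And>q. q \<in> path_pairs \<Longrightarrow> \<bar>f q\<bar> \<le> C" and lsc: "lower_semicont f"
    and c: "c < (\<integral>\<omega>. f (V \<omega>) \<partial>N)"
  shows "\<forall>\<^sub>F i in F. c < (\<integral>\<omega>. f (W i \<omega>) \<partial>M)"
proof -
  interpret M: prob_space M by fact
  interpret N: prob_space N by fact
  let ?f = "inf_convolution f"
  have lip: "bounded_lipschitz (?f k) C (real k)" for k
    by (rule inf_convolution_lipschitz[OF f])
  have "(\<lambda>k. \<integral>\<omega>. ?f k (V \<omega>) \<partial>N) \<longlonglongrightarrow> (\<integral>\<omega>. f (V \<omega>) \<partial>N)"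
  proof (rule integral_dominated_convergence[where w = "\<lambda>_. C"])
    show "(\<lambda>\<omega>. f (V \<omega>)) \<in> borel_measurable N" by (rule measurable_lower_semicont[where W = V, OF V mV f lsc])
    show "AE \<omega> in N. norm (?f k (V \<omega>)) \<le> C" for k
      by (intro AE_I2) (use bounded_lipschitzD(2)[OF lip V] in simp)
    show "AE \<omega> in N. (\<lambda>k. ?f k (V \<omega>)) \<longlonglongrightarrow> f (V \<omega>)"
      using inf_convolution_tendsto[OF f V lsc] by (intro AE_I2)
  qed (use lip mV in auto)
  then have "\<forall>\<^sub>F k in sequentially. c < (\<integral>\<omega>. ?f k (V \<omega>) \<partial>N)"
    using c by (rule order_tendstoD)
  then obtain k where "c < (\<integral>\<omega>. ?f k (V \<omega>) \<partial>N)"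
    by (auto simp: eventually_sequentially)
  then have "\<forall>\<^sub>F i in F. c < (\<integral>\<omega>. ?f k (W i \<omega>) \<partial>M)"
    using lim[OF lip] by (auto dest: order_tendstoD)
  then show ?thesis using W
  proof eventually_elim
    case (elim i)
    have b: "\<bar>?f k p\<bar> \<le> C" if "p \<in> path_pairs" for p
      by (rule bounded_lipschitzD(2)[OF lip that])
    have "(\<lambda>\<omega>. ?f k (W i \<omega>)) \<in> borel_measurable M" using elim lip by blast
    moreover have "(\<lambda>\<omega>. f (W i \<omega>)) \<in> borel_measurable M"
      by (rule measurable_lower_semicont[OF _ _ f lsc]) (use elim in blast)+
    ultimately have "(\<integral>\<omega>. ?f k (W i \<omega>) \<partial>M) \<le> (\<integral>\<omega>. f (W i \<omega>) \<partial>M)"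
      using elim(2) f b inf_convolution_le[where f = f and C = C and k = k, OF f]
      by (intro integral_mono M.integrable_const_bound[where B = C])
         (auto simp del: mem_Times_iff intro!: AE_I2)
    then show ?case using elim by linarith
  qed
qed

lemma converges_weakly_wm2:
  fixes W :: "'i \<Rightarrow> 'a \<Rightarrow> path_pair"
    and V :: "'b \<Rightarrow> path_pair"
  assumes "prob_space M" "prob_space N"
    and W: "\<forall>\<^sub>F i in F. (\<forall>\<omega>\<in>space M. W i \<omega> \<in> path_pairs) \<and>
        (\<forall>g C L. bounded_lipschitz g C L \<longrightarrow> (\<lambda>\<omega>. g (W i \<omega>)) \<in> borel_measurable M)"
    and V: "\<And>\<omega>. \<omega> \<in> space N \<Longrightarrow> V \<omega> \<in> path_pairs"
    and mV: "\<And>g C L. bounded_lipschitz g C L \<Longrightarrow> (\<lambda>\<omega>. g (V \<omega>)) \<in> borel_measurable N"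
    and lim: "\<And>g C L. bounded_lipschitz g C L \<Longrightarrow>
        ((\<lambda>i. \<integral>\<omega>. g (W i \<omega>) \<partial>M) \<longlongrightarrow> (\<integral>\<omega>. g (V \<omega>) \<partial>N)) F"
  shows "converges_weakly wm2_topology M W N V F"
  unfolding converges_weakly_def
proof (intro conjI allI impI)
  show "\<forall>\<^sub>F i in F. W i \<in> M \<rightarrow>\<^sub>M borel_of wm2_topology"
    using W by eventually_elim (auto intro!: measurable_borel_of_wm2)
  show "V \<in> N \<rightarrow>\<^sub>M borel_of wm2_topology" by (rule measurable_borel_of_wm2[where W = V, OF V mV])
next
  fix f :: "path_pair \<Rightarrow> real"
  assume *: "continuous_map wm2_topology euclideanreal f \<and> bounded (f ` topspace wm2_topology)"
  then obtain C where C: "\<And>q. q \<in> path_pairs \<Longrightarrow> \<bar>f q\<bar> \<le> C"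
    by (force simp: bounded_iff topspace_m2_topology)
  note lim_lsc = liminf_expectation_lower_semicont[OF assms]
  show "((\<lambda>i. \<integral>\<omega>. f (W i \<omega>) \<partial>M) \<longlongrightarrow> (\<integral>\<omega>. f (V \<omega>) \<partial>N)) F"
  proof (rule order_tendstoI)
    fix c assume "c < (\<integral>\<omega>. f (V \<omega>) \<partial>N)"
    then show "\<forall>\<^sub>F i in F. c < (\<integral>\<omega>. f (W i \<omega>) \<partial>M)"
      using * C by (intro lim_lsc[where C = C] lower_semicont_continuous) auto
  next
    fix c assume "(\<integral>\<omega>. f (V \<omega>) \<partial>N) < c"
    then have "\<forall>\<^sub>F i in F. - c < (\<integral>\<omega>. - f (W i \<omega>) \<partial>M)"
      using * C by (intro lim_lsc[where C = C] lower_semicont_continuous continuous_map_minus) auto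
    then show "\<forall>\<^sub>F i in F. (\<integral>\<omega>. f (W i \<omega>) \<partial>M) < c" by simp
  qed
qed

text \<open>A common form for the rescaled walk, the block path, the sampled Brownian path and the
  deterministic limit: values that change \<open>c\<close> times per unit of time plus a continuous
  part \<open>b\<close>. Regularity, continuity in \<open>v\<close> and measurability are thus
  proved once. With vanishing \<open>v\<close>, as in \<open>drift_path\<close>, the rate is
  arbitrary and set to 1.\<close>

definition step_path :: "real \<Rightarrow> (nat \<Rightarrow> real) \<Rightarrow> (real \<Rightarrow> real) \<Rightarrow> real \<Rightarrow> real" where
  "step_path c v b = (\<lambda>t\<in>{0..}. v (nat \<lfloor>c * t\<rfloor>) + b t)"

abbreviation drift_path :: "(real \<Rightarrow> real) \<Rightarrow> real \<Rightarrow> real" where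
  "drift_path \<equiv> step_path 1 (\<lambda>_. 0)"

lemma floor_eventually_at_right:
  "\<forall>\<^sub>F s in at_right (t::real). \<lfloor>s\<rfloor> = \<lfloor>t\<rfloor>"
  unfolding eventually_at_right_field
proof (intro exI conjI allI impI)
  show "t < of_int \<lfloor>t\<rfloor> + 1" by linarith
  fix s assume "t < s" "s < of_int \<lfloor>t\<rfloor> + 1"
  then show "\<lfloor>s\<rfloor> = \<lfloor>t\<rfloor>" by linarith
qed

text \<open>The ceiling minus 1 covers both cases: it equals the floor of \<open>t\<close> unless
  \<open>t\<close> is an integer, where the left limit of the floor is \<open>t - 1\<close>.\<close>

lemma floor_eventually_at_left:
  "\<forall>\<^sub>F s in at_left (t::real). \<lfloor>s\<rfloor> = \<lceil>t\<rceil> - 1"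
  unfolding eventually_at_left_field
proof (intro exI conjI allI impI)
  show "of_int \<lceil>t\<rceil> - 1 < t" by linarith
  fix s assume "of_int \<lceil>t\<rceil> - 1 < s" "s < t"
  then show "\<lfloor>s\<rfloor> = \<lceil>t\<rceil> - 1" by linarith
qed

lemma step_path_cadlag:
  assumes c: "0 < c" and b: "continuous_on UNIV b"
  shows "step_path c v b \<in> cadlag_paths"
  unfolding cadlag_paths_def
proof (intro CollectI conjI allI impI)
  show "step_path c v b \<in> extensional {0..}" by (simp add: step_path_def)
next
  fix t :: real assume t: "0 \<le> t"
  have "filterlim (\<lambda>s. c * s) (at_right (c * t)) (at_right t)"
    unfolding filterlim_at using c
    by (auto intro!: tendsto_intros simp: eventually_at_filter)
  then have "\<forall>\<^sub>F s in at_right t. \<lfloor>c * s\<rfloor> = \<lfloor>c * t\<rfloor>"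
    by (rule eventually_compose_filterlim[OF floor_eventually_at_right])
  moreover have "\<forall>\<^sub>F s in at_right t. t < s" by (simp add: eventually_at_filter)
  ultimately have ev: "\<forall>\<^sub>F s in at_right t. v (nat \<lfloor>c * t\<rfloor>) + b s = step_path c v b s"
    by eventually_elim (use t in \<open>auto simp: step_path_def\<close>)
  have "(b \<longlongrightarrow> b t) (at t within {t<..})"
    using b by (auto simp: continuous_on_eq_continuous_at isCont_def intro: tendsto_within_subset)
  then have "((\<lambda>s. v (nat \<lfloor>c * t\<rfloor>) + b s) \<longlongrightarrow> v (nat \<lfloor>c * t\<rfloor>) + b t) (at_right t)"
    by (intro tendsto_intros)
  also have "v (nat \<lfloor>c * t\<rfloor>) + b t = step_path c v b t" using t by (simp add: step_path_def)
  finally show "(step_path c v b \<longlongrightarrow> step_path c v b t) (at_right t)"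
    using ev by (rule Lim_transform_eventually)
next
  fix t :: real assume t: "0 < t"
  have "filterlim (\<lambda>s. c * s) (at_left (c * t)) (at_left t)"
    unfolding filterlim_at using c
    by (auto intro!: tendsto_intros simp: eventually_at_filter)
  then have "\<forall>\<^sub>F s in at_left t. \<lfloor>c * s\<rfloor> = \<lceil>c * t\<rceil> - 1"
    by (rule eventually_compose_filterlim[OF floor_eventually_at_left])
  moreover have "\<forall>\<^sub>F s in at_left t. 0 < s" 
    unfolding eventually_at_left_field using t by (intro exI[of _ 0]) auto
  ultimately have ev: "\<forall>\<^sub>F s in at_left t. v (nat (\<lceil>c * t\<rceil> - 1)) + b s = step_path c v b s"
    by eventually_elim (auto simp: step_path_def)
  have "(b \<longlongrightarrow> b t) (at t within {..<t})"
    using b by (auto simp: continuous_on_eq_continuous_at isCont_def intro: tendsto_within_subset)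
  then have "((\<lambda>s. v (nat (\<lceil>c * t\<rceil> - 1)) + b s) \<longlongrightarrow> v (nat (\<lceil>c * t\<rceil> - 1)) + b t) (at_left t)"
    by (intro tendsto_intros)
  then show "\<exists>l. (step_path c v b \<longlongrightarrow> l) (at_left t)"
    using ev by (intro exI) (rule Lim_transform_eventually)
qed

text \<open>Only finitely many values are visible on \<open>[0, T]\<close>, so pointwise convergence
  of the values is uniform there.\<close>

lemma step_path_unif_dist_tendsto:
  assumes "0 < c" and v: "\<And>j. (\<lambda>n. vs n j) \<longlonglongrightarrow> v j"
  shows "(\<lambda>n. unif_dist (step_path c (vs n) b) (step_path c v b)) \<longlonglongrightarrow> 0"
  unfolding unif_dist_tendsto_0_iff
proof (intro allI impI)
  fix T e :: real assume e: "0 < e"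
  have "\<forall>\<^sub>F n in sequentially. \<bar>vs n j - v j\<bar> < e" for j
    using v[of j] e unfolding tendsto_iff dist_real_def by blast
  then have "\<forall>\<^sub>F n in sequentially. \<forall>j\<in>{..nat \<lfloor>c * T\<rfloor>}. \<bar>vs n j - v j\<bar> < e"
    by (intro eventually_ball_finite) auto
  then show "\<forall>\<^sub>F n in sequentially. \<forall>t. 0 \<le> t \<and> t \<le> T \<longrightarrow>
      \<bar>step_path c (vs n) b t - step_path c v b t\<bar> \<le> e"
  proof (rule eventually_mono, intro allI impI)
    fix n t assume *: "\<forall>j\<in>{..nat \<lfloor>c * T\<rfloor>}. \<bar>vs n j - v j\<bar> < e" and t: "0 \<le> t \<and> t \<le> T"
    have "nat \<lfloor>c * t\<rfloor> \<le> nat \<lfloor>c * T\<rfloor>"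
      using t \<open>0 < c\<close> by (intro nat_mono floor_mono mult_left_mono) auto
    then have "\<bar>vs n (nat \<lfloor>c * t\<rfloor>) - v (nat \<lfloor>c * t\<rfloor>)\<bar> < e" using * by blast
    then show "\<bar>step_path c (vs n) b t - step_path c v b t\<bar> \<le> e"
      using t by (simp add: step_path_def)
  qed
qed

lemma bounded_lipschitz_tendsto:
  assumes g: "bounded_lipschitz g C L" and "\<And>n. ps n \<in> path_pairs" "p \<in> path_pairs"
    and lim: "(\<lambda>n. pair_dist (ps n) p) \<longlonglongrightarrow> 0"
  shows "(\<lambda>n. g (ps n)) \<longlonglongrightarrow> g p"
proof -
  have "(\<lambda>n. L * pair_dist (ps n) p) \<longlonglongrightarrow> L * 0" by (intro tendsto_intros lim)
  then have "(\<lambda>n. L * pair_dist (ps n) p) \<longlonglongrightarrow> 0" by simp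
  moreover have "\<forall>\<^sub>F n in sequentially. norm (g (ps n) - g p) \<le> L * pair_dist (ps n) p"
    unfolding real_norm_def
    by (rule always_eventually, rule allI) (rule bounded_lipschitzD(3)[OF g assms(2,3)])
  ultimately have "(\<lambda>n. g (ps n) - g p) \<longlonglongrightarrow> 0" by (rule Lim_null_comparison[rotated])
  then show ?thesis by (simp add: LIM_zero_iff)
qed

text \<open>The functional is read as a function \<open>G\<close> of the sequence of value pairs. By
  the preceding lemmas \<open>G\<close> is continuous for the product topology, and a
  sequence-valued map is Borel as soon as its coordinates are. This replaces any sigma-algebra on
  the path space.\<close>

lemma measurable_step_paths:
  fixes V V' :: "nat \<Rightarrow> 'a \<Rightarrow> real"
  assumes g: "bounded_lipschitz g C L" and c: "0 < c" "0 < c'"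
    and b: "continuous_on UNIV b" "continuous_on UNIV b'"
    and V: "\<And>j. V j \<in> borel_measurable M" "\<And>j. V' j \<in> borel_measurable M"
  shows "(\<lambda>\<omega>. g (step_path c (\<lambda>j. V j \<omega>) b, step_path c' (\<lambda>j. V' j \<omega>) b')) \<in> borel_measurable M"
proof -
  define G where "G w = g (step_path c (\<lambda>j. fst (w j)) b, step_path c' (\<lambda>j. snd (w j)) b')"
    for w :: "nat \<Rightarrow> real \<times> real"
  have "continuous_on UNIV G"
    unfolding continuous_on_sequentially o_def
  proof (intro allI ballI impI, elim conjE)
    fix ws :: "nat \<Rightarrow> nat \<Rightarrow> real \<times> real" and w assume "ws \<longlonglongrightarrow> w"
    then have "(\<lambda>n. ws n j) \<longlonglongrightarrow> w j" for j
      by (auto intro: continuous_on_tendsto_compose[OF continuous_on_product_coordinates])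
    note lims = tendsto_fst[OF this] tendsto_snd[OF this]
    have "(\<lambda>n. unif_dist (step_path c (\<lambda>j. fst (ws n j)) b) (step_path c (\<lambda>j. fst (w j)) b)
        + unif_dist (step_path c' (\<lambda>j. snd (ws n j)) b') (step_path c' (\<lambda>j. snd (w j)) b'))
        \<longlonglongrightarrow> 0 + 0"
      by (intro tendsto_intros step_path_unif_dist_tendsto c lims)
    then show "(\<lambda>n. G (ws n)) \<longlonglongrightarrow> G w"
      unfolding G_def using c b
      by (intro bounded_lipschitz_tendsto[OF g]) (auto simp: pair_dist_def intro!: step_path_cadlag)
  qed
  then have "G \<in> borel_measurable borel" by (rule borel_measurable_continuous_onI)
  moreover have "(\<lambda>\<omega> j. (V j \<omega>, V' j \<omega>)) \<in> borel_measurable M"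
    by (rule measurable_coordinatewise_then_product) (intro borel_measurable_Pair V)
  ultimately have "(\<lambda>\<omega>. G (\<lambda>j. (V j \<omega>, V' j \<omega>))) \<in> borel_measurable M"
    by (rule measurable_compose[rotated])
  then show ?thesis by (simp add: G_def)
qed

section \<open>Sums of independent random variables\<close>

text \<open>Borel-Cantelli along powers of 2: the event with index \<open>k + 1\<close> is meant to
  control every \<open>n\<close> in the dyadic interval that ends at \<open>2 ^ (k + 1)\<close>, so
  a geometric bound at dyadic scales is enough.\<close>

lemma (in prob_space) AE_tendsto_0_dyadic:
  fixes F :: "nat \<Rightarrow> 'a \<Rightarrow> real" and c :: "real \<Rightarrow> real"
  assumes A: "\<And>e k. 0 < e \<Longrightarrow> A e k \<in> sets M"
    and le: "\<And>e k. 0 < e \<Longrightarrow> prob (A e k) \<le> c e * (1 / 2) ^ k"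
    and F: "\<And>e \<omega> k n. 0 < e \<Longrightarrow> \<omega> \<in> space M - A e (k + 1) \<Longrightarrow> 2 ^ k \<le> n \<Longrightarrow> n < 2 ^ (k + 1) \<Longrightarrow>
      \<bar>F n \<omega>\<bar> < 4 * e"
  shows "AE \<omega> in M. (\<lambda>n. F n \<omega>) \<longlonglongrightarrow> 0"
proof -
  have ae: "AE \<omega> in M. \<forall>\<^sub>F n in sequentially. \<bar>F n \<omega>\<bar> < 4 * e" if e: "0 < e" for e :: real
  proof -
    have "summable (\<lambda>k. prob (A e k))"
      by (rule summable_comparison_test'[where g = "\<lambda>k. c e * (1 / 2) ^ k" and N = 0])
         (use le[OF e] in \<open>auto intro!: summable_mult summable_geometric\<close>)
    then have "AE \<omega> in M. \<forall>\<^sub>F k in sequentially. \<omega> \<in> space M - A e k"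
      using A[OF e] by (intro borel_cantelli_AE1) (auto simp: emeasure_eq_measure)
    then show ?thesis
    proof eventually_elim
      case (elim \<omega>)
      then obtain k0 where k0: "\<And>k. k \<ge> k0 \<Longrightarrow> \<omega> \<in> space M - A e k"
        unfolding eventually_sequentially by blast
      show ?case
      proof (rule eventually_sequentiallyI)
        fix n :: nat assume n: "(2::nat) ^ k0 \<le> n"
        have "1 \<le> n" using n by (metis le_trans one_le_numeral one_le_power)
        then obtain k where k: "(2::nat) ^ k \<le> n" "n < 2 ^ (k + 1)"
          using ex_power_ivl1[of 2 n] by auto
        have "(2::nat) ^ k0 < 2 ^ (k + 1)" using n k by linarith
        then have "k0 < k + 1" by (simp only: power_strict_increasing_iff)
        then show "\<bar>F n \<omega>\<bar> < 4 * e" by (intro F[OF e k0 k]) simp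
      qed
    qed
  qed
  have "AE \<omega> in M. \<forall>m. \<forall>\<^sub>F n in sequentially. \<bar>F n \<omega>\<bar> < 4 * (1 / real (Suc m))"
    unfolding AE_all_countable by (intro allI ae) simp
  then show ?thesis
  proof eventually_elim
    case (elim \<omega>)
    show ?case
    proof (rule tendstoI)
      fix e :: real assume "0 < e"
      then obtain m where m: "1 / real (Suc m) < e / 4" using nat_approx_posE[of "e / 4"] by auto
      show "\<forall>\<^sub>F n in sequentially. dist (F n \<omega>) 0 < e"
        using spec[OF elim, of m] by eventually_elim (use m in \<open>simp add: dist_real_def\<close>)
    qed
  qed
qed

lemma expectation_eq_if_distr_eq:
  fixes V :: "'a \<Rightarrow> real" and f :: "real \<Rightarrow> real"
  assumes "distr M borel V = distr M borel W"
    and [measurable]: "V \<in> borel_measurable M" "W \<in> borel_measurable M" "f \<in> borel_measurable borel"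
  shows "(\<integral>\<omega>. f (V \<omega>) \<partial>M) = (\<integral>\<omega>. f (W \<omega>) \<partial>M)"
    and "integrable M (\<lambda>\<omega>. f (V \<omega>)) \<longleftrightarrow> integrable M (\<lambda>\<omega>. f (W \<omega>))"
  using integral_distr[of V M borel f] integral_distr[of W M borel f]
    integrable_distr_eq[of V M borel f] integrable_distr_eq[of W M borel f] assms(1) by simp_all

text \<open>Independence and a common variance, as much as the maximal inequality and the strong law
  use. The locale serves a second time for the centred truncated squares.\<close>

locale centered_sequence = prob_space M for M :: "'a measure" +
  fixes Y :: "nat \<Rightarrow> 'a \<Rightarrow> real" and v :: real
  assumes indep: "indep_vars (\<lambda>_. borel) Y UNIV"
    and square_integrable: "\<And>i. integrable M (\<lambda>\<omega>. (Y i \<omega>)\<^sup>2)"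
    and mean_0: "\<And>i. expectation (Y i) = 0"
    and second_moment: "\<And>i. expectation (\<lambda>\<omega>. (Y i \<omega>)\<^sup>2) = v"
begin

lemma Y_measurable [measurable]: "Y i \<in> borel_measurable M"
  using indep unfolding indep_vars_def by auto

lemma Y_integrable: "integrable M (Y i)"
  by (rule square_integrable_imp_integrable[OF _ square_integrable]) measurable

lemma v_nonneg: "0 \<le> v"
  using second_moment[of 0, symmetric] by simp

lemma sum_moments:
  assumes "finite A"
  shows "integrable M (\<lambda>\<omega>. \<Sum>i\<in>A. Y i \<omega>) \<and> expectation (\<lambda>\<omega>. \<Sum>i\<in>A. Y i \<omega>) = 0 \<and>
    integrable M (\<lambda>\<omega>. (\<Sum>i\<in>A. Y i \<omega>)\<^sup>2) \<and> expectation (\<lambda>\<omega>. (\<Sum>i\<in>A. Y i \<omega>)\<^sup>2) = real (card A) * v"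
  using assms
proof induction
  case (insert x A)
  let ?S = "\<lambda>\<omega>. \<Sum>i\<in>A. Y i \<omega>"
  have ind: "indep_var borel (Y x) borel ?S"
    using insert indep_vars_subset[OF indep] by (intro indep_vars_sum) auto
  have int: "integrable M (\<lambda>\<omega>. Y x \<omega> * ?S \<omega>)"
    using insert by (intro indep_var_integrable[OF ind] Y_integrable) auto
  have E: "expectation (\<lambda>\<omega>. Y x \<omega> * ?S \<omega>) = 0"
    using insert by (subst indep_var_lebesgue_integral[OF ind]) (auto simp: Y_integrable mean_0)
  have eq: "(\<Sum>i\<in>insert x A. Y i \<omega>)\<^sup>2 = (Y x \<omega>)\<^sup>2 + 2 * (Y x \<omega> * ?S \<omega>) + (?S \<omega>)\<^sup>2" for \<omega>
    using insert by (simp add: power2_sum)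
  show ?case
    unfolding eq using insert int E
    by (simp add: Y_integrable square_integrable mean_0 second_moment algebra_simps)
qed simp

lemma sum_Chebyshev:
  assumes "finite A" "0 < a"
  shows "prob {\<omega>\<in>space M. a \<le> \<bar>\<Sum>i\<in>A. Y i \<omega>\<bar>} \<le> real (card A) * v / a\<^sup>2"
  using Chebyshev_inequality[of "\<lambda>\<omega>. \<Sum>i\<in>A. Y i \<omega>" a] sum_moments[OF assms(1)] assms(2) by simp

lemma sum_measurable_PiM [measurable]:
  fixes A B :: "nat set"
  assumes "B \<subseteq> A"
  shows "(\<lambda>y. \<Sum>i\<in>B. y i) \<in> borel_measurable (\<Pi>\<^sub>M i\<in>A. borel :: real measure)"
  using assms by (intro borel_measurable_sum) (auto intro!: measurable_component_singleton)

text \<open>Split by the first \<open>k\<close> at which the sum reaches \<open>2 * r\<close>. The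
  remaining increments are independent of this event and, by Chebyshev's inequality, add up to less
  than \<open>r\<close> with probability at least 1/2, in which case the full sum still exceeds
  \<open>r\<close>. The offset \<open>a\<close> makes the inequality available inside any
  block.\<close>

lemma ottaviani:
  fixes a n :: nat and r :: real
  defines "S \<equiv> \<lambda>k \<omega>. \<Sum>i\<in>{a..<a + k}. Y i \<omega>"
  assumes r: "0 < r" and small: "real n * v / r\<^sup>2 \<le> 1 / 2"
  shows "prob {\<omega>\<in>space M. \<exists>k\<le>n. 2 * r \<le> \<bar>S k \<omega>\<bar>} \<le> 2 * prob {\<omega>\<in>space M. r \<le> \<bar>S n \<omega>\<bar>}"
proof -
  have [measurable]: "S k \<in> borel_measurable M" for k unfolding S_def by measurable
  define E where "E k = {\<omega>\<in>space M. 2 * r \<le> \<bar>S k \<omega>\<bar> \<and> (\<forall>j<k. \<bar>S j \<omega>\<bar> < 2 * r)}" for k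
  define H where "H k = {\<omega>\<in>space M. \<bar>\<Sum>i\<in>{a + k..<a + n}. Y i \<omega>\<bar> < r}" for k
  have [measurable]: "E k \<in> sets M" "H k \<in> sets M" for k unfolding E_def H_def by measurable
  have disj: "disjoint_family_on E {..n}"
    unfolding disjoint_family_on_def E_def
    by (auto simp: not_less[symmetric]) (metis linorder_neqE_nat not_less)
  have cover: "{\<omega>\<in>space M. \<exists>k\<le>n. 2 * r \<le> \<bar>S k \<omega>\<bar>} = (\<Union>k\<le>n. E k)"
  proof (intro equalityI subsetI)
    fix \<omega> assume "\<omega> \<in> {\<omega>\<in>space M. \<exists>k\<le>n. 2 * r \<le> \<bar>S k \<omega>\<bar>}"
    then obtain k where k: "\<omega> \<in> space M" "k \<le> n" "2 * r \<le> \<bar>S k \<omega>\<bar>" by blast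
    define m where "m = (LEAST k. 2 * r \<le> \<bar>S k \<omega>\<bar>)"
    have "2 * r \<le> \<bar>S m \<omega>\<bar>" unfolding m_def by (rule LeastI[of _ k]) (rule k)
    moreover have "\<bar>S j \<omega>\<bar> < 2 * r" if "j < m" for j
      using not_less_Least[of j "\<lambda>k. 2 * r \<le> \<bar>S k \<omega>\<bar>"] that unfolding m_def by auto
    moreover have "m \<le> n" using Least_le[of "\<lambda>k. 2 * r \<le> \<bar>S k \<omega>\<bar>" k] k unfolding m_def by simp
    ultimately show "\<omega> \<in> (\<Union>k\<le>n. E k)" using k(1) unfolding E_def by auto
  qed (auto simp: E_def)
  have PH: "1 / 2 \<le> prob (H k)" if "k \<le> n" for k
  proof -
    have "prob {\<omega>\<in>space M. r \<le> \<bar>\<Sum>i\<in>{a + k..<a + n}. Y i \<omega>\<bar>} \<le> real (card {a + k..<a + n}) * v / r\<^sup>2"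
      by (rule sum_Chebyshev) (use r in auto)
    also have "\<dots> \<le> real n * v / r\<^sup>2"
      using v_nonneg by (intro divide_right_mono mult_right_mono) auto
    also note small
    finally have "prob {\<omega>\<in>space M. r \<le> \<bar>\<Sum>i\<in>{a + k..<a + n}. Y i \<omega>\<bar>} \<le> 1 / 2" .
    moreover have "H k = space M - {\<omega>\<in>space M. r \<le> \<bar>\<Sum>i\<in>{a + k..<a + n}. Y i \<omega>\<bar>}"
      unfolding H_def by auto
    ultimately show ?thesis by (simp add: prob_compl)
  qed
  have indEH: "prob (E k \<inter> H k) = prob (E k) * prob (H k)" if "k \<le> n" for k
  proof -
    let ?A = "{a..<a + k}" and ?B = "{a + k..<a + n}"
    define E' where "E' = {y \<in> space (\<Pi>\<^sub>M i\<in>?A. borel :: real measure).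
      2 * r \<le> \<bar>\<Sum>i\<in>?A. y i\<bar> \<and> (\<forall>j<k. \<bar>\<Sum>i\<in>{a..<a + j}. y i\<bar> < 2 * r)}"
    define H' where "H' = {y \<in> space (\<Pi>\<^sub>M i\<in>?B. borel :: real measure). \<bar>\<Sum>i\<in>?B. y i\<bar> < r}"
    \<comment> \<open>Replacing \<open>j\<close> by \<open>min j k\<close> keeps the summation range
      inside \<open>?A\<close> for every \<open>j\<close>, so measurability holds without a side
      condition.\<close>
    have [measurable]: "(\<lambda>y. \<Sum>i\<in>{a..<a + min j k}. y i) \<in> borel_measurable (\<Pi>\<^sub>M i\<in>?A. borel :: real measure)" for j
      by (rule sum_measurable_PiM) auto
    have "E' = {y \<in> space (\<Pi>\<^sub>M i\<in>?A. borel :: real measure).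
      2 * r \<le> \<bar>\<Sum>i\<in>{a..<a + min k k}. y i\<bar> \<and> (\<forall>j<k. \<bar>\<Sum>i\<in>{a..<a + min j k}. y i\<bar> < 2 * r)}"
      unfolding E'_def by simp
    also have "\<dots> \<in> sets (\<Pi>\<^sub>M i\<in>?A. borel)" by measurable
    finally have "E' \<in> sets (\<Pi>\<^sub>M i\<in>?A. borel)" .
    moreover have "H' \<in> sets (\<Pi>\<^sub>M i\<in>?B. borel)"
      unfolding H'_def by measurable
    moreover have "indep_var (\<Pi>\<^sub>M i\<in>?A. borel) (\<lambda>\<omega>. restrict (\<lambda>i. Y i \<omega>) ?A)
        (\<Pi>\<^sub>M i\<in>?B. borel) (\<lambda>\<omega>. restrict (\<lambda>i. Y i \<omega>) ?B)"
      by (rule indep_var_restrict[OF indep]) auto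
    ultimately have "prob ((\<lambda>\<omega>. (restrict (\<lambda>i. Y i \<omega>) ?A, restrict (\<lambda>i. Y i \<omega>) ?B)) -` (E' \<times> H') \<inter> space M)
      = prob ((\<lambda>\<omega>. restrict (\<lambda>i. Y i \<omega>) ?A) -` E' \<inter> space M) *
        prob ((\<lambda>\<omega>. restrict (\<lambda>i. Y i \<omega>) ?B) -` H' \<inter> space M)"
      by (intro indep_varD)
    moreover have sub: "(\<Sum>i\<in>{a..<a + j}. restrict (\<lambda>i. Y i \<omega>) ?A i) = S j \<omega>" if "j \<le> k" for j \<omega>
      unfolding S_def using that by (intro sum.cong) auto
    have "(\<lambda>\<omega>. restrict (\<lambda>i. Y i \<omega>) ?A) -` E' \<inter> space M = E k"
      unfolding E'_def E_def using sub by (auto simp: space_PiM)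
    moreover have "(\<lambda>\<omega>. restrict (\<lambda>i. Y i \<omega>) ?B) -` H' \<inter> space M = H k"
      unfolding H'_def H_def by (auto simp: space_PiM)
    moreover have "(\<lambda>\<omega>. (restrict (\<lambda>i. Y i \<omega>) ?A, restrict (\<lambda>i. Y i \<omega>) ?B)) -` (E' \<times> H') \<inter> space M
      = ((\<lambda>\<omega>. restrict (\<lambda>i. Y i \<omega>) ?A) -` E' \<inter> space M) \<inter> ((\<lambda>\<omega>. restrict (\<lambda>i. Y i \<omega>) ?B) -` H' \<inter> space M)"
      by auto
    ultimately show ?thesis by simp
  qed
  have "prob {\<omega>\<in>space M. \<exists>k\<le>n. 2 * r \<le> \<bar>S k \<omega>\<bar>} = (\<Sum>k\<le>n. prob (E k))"
    unfolding cover using disj by (intro finite_measure_finite_Union) auto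
  also have "\<dots> \<le> (\<Sum>k\<le>n. 2 * prob (E k \<inter> H k))"
  proof (rule sum_mono)
    fix k assume "k \<in> {..n}"
    then have "prob (E k) * 1 \<le> prob (E k) * (2 * prob (H k))"
      using PH[of k] by (intro mult_left_mono) auto
    then show "prob (E k) \<le> 2 * prob (E k \<inter> H k)" using indEH[of k] \<open>k \<in> {..n}\<close> by simp
  qed
  also have "\<dots> = 2 * prob (\<Union>k\<le>n. E k \<inter> H k)"
    using disj
    by (subst finite_measure_finite_Union) (auto simp: disjoint_family_on_def sum_distrib_left)
  also have "prob (\<Union>k\<le>n. E k \<inter> H k) \<le> prob {\<omega>\<in>space M. r \<le> \<bar>S n \<omega>\<bar>}"
  proof (rule finite_measure_mono)
    show "(\<Union>k\<le>n. E k \<inter> H k) \<subseteq> {\<omega>\<in>space M. r \<le> \<bar>S n \<omega>\<bar>}"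
    proof
      fix \<omega> assume "\<omega> \<in> (\<Union>k\<le>n. E k \<inter> H k)"
      then obtain k where k: "k \<le> n" "\<omega> \<in> E k" "\<omega> \<in> H k" by auto
      have "S n \<omega> = S k \<omega> + (\<Sum>i\<in>{a + k..<a + n}. Y i \<omega>)"
        unfolding S_def using k(1) by (subst sum.atLeastLessThan_concat) auto
      then show "\<omega> \<in> {\<omega>\<in>space M. r \<le> \<bar>S n \<omega>\<bar>}" using k(2,3) unfolding E_def H_def by auto
    qed
  qed measurable
  finally show ?thesis by simp
qed

text \<open>When the smallness condition of \<open>ottaviani\<close> fails, the right-hand side
  exceeds 1 and the bound is trivial.\<close>

lemma maximal_inequality:
  fixes n :: nat and r :: real
  assumes r: "0 < r"
  shows "prob {\<omega>\<in>space M. \<exists>k\<le>n. 2 * r \<le> \<bar>\<Sum>i<k. Y i \<omega>\<bar>} \<le> 4 * (real n * v / r\<^sup>2)"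
proof (cases "real n * v / r\<^sup>2 \<le> 1 / 2")
  case True
  have "prob {\<omega>\<in>space M. \<exists>k\<le>n. 2 * r \<le> \<bar>\<Sum>i<k. Y i \<omega>\<bar>} \<le> 2 * prob {\<omega>\<in>space M. r \<le> \<bar>\<Sum>i<n. Y i \<omega>\<bar>}"
    using ottaviani[of r n 0] r True by (simp add: lessThan_atLeast0)
  also have "\<dots> \<le> 2 * (real n * v / r\<^sup>2)" using sum_Chebyshev[of "{..<n}" r] r by simp
  also have "\<dots> \<le> 4 * (real n * v / r\<^sup>2)" using v_nonneg by (intro mult_right_mono) auto
  finally show ?thesis .
next
  case False
  then have "1 \<le> 4 * (real n * v / r\<^sup>2)" by linarith
  then show ?thesis using prob_le_1 order_trans by blast
qed

text \<open>With second moments the maximal inequality at scale \<open>2 ^ k\<close> gives a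
  probability of order \<open>2 ^ (- k)\<close>, which is summable.\<close>

lemma strong_law: "AE \<omega> in M. (\<lambda>n. (\<Sum>i<n. Y i \<omega>) / real n) \<longlonglongrightarrow> 0"
proof (rule AE_tendsto_0_dyadic)
  let ?A = "\<lambda>e k. {\<omega>\<in>space M. \<exists>j\<le>2 ^ k. 2 * (e * 2 ^ k) \<le> \<bar>\<Sum>i<j. Y i \<omega>\<bar>}"
  fix e :: real assume e: "0 < e"
  show "?A e k \<in> sets M" for k by measurable
  show "prob (?A e k) \<le> 4 * v / e\<^sup>2 * (1 / 2) ^ k" for k
  proof -
    have "prob (?A e k) \<le> 4 * (real (2 ^ k) * v / (e * 2 ^ k)\<^sup>2)"
      using maximal_inequality[of "e * 2 ^ k" "2 ^ k"] e by simp
    also have "\<dots> = 4 * v / e\<^sup>2 * (1 / 2) ^ k"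
      using e by (simp add: field_simps power2_eq_square)
    finally show ?thesis .
  qed
  fix \<omega> k and n :: nat assume \<omega>: "\<omega> \<in> space M - ?A e (k + 1)" and k: "2 ^ k \<le> n" "n < 2 ^ (k + 1)"
  have "\<bar>\<Sum>i<n. Y i \<omega>\<bar> < 2 * (e * 2 ^ (k + 1))"
    using \<omega> less_imp_le[OF k(2)] by (auto simp: not_le dest: spec[of _ n])
  \<comment> \<open>The factor 4 is a 2 from the maximal inequality times a 2 from comparing
    \<open>2 ^ (k + 1)\<close> with \<open>2 ^ k \<le> n\<close>.\<close>
  also have "\<dots> = 4 * e * real (2 ^ k)" by simp
  also have "\<dots> \<le> 4 * e * real n" using k(1) e by (intro mult_left_mono) (simp_all only: of_nat_le_iff)
  finally show "\<bar>(\<Sum>i<n. Y i \<omega>) / real n\<bar> < 4 * e"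
    using order_less_le_trans[OF _ k(1), of 0] by (simp add: field_simps)
qed

end

section \<open>From almost sure limits to uniform control in probability\<close>

lemma (in prob_space) prob_tendsto_0_if_AE:
  assumes [measurable]: "\<And>n. A n \<in> sets M"
    and "AE \<omega> in M. \<forall>\<^sub>F n in sequentially. \<omega> \<notin> A n"
  shows "(\<lambda>n. prob (A n)) \<longlonglongrightarrow> 0"
proof -
  have "(\<lambda>n. \<integral>\<omega>. indicator (A n) \<omega> \<partial>M) \<longlonglongrightarrow> (\<integral>\<omega>. (0::real) \<partial>M)"
  proof (rule integral_dominated_convergence[where w = "\<lambda>_. 1"])
    show "AE \<omega> in M. (\<lambda>n. indicator (A n) \<omega> :: real) \<longlonglongrightarrow> 0"
      using assms(2) by eventually_elim
        (auto intro!: tendsto_eventually elim!: eventually_mono split: split_indicator)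
  qed (auto split: split_indicator)
  then show ?thesis by simp
qed

text \<open>Past a random \<open>k0\<close> each \<open>W k\<close> is at most \<open>d * k\<close>,
  hence at most \<open>d * n\<close>; the finitely many earlier values have a fixed maximum
  \<open>C\<close>, which \<open>d * n\<close> eventually exceeds.\<close>

lemma (in prob_space) prob_running_max_tendsto_0:
  fixes W :: "nat \<Rightarrow> 'a \<Rightarrow> real"
  assumes [measurable]: "\<And>n. W n \<in> borel_measurable M"
    and lim: "AE \<omega> in M. (\<lambda>n. W n \<omega> / real n) \<longlonglongrightarrow> 0" and d: "0 < d"
  shows "(\<lambda>n. prob {\<omega>\<in>space M. \<exists>k\<le>n. d * real n < \<bar>W k \<omega>\<bar>}) \<longlonglongrightarrow> 0"
proof (rule prob_tendsto_0_if_AE)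
  show "AE \<omega> in M. \<forall>\<^sub>F n in sequentially. \<omega> \<notin> {\<omega>\<in>space M. \<exists>k\<le>n. d * real n < \<bar>W k \<omega>\<bar>}"
    using lim
  proof eventually_elim
    case (elim \<omega>)
    then have "\<forall>\<^sub>F n in sequentially. \<bar>W n \<omega> / real n\<bar> < d"
      using d unfolding tendsto_iff dist_real_def by simp
    then obtain k0 where k0: "\<And>k. k \<ge> k0 \<Longrightarrow> \<bar>W k \<omega> / real k\<bar> < d"
      unfolding eventually_sequentially by blast
    define C where "C = Max ((\<lambda>k. \<bar>W k \<omega>\<bar>) ` {..k0})"
    have C: "\<bar>W k \<omega>\<bar> \<le> C" if "k \<le> k0" for k unfolding C_def using that by (intro Max_ge) auto
    have "\<forall>\<^sub>F n in sequentially. C / d \<le> real n"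
      using filterlim_real_sequentially unfolding filterlim_at_top by blast
    then show ?case
    proof eventually_elim
      case (elim n)
      have "\<bar>W k \<omega>\<bar> \<le> d * real n" if "k \<le> n" for k
      proof (cases "k \<le> k0")
        case True
        then show ?thesis using C[OF True] elim d by (simp add: field_simps)
      next
        case False
        then have "\<bar>W k \<omega>\<bar> \<le> d * real k" using k0[of k] by (simp add: field_simps)
        also have "\<dots> \<le> d * real n" using that d by simp
        finally show ?thesis .
      qed
      then show ?case by (auto simp: not_less)
    qed
  qed
qed measurable

section \<open>Joint laws of independent families and coordinatewise coupling\<close>

lemma joint_law_eq:
  fixes V :: "'i \<Rightarrow> 'a \<Rightarrow> real" and W :: "'i \<Rightarrow> 'b \<Rightarrow> real"
  assumes "prob_space M" "prob_space N"
    and V: "prob_space.indep_vars M (\<lambda>_. borel) V I" and W: "prob_space.indep_vars N (\<lambda>_. borel) W I"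
    and eq: "\<And>i. i \<in> I \<Longrightarrow> distr M borel (V i) = distr N borel (W i)"
  shows "distr M (\<Pi>\<^sub>M i\<in>I. borel) (\<lambda>\<omega>. \<lambda>i\<in>I. V i \<omega>) = distr N (\<Pi>\<^sub>M i\<in>I. borel) (\<lambda>\<omega>. \<lambda>i\<in>I. W i \<omega>)"
proof -
  interpret M: prob_space M by fact
  interpret N: prob_space N by fact
  have rv: "\<And>i. i \<in> I \<Longrightarrow> V i \<in> borel_measurable M" "\<And>i. i \<in> I \<Longrightarrow> W i \<in> borel_measurable N"
    using V W unfolding M.indep_vars_def N.indep_vars_def by auto
  show ?thesis
  proof (cases "I = {}")
    \<comment> \<open>With an empty index set both laws are the unit mass at the only function in
      the product.\<close>
    case True
    interpret MD: prob_space "distr M (\<Pi>\<^sub>M i\<in>I. borel :: real measure) (\<lambda>\<omega>. \<lambda>i\<in>I. V i \<omega>)"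
      by (rule M.prob_space_distr) (use rv in measurable)
    interpret ND: prob_space "distr N (\<Pi>\<^sub>M i\<in>I. borel :: real measure) (\<lambda>\<omega>. \<lambda>i\<in>I. W i \<omega>)"
      by (rule N.prob_space_distr) (use rv in measurable)
    show ?thesis
    proof (rule measure_eqI)
      fix A assume "A \<in> sets (distr M (\<Pi>\<^sub>M i\<in>I. borel :: real measure) (\<lambda>\<omega>. \<lambda>i\<in>I. V i \<omega>))"
      then have "A \<in> sets (\<Pi>\<^sub>M i\<in>{}. borel :: real measure)" using True by simp
      then have "A = {} \<or> A = {\<lambda>_. undefined}" by (auto simp: PiM_empty)
      then show "emeasure (distr M (\<Pi>\<^sub>M i\<in>I. borel :: real measure) (\<lambda>\<omega>. \<lambda>i\<in>I. V i \<omega>)) A =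
        emeasure (distr N (\<Pi>\<^sub>M i\<in>I. borel :: real measure) (\<lambda>\<omega>. \<lambda>i\<in>I. W i \<omega>)) A"
        using MD.emeasure_space_1 ND.emeasure_space_1 True by (auto simp: space_PiM)
    qed simp
  next
    case False
    have "distr M (\<Pi>\<^sub>M i\<in>I. borel) (\<lambda>\<omega>. \<lambda>i\<in>I. V i \<omega>) = (\<Pi>\<^sub>M i\<in>I. distr M borel (V i))"
      using V by (subst (asm) M.indep_vars_iff_distr_eq_PiM'[OF False]) (use rv in auto)
    also have "\<dots> = (\<Pi>\<^sub>M i\<in>I. distr N borel (W i))" by (intro PiM_cong eq refl)
    also have "\<dots> = distr N (\<Pi>\<^sub>M i\<in>I. borel) (\<lambda>\<omega>. \<lambda>i\<in>I. W i \<omega>)"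
      using W by (subst (asm) N.indep_vars_iff_distr_eq_PiM'[OF False]) (use rv in auto)
    finally show ?thesis .
  qed
qed

text \<open>Events that concern single coordinates are cylinders, and a finite intersection of
  cylinders over distinct coordinates is a cylinder whose measure is the product.\<close>

lemma indep_vars_PiM_components:
  fixes U :: "'i \<Rightarrow> 'a \<Rightarrow> real"
  assumes \<Omega>: "\<And>i. prob_space (\<Omega> i)" and U: "\<And>i. i \<in> I \<Longrightarrow> U i \<in> borel_measurable (\<Omega> i)" and I: "finite I"
  shows "prob_space.indep_vars (PiM I \<Omega>) (\<lambda>_. borel) (\<lambda>i \<omega>. U i (\<omega> i)) I"
    and "\<And>i. i \<in> I \<Longrightarrow> distr (PiM I \<Omega>) borel (\<lambda>\<omega>. U i (\<omega> i)) = distr (\<Omega> i) borel (U i)"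
proof -
  interpret P: prob_space "PiM I \<Omega>" by (rule prob_space_PiM) (rule \<Omega>)
  interpret PP: product_prob_space \<Omega> I by (rule product_prob_spaceI) (rule \<Omega>)
  show d: "distr (PiM I \<Omega>) borel (\<lambda>\<omega>. U i (\<omega> i)) = distr (\<Omega> i) borel (U i)" if "i \<in> I" for i
  proof -
    have "distr (\<Omega> i) borel (U i) = distr (distr (PiM I \<Omega>) (\<Omega> i) (\<lambda>\<omega>. \<omega> i)) borel (U i)"
      using \<Omega> that by (subst distr_PiM_component) auto
    also have "\<dots> = distr (PiM I \<Omega>) borel (\<lambda>\<omega>. U i (\<omega> i))"
      using that U by (subst distr_distr) (auto simp: o_def)
    finally show ?thesis by simp
  qed
  have rv: "(\<lambda>\<omega>. U i (\<omega> i)) \<in> borel_measurable (PiM I \<Omega>)" if "i \<in> I" for i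
    using that U by (intro measurable_compose[OF measurable_component_singleton]) auto
  show "P.indep_vars (\<lambda>_. borel) (\<lambda>i \<omega>. U i (\<omega> i)) I"
    unfolding P.indep_vars_def2 
  proof (intro conjI ballI rv P.indep_setsI)
    fix i assume "i \<in> I"
    then show "{(\<lambda>\<omega>. U i (\<omega> i)) -` A \<inter> space (PiM I \<Omega>) |A. A \<in> sets borel} \<subseteq> P.events"
      using rv by (auto intro: measurable_sets)
  next
    fix A J assume J: "J \<noteq> {}" "J \<subseteq> I" "finite J"
      and "\<forall>j\<in>J. A j \<in> {(\<lambda>\<omega>. U j (\<omega> j)) -` A \<inter> space (PiM I \<Omega>) |A. A \<in> sets borel}"
    then obtain B where B: "\<And>j. j \<in> J \<Longrightarrow> A j = (\<lambda>\<omega>. U j (\<omega> j)) -` B j \<inter> space (PiM I \<Omega>)"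
      "\<And>j. j \<in> J \<Longrightarrow> B j \<in> sets borel"
      by (simp add: image_iff) metis
    define C where "C j = U j -` B j \<inter> space (\<Omega> j)" for j
    have C: "C j \<in> sets (\<Omega> j)" if "j \<in> J" for j
      unfolding C_def using U J B(2) that by (auto intro: measurable_sets)
    have A: "A j = prod_emb I \<Omega> {j} (\<Pi>\<^sub>E i\<in>{j}. C i)" if "j \<in> J" for j
      using that J by (auto simp: B(1)[OF that] prod_emb_def C_def space_PiM PiE_iff)
    have eA: "P.prob (A j) = measure (\<Omega> j) (C j)" if "j \<in> J" for j
      unfolding A[OF that] using that J C \<Omega>
      by (subst PP.measure_PiM_emb) auto
    have "(\<Inter>j\<in>J. A j) = prod_emb I \<Omega> J (\<Pi>\<^sub>E i\<in>J. C i)"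
      using J subsetD[OF J(2)] by (auto simp: B(1) prod_emb_def C_def space_PiM PiE_iff)
    then have "P.prob (\<Inter>j\<in>J. A j) = (\<Prod>j\<in>J. measure (\<Omega> j) (C j))"
      using J C \<Omega> by (simp add: PP.measure_PiM_emb)
    then show "P.prob (\<Inter>j\<in>J. A j) = (\<Prod>j\<in>J. P.prob (A j))" using eA by simp
  qed
qed

lemma tendsto_expectation_indep:
  fixes V :: "nat \<Rightarrow> nat \<Rightarrow> 'a \<Rightarrow> real" and W :: "nat \<Rightarrow> 'b \<Rightarrow> real"
    and G :: "(nat \<Rightarrow> real) \<Rightarrow> real"
  assumes "prob_space M" "prob_space N" and I: "finite I"
    and V: "\<And>n. prob_space.indep_vars M (\<lambda>_. borel) (V n) I"
    and W: "prob_space.indep_vars N (\<lambda>_. borel) W I"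
    and conv: "\<And>i. i \<in> I \<Longrightarrow> weak_conv_m (\<lambda>n. distr M borel (V n i)) (distr N borel (W i))"
    and bdd: "\<And>w. \<bar>G w\<bar> \<le> C"
    and cont: "\<And>ws w. (\<And>i. i \<in> I \<Longrightarrow> (\<lambda>n. ws n i) \<longlonglongrightarrow> w i) \<Longrightarrow> (\<lambda>n. G (ws n)) \<longlonglongrightarrow> G w"
  shows "(\<lambda>n. \<integral>\<omega>. G (\<lambda>i. V n i \<omega>) \<partial>M) \<longlonglongrightarrow> (\<integral>\<omega>. G (\<lambda>i. W i \<omega>) \<partial>N)"
proof -
  interpret M: prob_space M by fact
  interpret N: prob_space N by fact
  have rv: "\<And>n i. i \<in> I \<Longrightarrow> V n i \<in> borel_measurable M" "\<And>i. i \<in> I \<Longrightarrow> W i \<in> borel_measurable N"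
    using V W unfolding M.indep_vars_def N.indep_vars_def by auto
  \<comment> \<open>Applied to a constant sequence, the continuity hypothesis says that
    \<open>G\<close> depends only on the coordinates in \<open>I\<close>.\<close>
  have G_cong: "G w = G w'" if "\<And>i. i \<in> I \<Longrightarrow> w i = w' i" for w w'
    using cont[of "\<lambda>_. w" w'] that by (simp add: LIMSEQ_const_iff)
  have "continuous_on UNIV G"
    unfolding continuous_on_sequentially o_def
    by (auto intro!: cont intro: continuous_on_tendsto_compose[OF continuous_on_product_coordinates])
  then have "G \<in> borel_measurable borel" by (rule borel_measurable_continuous_onI)
  \<comment> \<open>\<open>G\<close> is Borel on the space of all sequences, whereas the laws live
    on the product over \<open>I\<close>. Extension by 0 links the two and, by
    \<open>G_cong\<close>, changes no value of \<open>G\<close>.\<close>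
  moreover have "(\<lambda>w i. if i \<in> I then w i else 0) \<in> borel_measurable (\<Pi>\<^sub>M i\<in>I. borel :: real measure)"
  proof (rule measurable_coordinatewise_then_product)
    show "(\<lambda>w. if i \<in> I then w i else 0) \<in> borel_measurable (\<Pi>\<^sub>M i\<in>I. borel :: real measure)" for i
      by (cases "i \<in> I") auto
  qed
  ultimately have "(\<lambda>w. G (\<lambda>i. if i \<in> I then w i else 0)) \<in> borel_measurable (\<Pi>\<^sub>M i\<in>I. borel :: real measure)"
    by (rule measurable_compose[rotated])
  moreover have "(\<lambda>w. G (\<lambda>i. if i \<in> I then w i else 0)) = G"
    by (intro ext G_cong) auto
  ultimately have G [measurable]: "G \<in> borel_measurable (\<Pi>\<^sub>M i\<in>I. borel :: real measure)" by simp
  \<comment> \<open>\<open>Q\<close> gathers what Skorohod's theorem yields for coordinate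
    \<open>i\<close>, so that spaces and variables can be chosen for all \<open>i\<close> at once.
    Outside \<open>I\<close> it asks for a probability space only.\<close>
  define Q where "Q i \<Omega> U Z \<longleftrightarrow> prob_space \<Omega> \<and> (i \<in> I \<longrightarrow> (\<forall>n. U n \<in> borel_measurable \<Omega>) \<and>
    (\<forall>n. distr \<Omega> borel (U n) = distr M borel (V n i)) \<and>
    Z \<in> borel_measurable \<Omega> \<and> distr \<Omega> borel Z = distr N borel (W i) \<and>
    (\<forall>x\<in>space \<Omega>. (\<lambda>n. U n x) \<longlonglongrightarrow> Z x))"
    for i and \<Omega> :: "real measure" and U :: "nat \<Rightarrow> real \<Rightarrow> real" and Z :: "real \<Rightarrow> real"
  have "\<exists>\<Omega> U Z. Q i \<Omega> U Z" for i
  proof (cases "i \<in> I")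
    case True
    have "real_distribution (distr M borel (V n i))" for n using True rv by auto
    moreover have "real_distribution (distr N borel (W i))" using True rv by auto
    ultimately show ?thesis using Skorohod[OF _ _ conv[OF True]] True unfolding Q_def by auto
  next
    case False
    have "prob_space (return borel (0::real))" by (rule prob_space_return) simp
    then show ?thesis using False unfolding Q_def by blast
  qed
  then obtain \<Omega> U Z where "\<And>i. Q i (\<Omega> i) (U i) (Z i)" by metis
  then have \<Omega>: "\<And>i. prob_space (\<Omega> i)"
    and U: "\<And>n i. i \<in> I \<Longrightarrow> U i n \<in> borel_measurable (\<Omega> i)"
      "\<And>n i. i \<in> I \<Longrightarrow> distr (\<Omega> i) borel (U i n) = distr M borel (V n i)"
    and Z: "\<And>i. i \<in> I \<Longrightarrow> Z i \<in> borel_measurable (\<Omega> i)"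
      "\<And>i. i \<in> I \<Longrightarrow> distr (\<Omega> i) borel (Z i) = distr N borel (W i)"
    and lim: "\<And>i x. i \<in> I \<Longrightarrow> x \<in> space (\<Omega> i) \<Longrightarrow> (\<lambda>n. U i n x) \<longlonglongrightarrow> Z i x"
    unfolding Q_def by blast+
  interpret P: prob_space "PiM I \<Omega>" by (rule prob_space_PiM) (rule \<Omega>)
  have mU [measurable]: "(\<lambda>x. \<lambda>i\<in>I. U i n (x i)) \<in> PiM I \<Omega> \<rightarrow>\<^sub>M (\<Pi>\<^sub>M i\<in>I. borel)" for n
    by (intro measurable_restrict measurable_compose[OF measurable_component_singleton]) (auto intro: U)
  have mZ [measurable]: "(\<lambda>x. \<lambda>i\<in>I. Z i (x i)) \<in> PiM I \<Omega> \<rightarrow>\<^sub>M (\<Pi>\<^sub>M i\<in>I. borel)"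
    by (intro measurable_restrict measurable_compose[OF measurable_component_singleton]) (auto intro: Z)
  have mV [measurable]: "(\<lambda>\<omega>. \<lambda>i\<in>I. V n i \<omega>) \<in> M \<rightarrow>\<^sub>M (\<Pi>\<^sub>M i\<in>I. borel)" for n
    by (intro measurable_restrict rv)
  have mW [measurable]: "(\<lambda>\<omega>. \<lambda>i\<in>I. W i \<omega>) \<in> N \<rightarrow>\<^sub>M (\<Pi>\<^sub>M i\<in>I. borel)"
    by (intro measurable_restrict rv)
  \<comment> \<open>Independence makes the joint law a function of the marginals, so coupling each
    coordinate over \<open>n\<close> on its own space is enough; nothing has to be coupled across
    coordinates.\<close>
  have transfer: "(\<integral>\<omega>. G (\<lambda>i. R i \<omega>) \<partial>L) = (\<integral>x. G (\<lambda>i\<in>I. T i (x i)) \<partial>PiM I \<Omega>)"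
    if L: "prob_space L" "prob_space.indep_vars L (\<lambda>_. borel) R I"
      and m [measurable]: "(\<lambda>\<omega>. \<lambda>i\<in>I. R i \<omega>) \<in> L \<rightarrow>\<^sub>M (\<Pi>\<^sub>M i\<in>I. borel)"
      and T: "\<And>i. i \<in> I \<Longrightarrow> T i \<in> borel_measurable (\<Omega> i)"
        "\<And>i. i \<in> I \<Longrightarrow> distr (\<Omega> i) borel (T i) = distr L borel (R i)"
    for L :: "'c measure" and R :: "nat \<Rightarrow> 'c \<Rightarrow> real" and T
  proof -
    have [measurable]: "(\<lambda>x. \<lambda>i\<in>I. T i (x i)) \<in> PiM I \<Omega> \<rightarrow>\<^sub>M (\<Pi>\<^sub>M i\<in>I. borel)"
      by (intro measurable_restrict measurable_compose[OF measurable_component_singleton]) (auto intro: T)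
    have "(\<integral>\<omega>. G (\<lambda>i. R i \<omega>) \<partial>L) = (\<integral>\<omega>. G (\<lambda>i\<in>I. R i \<omega>) \<partial>L)"
      by (intro Bochner_Integration.integral_cong refl G_cong) auto
    also have "\<dots> = (\<integral>w. G w \<partial>distr L (\<Pi>\<^sub>M i\<in>I. borel) (\<lambda>\<omega>. \<lambda>i\<in>I. R i \<omega>))"
      by (subst integral_distr) auto
    also have "distr L (\<Pi>\<^sub>M i\<in>I. borel) (\<lambda>\<omega>. \<lambda>i\<in>I. R i \<omega>)
        = distr (PiM I \<Omega>) (\<Pi>\<^sub>M i\<in>I. borel) (\<lambda>x. \<lambda>i\<in>I. T i (x i))"
      using indep_vars_PiM_components[where \<Omega> = \<Omega> and I = I and U = T] \<Omega> T I
      by (intro joint_law_eq P.prob_space_axioms L) auto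
    also have "(\<integral>w. G w \<partial>\<dots>) = (\<integral>x. G (\<lambda>i\<in>I. T i (x i)) \<partial>PiM I \<Omega>)"
      by (subst integral_distr) auto
    finally show ?thesis .
  qed
  have eV: "(\<integral>\<omega>. G (\<lambda>i. V n i \<omega>) \<partial>M) = (\<integral>x. G (\<lambda>i\<in>I. U i n (x i)) \<partial>PiM I \<Omega>)" for n
    by (rule transfer[OF M.prob_space_axioms V mV U])
  have eW: "(\<integral>\<omega>. G (\<lambda>i. W i \<omega>) \<partial>N) = (\<integral>x. G (\<lambda>i\<in>I. Z i (x i)) \<partial>PiM I \<Omega>)"
    by (rule transfer[OF N.prob_space_axioms W mW Z])
  show ?thesis
    unfolding eV eW
  proof (rule integral_dominated_convergence[where w = "\<lambda>_. C"])
    show "AE x in PiM I \<Omega>. (\<lambda>n. G (\<lambda>i\<in>I. U i n (x i))) \<longlonglongrightarrow> G (\<lambda>i\<in>I. Z i (x i))"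
      by (intro AE_I2 cont) (auto intro!: lim simp: space_PiM)
  qed (use bdd in auto)
qed

text \<open>The centred Gaussian law with standard deviation \<open>\<bar>c\<bar>\<close>, written
  as an image so that moments and scaling refer back to the standard normal law.\<close>

abbreviation normal_image :: "real \<Rightarrow> real measure" where
  "normal_image c \<equiv> distr std_normal_distribution borel (\<lambda>x. c * x)"

locale iid_centered = centered_sequence +
  assumes ident: "\<And>i. distr M borel (Y i) = distr M borel (Y 0)" and v_pos: "0 < v"
begin

text \<open>The characteristic function of a sum of i.i.d. terms depends on their number only, so
  the position of a block is irrelevant for its law.\<close>

lemma distr_block_sum:
  "distr M borel (\<lambda>\<omega>. \<Sum>i\<in>{a..<a + k}. Y i \<omega>) = distr M borel (\<lambda>\<omega>. \<Sum>i<k. Y i \<omega>)"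
proof (rule Levy_uniqueness)
  have "char (distr M borel (\<lambda>\<omega>. \<Sum>i\<in>A. Y i \<omega>)) t = char (distr M borel (Y 0)) t ^ card A" for A t
  proof -
    have "char (distr M borel (\<lambda>\<omega>. \<Sum>i\<in>A. Y i \<omega>)) t = (\<Prod>i\<in>A. char (distr M borel (Y i)) t)"
      by (intro char_distr_sum indep_vars_subset[OF indep]) simp
    also have "\<dots> = (\<Prod>i\<in>A. char (distr M borel (Y 0)) t)"
      by (intro prod.cong refl) (subst ident, rule refl)
    finally show ?thesis by simp
  qed
  then show "char (distr M borel (\<lambda>\<omega>. \<Sum>i\<in>{a..<a + k}. Y i \<omega>)) = char (distr M borel (\<lambda>\<omega>. \<Sum>i<k. Y i \<omega>))"
    by (intro ext) simp
qed (auto intro!: real_distribution_distr)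

text \<open>Slutsky's theorem with varying block lengths. In law the block starts at 0, so the sum
  is \<open>cs n * sqrt (ks n * v)\<close> times a normalized sum with \<open>ks n\<close> terms.
  Representing the central limit theorem by pointwise convergent variables lets the factor and the
  index move together.\<close>

lemma scaled_block_sum_weak_conv:
  fixes as ks :: "nat \<Rightarrow> nat" and cs :: "nat \<Rightarrow> real"
  assumes ks: "filterlim ks at_top sequentially" and cs: "(\<lambda>n. cs n * sqrt (real (ks n) * v)) \<longlonglongrightarrow> c"
  shows "weak_conv_m (\<lambda>n. distr M borel (\<lambda>\<omega>. cs n * (\<Sum>i\<in>{as n..<as n + ks n}. Y i \<omega>)))
    (normal_image c)"
proof -
  have var: "variance (Y i) = (sqrt v)\<^sup>2" for i
    using v_nonneg by (simp add: mean_0 second_moment)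
  have clt: "weak_conv_m (\<lambda>n. distr M borel (\<lambda>\<omega>. (\<Sum>i<n. Y i \<omega>) / sqrt (real n * (sqrt v)\<^sup>2))) std_normal_distribution"
    by (rule central_limit_theorem_zero_mean[OF indep mean_0 _ square_integrable var ident]) (use v_pos in simp)
  define S where "S n \<omega> = (\<Sum>i<n. Y i \<omega>) / sqrt (real n * v)" for n \<omega>
  have [measurable]: "S n \<in> borel_measurable M" for n unfolding S_def by measurable
  have "weak_conv_m (\<lambda>n. distr M borel (S n)) std_normal_distribution"
    using clt v_nonneg by (simp add: S_def[abs_def])
  then obtain \<Omega> :: "real measure" and U :: "nat \<Rightarrow> real \<Rightarrow> real" and Z where
      "prob_space \<Omega>" and U [measurable]: "\<And>n. U n \<in> borel_measurable \<Omega>"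
      and dU: "\<And>n. distr \<Omega> borel (U n) = distr M borel (S n)"
      and Z [measurable]: "Z \<in> borel_measurable \<Omega>"
      and dZ: "distr \<Omega> borel Z = std_normal_distribution"
      and lim: "\<And>x. x \<in> space \<Omega> \<Longrightarrow> (\<lambda>n. U n x) \<longlonglongrightarrow> Z x"
    using Skorohod[of "\<lambda>n. distr M borel (S n)" std_normal_distribution]
    by (auto simp: real_dist_normal_dist intro: that)
  interpret \<Omega>: prob_space \<Omega> by fact
  let ?T = "\<lambda>n \<omega>. cs n * (\<Sum>i\<in>{as n..<as n + ks n}. Y i \<omega>)"
  interpret std_normal: real_distribution std_normal_distribution by (rule real_dist_normal_dist)
  have rd: "real_distribution (normal_image c)"
    by (intro std_normal.real_distribution_distr) simp
  show ?thesis
  proof (rule integral_bdd_continuous_conv_imp_weak_conv)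
    fix f :: "real \<Rightarrow> real" assume f: "\<And>x. isCont f x" "\<And>x. \<bar>f x\<bar> \<le> 1"
    have [measurable]: "f \<in> borel_measurable borel"
      using f(1) by (intro borel_measurable_continuous_onI) (simp add: continuous_on_eq_continuous_at)
    let ?b = "\<lambda>n. cs n * sqrt (real (ks n) * v)"
    have eq: "integral\<^sup>L (distr M borel (?T n)) f = (\<integral>x. f (?b n * U (ks n) x) \<partial>\<Omega>)" if "0 < ks n" for n
    proof -
      have "integral\<^sup>L (distr M borel (?T n)) f = (\<integral>y. f (cs n * y) \<partial>distr M borel (\<lambda>\<omega>. \<Sum>i\<in>{as n..<as n + ks n}. Y i \<omega>))"
        by (simp add: integral_distr)
      also have "\<dots> = (\<integral>\<omega>. f (cs n * (\<Sum>i<ks n. Y i \<omega>)) \<partial>M)"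
        unfolding distr_block_sum by (simp add: integral_distr)
      also have "\<dots> = (\<integral>\<omega>. f (?b n * S (ks n) \<omega>) \<partial>M)"
        using that v_pos by (intro Bochner_Integration.integral_cong) (auto simp: S_def)
      also have "\<dots> = (\<integral>y. f (?b n * y) \<partial>distr M borel (S (ks n)))"
        by (simp add: integral_distr)
      also have "\<dots> = (\<integral>x. f (?b n * U (ks n) x) \<partial>\<Omega>)"
        unfolding dU[symmetric] by (simp add: integral_distr)
      finally show ?thesis .
    qed
    have "(\<lambda>n. \<integral>x. f (?b n * U (ks n) x) \<partial>\<Omega>) \<longlonglongrightarrow> (\<integral>x. f (c * Z x) \<partial>\<Omega>)"
    proof (rule integral_dominated_convergence[where w = "\<lambda>_. 1"])
      show "AE x in \<Omega>. (\<lambda>n. f (?b n * U (ks n) x)) \<longlonglongrightarrow> f (c * Z x)"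
        using f(1) by (intro AE_I2 isCont_tendsto_compose[of _ f] tendsto_mult cs
            filterlim_compose[OF lim ks]) auto
    qed (use f(2) in auto)
    also have "(\<integral>x. f (c * Z x) \<partial>\<Omega>) = integral\<^sup>L (normal_image c) f"
      unfolding dZ[symmetric] by (simp add: integral_distr)
    finally show "(\<lambda>n. integral\<^sup>L (distr M borel (?T n)) f) \<longlonglongrightarrow> integral\<^sup>L (normal_image c) f"
    proof (rule Lim_transform_eventually)
      have "\<forall>\<^sub>F n in sequentially. 0 < ks n"
        using ks[unfolded filterlim_at_top, rule_format, of 1] by (rule eventually_mono) simp
      then show "\<forall>\<^sub>F n in sequentially. (\<integral>x. f (?b n * U (ks n) x) \<partial>\<Omega>) = integral\<^sup>L (distr M borel (?T n)) f"
        by eventually_elim (simp add: eq)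
    qed
  qed (use rd in \<open>auto intro!: real_distribution_distr\<close>)
qed

end

section \<open>Sample second moments\<close>

context iid_centered
begin

lemma expectation_compose:
  fixes f :: "real \<Rightarrow> real"
  assumes "f \<in> borel_measurable borel"
  shows "expectation (\<lambda>\<omega>. f (Y i \<omega>)) = expectation (\<lambda>\<omega>. f (Y 0 \<omega>))"
  by (rule expectation_eq_if_distr_eq(1)[OF ident Y_measurable Y_measurable assms])

definition truncated_mean :: "real \<Rightarrow> real" where
  "truncated_mean C = expectation (\<lambda>\<omega>. min ((Y 0 \<omega>)\<^sup>2) C)"

lemma truncated_integrable: "0 \<le> C \<Longrightarrow> integrable M (\<lambda>\<omega>. min ((Y i \<omega>)\<^sup>2) C)"
  by (rule integrable_const_bound[where B = C]) auto

lemma truncated_expectation: "expectation (\<lambda>\<omega>. min ((Y i \<omega>)\<^sup>2) C) = truncated_mean C"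
  unfolding truncated_mean_def by (rule expectation_compose) measurable

lemma truncated_mean_le: "0 \<le> C \<Longrightarrow> truncated_mean C \<le> v"
  unfolding truncated_mean_def second_moment[of 0, symmetric]
  by (intro integral_mono truncated_integrable square_integrable) auto

lemma truncated_mean_tendsto: "(\<lambda>n. truncated_mean (real n)) \<longlonglongrightarrow> v"
  unfolding truncated_mean_def second_moment[of 0, symmetric]
proof (rule integral_dominated_convergence[where w = "\<lambda>\<omega>. (Y 0 \<omega>)\<^sup>2"])
  show "AE \<omega> in M. (\<lambda>n. min ((Y 0 \<omega>)\<^sup>2) (real n)) \<longlonglongrightarrow> (Y 0 \<omega>)\<^sup>2"
  proof (rule AE_I2, rule tendsto_eventually)
    fix \<omega>
    have "\<forall>\<^sub>F n in sequentially. (Y 0 \<omega>)\<^sup>2 \<le> real n"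
      using filterlim_real_sequentially unfolding filterlim_at_top by blast
    then show "\<forall>\<^sub>F n in sequentially. min ((Y 0 \<omega>)\<^sup>2) (real n) = (Y 0 \<omega>)\<^sup>2"
      by eventually_elim simp
  qed
qed (use square_integrable in auto)

lemma truncated_mean_approx:
  assumes "c < v"
  obtains C where "0 \<le> C" "c < truncated_mean C"
proof -
  have "\<forall>\<^sub>F n in sequentially. c < truncated_mean (real n)"
    using truncated_mean_tendsto assms by (rule order_tendstoD)
  then obtain n where "c < truncated_mean (real n)" by (auto simp: eventually_sequentially)
  then show ?thesis by (intro that[of "real n"]) auto
qed

text \<open>The squares are assumed to have a first moment only. Truncated at \<open>C\<close> they
  are bounded, so the second-moment strong law applies to them.\<close>

lemma truncated_strong_law:
  assumes C: "0 \<le> C"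
  shows "AE \<omega> in M. (\<lambda>n. (\<Sum>i<n. min ((Y i \<omega>)\<^sup>2) C - truncated_mean C) / real n) \<longlonglongrightarrow> 0"
proof -
  have bdd: "\<bar>min ((Y i \<omega>)\<^sup>2) C - truncated_mean C\<bar> \<le> C + \<bar>truncated_mean C\<bar>" for i \<omega>
    using C by (intro order_trans[OF abs_triangle_ineq4]) (auto intro!: add_mono)
  interpret T: centered_sequence M "\<lambda>i \<omega>. min ((Y i \<omega>)\<^sup>2) C - truncated_mean C"
    "expectation (\<lambda>\<omega>. (min ((Y 0 \<omega>)\<^sup>2) C - truncated_mean C)\<^sup>2)"
  proof unfold_locales
    show "indep_vars (\<lambda>_. borel) (\<lambda>i \<omega>. min ((Y i \<omega>)\<^sup>2) C - truncated_mean C) UNIV"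
      by (rule indep_vars_compose2[OF indep]) measurable
    show "integrable M (\<lambda>\<omega>. (min ((Y i \<omega>)\<^sup>2) C - truncated_mean C)\<^sup>2)" for i
      using bdd by (intro integrable_const_bound[where B = "(C + \<bar>truncated_mean C\<bar>)\<^sup>2"])
        (auto simp: abs_le_square_iff[symmetric] intro!: AE_I2 order_trans[OF bdd abs_ge_self])
    show "expectation (\<lambda>\<omega>. min ((Y i \<omega>)\<^sup>2) C - truncated_mean C) = 0" for i
      using C by (simp add: truncated_integrable truncated_expectation prob_space)
    show "expectation (\<lambda>\<omega>. (min ((Y i \<omega>)\<^sup>2) C - truncated_mean C)\<^sup>2) =
      expectation (\<lambda>\<omega>. (min ((Y 0 \<omega>)\<^sup>2) C - truncated_mean C)\<^sup>2)" for i
      by (rule expectation_compose) measurable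
  qed
  show ?thesis by (rule T.strong_law)
qed

text \<open>Truncation only decreases the sums, so a lower bound survives its removal, and
  \<open>C\<close> can be chosen with truncated mean above \<open>c\<close>.\<close>

lemma sum_squares_lower:
  assumes "c < v"
  shows "AE \<omega> in M. \<forall>\<^sub>F n in sequentially. c < (\<Sum>i<n. (Y i \<omega>)\<^sup>2) / real n"
proof -
  obtain C where C: "0 \<le> C" "c < truncated_mean C" using truncated_mean_approx[OF assms] .
  show ?thesis using truncated_strong_law[OF C(1)]
  proof eventually_elim
    case (elim \<omega>)
    have "\<forall>\<^sub>F n in sequentially. c - truncated_mean C < (\<Sum>i<n. min ((Y i \<omega>)\<^sup>2) C - truncated_mean C) / real n"
      using order_tendstoD(1)[OF elim, of "c - truncated_mean C"] C by simp
    then show ?case using eventually_gt_at_top[of 0]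
    proof eventually_elim
      case (elim n)
      have "c * real n < (\<Sum>i<n. min ((Y i \<omega>)\<^sup>2) C)"
        using elim by (simp add: sum_subtractf field_simps)
      also have "\<dots> \<le> (\<Sum>i<n. (Y i \<omega>)\<^sup>2)" by (intro sum_mono) simp
      finally show ?case using elim by (simp add: field_simps)
    qed
  qed
qed

text \<open>The truncation remainder \<open>R\<close> is nonnegative and increasing in the index.
  Hence bounding its final value \<open>R n\<close> bounds all earlier ones, and a first moment
  suffices for that.\<close>

lemma sum_squares_uniform:
  assumes d: "0 < d"
  shows "(\<lambda>n. prob {\<omega>\<in>space M. \<exists>k\<le>n. d * real n < \<bar>(\<Sum>i<k. (Y i \<omega>)\<^sup>2) - real k * v\<bar>}) \<longlonglongrightarrow> 0"
proof (rule tendstoI)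
  fix e :: real assume e: "0 < e"
  \<comment> \<open>The bound \<open>d / 3\<close> is the share of the deterministic error
    \<open>k * (v - m)\<close>; the bound \<open>d * e / 6\<close> makes Markov's estimate
    \<open>3 * (v - m) / d\<close> at most \<open>e / 2\<close>.\<close>
  have "v - min (d / 3) (d * e / 6) < v" using d e by simp
  then obtain C where C: "0 \<le> C" "v - min (d / 3) (d * e / 6) < truncated_mean C"
    using truncated_mean_approx by blast
  define m where "m = truncated_mean C"
  have m: "m \<le> v" "v - m \<le> d / 3" "v - m \<le> d * e / 6"
    using C truncated_mean_le[OF C(1)] by (auto simp: m_def)
  define T where "T k \<omega> = (\<Sum>i<k. min ((Y i \<omega>)\<^sup>2) C - m)" for k \<omega>
  define R where "R k \<omega> = (\<Sum>i<k. (Y i \<omega>)\<^sup>2 - min ((Y i \<omega>)\<^sup>2) C)" for k \<omega>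
  have [measurable]: "T k \<in> borel_measurable M" "R k \<in> borel_measurable M" for k
    unfolding T_def R_def by measurable
  let ?A = "\<lambda>n. {\<omega>\<in>space M. \<exists>k\<le>n. d / 3 * real n < \<bar>T k \<omega>\<bar>}"
  let ?B = "\<lambda>n. {\<omega>\<in>space M. d / 3 * real n \<le> R n \<omega>}"
  have "(\<lambda>n. prob (?A n)) \<longlonglongrightarrow> 0"
    using truncated_strong_law[OF C(1)] d unfolding T_def m_def
    by (intro prob_running_max_tendsto_0) auto
  then have "\<forall>\<^sub>F n in sequentially. prob (?A n) < e / 2"
    using e by (intro order_tendstoD(2)) auto
  then show "\<forall>\<^sub>F n in sequentially. dist (prob {\<omega>\<in>space M. \<exists>k\<le>n.
      d * real n < \<bar>(\<Sum>i<k. (Y i \<omega>)\<^sup>2) - real k * v\<bar>}) 0 < e"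
    using eventually_gt_at_top[of 0]
  proof eventually_elim
    case (elim n)
    have R0: "0 \<le> (Y i \<omega>)\<^sup>2 - min ((Y i \<omega>)\<^sup>2) C" for i \<omega> by simp
    have int: "integrable M (\<lambda>\<omega>. (Y i \<omega>)\<^sup>2 - min ((Y i \<omega>)\<^sup>2) C)" for i
      using C(1) by (intro Bochner_Integration.integrable_diff square_integrable truncated_integrable)
    have ER: "expectation (R n) = real n * (v - m)"
      unfolding R_def using C(1) int
      by (simp add: square_integrable truncated_integrable second_moment truncated_expectation m_def)
    have "prob (?B n) \<le> expectation (R n) / (d / 3 * real n)"
      using int d elim R0 unfolding R_def
      by (intro integral_Markov_inequality_measure[where A = "{}"]) (auto intro!: sum_nonneg)
    also have "\<dots> = 3 * (v - m) / d" using elim by (simp add: ER)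
    also have "\<dots> \<le> e / 2" using m(3) d by (simp add: field_simps)
    finally have B: "prob (?B n) \<le> e / 2" .
    have "prob {\<omega>\<in>space M. \<exists>k\<le>n. d * real n < \<bar>(\<Sum>i<k. (Y i \<omega>)\<^sup>2) - real k * v\<bar>} \<le> prob (?A n \<union> ?B n)"
    proof (rule finite_measure_mono)
      show "{\<omega>\<in>space M. \<exists>k\<le>n. d * real n < \<bar>(\<Sum>i<k. (Y i \<omega>)\<^sup>2) - real k * v\<bar>} \<subseteq> ?A n \<union> ?B n"
      proof (rule subsetI, rule ccontr)
        fix \<omega> assume "\<omega> \<in> {\<omega>\<in>space M. \<exists>k\<le>n. d * real n < \<bar>(\<Sum>i<k. (Y i \<omega>)\<^sup>2) - real k * v\<bar>}"
          and "\<omega> \<notin> ?A n \<union> ?B n"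
        then obtain k where \<omega>: "\<omega> \<in> space M" and k: "k \<le> n"
          and gt: "d * real n < \<bar>(\<Sum>i<k. (Y i \<omega>)\<^sup>2) - real k * v\<bar>" and no: "\<omega> \<notin> ?B n" "\<omega> \<notin> ?A n"
          by blast
        \<comment> \<open>Three errors of size \<open>d / 3 * n\<close> each. \<open>R\<close> and
          the centring term are nonnegative and enter with opposite signs, so at most two of the
          three add up.\<close>
        have "(\<Sum>i<k. (Y i \<omega>)\<^sup>2) - real k * v = T k \<omega> + R k \<omega> - real k * (v - m)"
          unfolding T_def R_def by (simp add: sum_subtractf algebra_simps)
        moreover have "\<bar>T k \<omega>\<bar> \<le> d / 3 * real n" using no(2) \<omega> k by (auto simp: not_less)
        moreover have "R k \<omega> \<le> R n \<omega>" unfolding R_def using k R0 by (intro sum_mono2) auto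
        moreover have "R n \<omega> < d / 3 * real n" using no(1) \<omega> by auto
        moreover have "0 \<le> R k \<omega>" unfolding R_def using R0 by (intro sum_nonneg) auto
        moreover have "real k * (v - m) \<le> d / 3 * real n"
          using mult_mono[of "real k" "real n" "v - m" "d / 3"] k m by (simp add: mult.commute)
        moreover have "0 \<le> real k * (v - m)" using m by simp
        ultimately have "\<bar>(\<Sum>i<k. (Y i \<omega>)\<^sup>2) - real k * v\<bar> \<le> d / 3 * real n + d / 3 * real n" by linarith
        also have "\<dots> \<le> d * real n" using d by (simp add: field_simps)
        finally show False using gt by simp
      qed
    qed measurable
    also have "\<dots> \<le> prob (?A n) + prob (?B n)" by (rule measure_Un_le) measurable
    also have "\<dots> < e" using elim B by linarith
    finally show ?case by simp
  qed
qed

text \<open>The partial sums increase, so dyadic indices suffice, and there Markov's inequality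
  compares the mean \<open>2 ^ k * v\<close> with the threshold \<open>e * 4 ^ k\<close>.\<close>

lemma sum_squares_over_square:
  "AE \<omega> in M. (\<lambda>n. (\<Sum>i<n. (Y i \<omega>)\<^sup>2) / (real n)\<^sup>2) \<longlonglongrightarrow> 0"
proof (rule AE_tendsto_0_dyadic)
  let ?Q = "\<lambda>n \<omega>. \<Sum>i<n. (Y i \<omega>)\<^sup>2"
  let ?A = "\<lambda>e k. {\<omega>\<in>space M. e * 4 ^ k \<le> ?Q (2 ^ k) \<omega>}"
  fix e :: real assume e: "0 < e"
  show "?A e k \<in> sets M" for k by measurable
  show "prob (?A e k) \<le> v / e * (1 / 2) ^ k" for k
  proof -
    have "prob (?A e k) \<le> expectation (?Q (2 ^ k)) / (e * 4 ^ k)"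
      using e square_integrable
      by (intro integral_Markov_inequality_measure[where A = "{}"]) (auto intro!: sum_nonneg)
    also have "expectation (?Q (2 ^ k)) = 2 ^ k * v"
      using square_integrable by (simp add: second_moment)
    also have "2 ^ k * v / (e * 4 ^ k) = v / e * ((2::real) ^ k / 4 ^ k)" by simp
    also have "(2::real) ^ k / 4 ^ k = (1 / 2) ^ k" by (simp add: power_divide[symmetric])
    finally show ?thesis .
  qed
  fix \<omega> k and n :: nat assume \<omega>: "\<omega> \<in> space M - ?A e (k + 1)" and k: "2 ^ k \<le> n" "n < 2 ^ (k + 1)"
  have "?Q n \<omega> \<le> ?Q (2 ^ (k + 1)) \<omega>"
    using k(2) by (intro sum_mono2) auto
  moreover have "?Q (2 ^ (k + 1)) \<omega> < e * 4 ^ (k + 1)" using \<omega> by (auto simp: not_le)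
  \<comment> \<open>The 4 is the loss in the squared scale between \<open>2 ^ (k + 1)\<close> and
    \<open>2 ^ k\<close>.\<close>
  ultimately have "?Q n \<omega> < 4 * e * (real (2 ^ k))\<^sup>2"
    by (simp add: power2_eq_square power_mult_distrib[symmetric])
  also have "\<dots> \<le> 4 * e * (real n)\<^sup>2"
    using of_nat_mono[OF k(1), where 'a = real] e by (intro mult_left_mono power_mono) auto
  finally show "\<bar>?Q n \<omega> / (real n)\<^sup>2\<bar> < 4 * e"
    using order_less_le_trans[OF _ k(1), of 0] by (simp add: field_simps sum_nonneg)
qed

text \<open>For \<open>n = 0\<close> the value is \<open>0\<close>, because division by zero gives zero.\<close>

definition sample_squares :: "nat \<Rightarrow> 'a \<Rightarrow> real" where
  "sample_squares n \<omega> = (\<Sum>i<n. (Y i \<omega>)\<^sup>2) - (\<Sum>i<n. Y i \<omega>)\<^sup>2 / real n"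

lemma sample_squares_measurable [measurable]: "sample_squares n \<in> borel_measurable M"
  unfolding sample_squares_def by measurable

text \<open>By the strong law the squared mean tends to 0, so the correction
  \<open>(S k)^2 / k\<close>, with \<open>S k\<close> the partial sum, is of smaller order than
  \<open>k\<close> and the running-maximum argument absorbs it.\<close>

lemma sample_squares_uniform:
  assumes d: "0 < d"
  shows "(\<lambda>n. prob {\<omega>\<in>space M. \<exists>k\<le>n. d * real n < \<bar>sample_squares k \<omega> - real k * v\<bar>}) \<longlonglongrightarrow> 0"
proof -
  let ?A = "\<lambda>n. {\<omega>\<in>space M. \<exists>k\<le>n. d / 2 * real n < \<bar>(\<Sum>i<k. (Y i \<omega>)\<^sup>2) - real k * v\<bar>}"
  let ?B = "\<lambda>n. {\<omega>\<in>space M. \<exists>k\<le>n. d / 2 * real n < \<bar>(\<Sum>i<k. Y i \<omega>)\<^sup>2 / real k\<bar>}"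
  have B: "(\<lambda>n. prob (?B n)) \<longlonglongrightarrow> 0"
  proof (rule prob_running_max_tendsto_0)
    show "AE \<omega> in M. (\<lambda>n. (\<Sum>i<n. Y i \<omega>)\<^sup>2 / real n / real n) \<longlonglongrightarrow> 0"
      using strong_law
    proof eventually_elim
      case (elim \<omega>)
      then have "(\<lambda>n. ((\<Sum>i<n. Y i \<omega>) / real n)\<^sup>2) \<longlonglongrightarrow> 0\<^sup>2" by (rule tendsto_power)
      then show ?case by (simp add: power2_eq_square)
    qed
  qed (use d in auto)
  have "(\<lambda>n. prob (?A n) + prob (?B n)) \<longlonglongrightarrow> 0 + 0"
    using sum_squares_uniform[of "d / 2"] B d by (intro tendsto_add) auto
  then have lim: "(\<lambda>n. prob (?A n) + prob (?B n)) \<longlonglongrightarrow> 0" by simp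
  have le: "prob {\<omega>\<in>space M. \<exists>k\<le>n. d * real n < \<bar>sample_squares k \<omega> - real k * v\<bar>} \<le> prob (?A n) + prob (?B n)" for n
  proof -
    have "prob {\<omega>\<in>space M. \<exists>k\<le>n. d * real n < \<bar>sample_squares k \<omega> - real k * v\<bar>} \<le> prob (?A n \<union> ?B n)"
    proof (rule finite_measure_mono)
      show "{\<omega>\<in>space M. \<exists>k\<le>n. d * real n < \<bar>sample_squares k \<omega> - real k * v\<bar>} \<subseteq> ?A n \<union> ?B n"
      proof (rule subsetI, rule ccontr)
        fix \<omega> assume "\<omega> \<in> {\<omega>\<in>space M. \<exists>k\<le>n. d * real n < \<bar>sample_squares k \<omega> - real k * v\<bar>}"
          and "\<omega> \<notin> ?A n \<union> ?B n"
        then obtain k where \<omega>: "\<omega> \<in> space M" and k: "k \<le> n"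
          and gt: "d * real n < \<bar>sample_squares k \<omega> - real k * v\<bar>" and no: "\<omega> \<notin> ?B n" "\<omega> \<notin> ?A n"
          by blast
        have "\<bar>(\<Sum>i<k. (Y i \<omega>)\<^sup>2) - real k * v\<bar> \<le> d / 2 * real n"
          "\<bar>(\<Sum>i<k. Y i \<omega>)\<^sup>2 / real k\<bar> \<le> d / 2 * real n"
          using no \<omega> k by (auto simp: not_less)
        then show False using gt unfolding sample_squares_def by linarith
      qed
    qed measurable
    also have "\<dots> \<le> prob (?A n) + prob (?B n)" by (rule measure_Un_le) measurable
    finally show ?thesis .
  qed
  show ?thesis
    by (rule tendsto_sandwich[OF _ _ tendsto_const lim])
       (intro always_eventually allI le measure_nonneg)+
qed

text \<open>The gap between \<open>c\<close> and an intermediate \<open>c'\<close> absorbs the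
  squared sample mean.\<close>

lemma sample_squares_lower:
  assumes "c < v"
  shows "AE \<omega> in M. \<forall>\<^sub>F n in sequentially. c < sample_squares n \<omega> / real n"
proof -
  obtain c' where c': "c < c'" "c' < v" using dense[OF assms] by blast
  show ?thesis using sum_squares_lower[OF c'(2)] strong_law
  proof eventually_elim
    case (elim \<omega>)
    have "(\<lambda>n. ((\<Sum>i<n. Y i \<omega>) / real n)\<^sup>2) \<longlonglongrightarrow> 0\<^sup>2" using elim(2) by (rule tendsto_power)
    from order_tendstoD(2)[OF this, of "c' - c"] have "\<forall>\<^sub>F n in sequentially. ((\<Sum>i<n. Y i \<omega>) / real n)\<^sup>2 < c' - c"
      using c' by simp
    then show ?case using elim(1)
    proof eventually_elim
      case (elim n)
      then show ?case unfolding sample_squares_def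
        by (simp add: diff_divide_distrib power2_eq_square)
    qed
  qed
qed

end

section \<open>Block increments\<close>

lemma (in prob_space) lipschitz_expectation_close:
  assumes g: "bounded_lipschitz g C L" and d: "0 \<le> d"
    and PQ: "\<And>\<omega>. \<omega> \<in> space M \<Longrightarrow> P \<omega> \<in> path_pairs" "\<And>\<omega>. \<omega> \<in> space M \<Longrightarrow> Q \<omega> \<in> path_pairs"
    and [measurable]: "(\<lambda>\<omega>. g (P \<omega>)) \<in> borel_measurable M" "(\<lambda>\<omega>. g (Q \<omega>)) \<in> borel_measurable M"
      "A \<in> sets M"
    and close: "\<And>\<omega>. \<omega> \<in> space M \<Longrightarrow> \<omega> \<notin> A \<Longrightarrow> pair_dist (P \<omega>) (Q \<omega>) \<le> d"
  shows "\<bar>expectation (\<lambda>\<omega>. g (P \<omega>)) - expectation (\<lambda>\<omega>. g (Q \<omega>))\<bar> \<le> L * d + 2 * C * prob A"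
proof -
  note lip = bounded_lipschitzD[OF g]
  have int: "integrable M (\<lambda>\<omega>. g (P \<omega>))" "integrable M (\<lambda>\<omega>. g (Q \<omega>))"
    by (rule integrable_const_bound[where B = C]; simp add: AE_I2 lip(2)[OF PQ(1)] lip(2)[OF PQ(2)])+
  have iA: "integrable M (indicator A :: 'a \<Rightarrow> real)"
    by (rule integrable_const_bound[where B = 1]) (auto split: split_indicator)
  have pt: "\<bar>g (P \<omega>) - g (Q \<omega>)\<bar> \<le> L * d + 2 * C * indicator A \<omega>" if "\<omega> \<in> space M" for \<omega>
  proof (cases "\<omega> \<in> A")
    case True
    have "\<bar>g (P \<omega>) - g (Q \<omega>)\<bar> \<le> \<bar>g (P \<omega>)\<bar> + \<bar>g (Q \<omega>)\<bar>" by linarith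
    also have "\<dots> \<le> C + C" by (intro add_mono lip(2) PQ that)
    also have "\<dots> \<le> L * d + 2 * C" using lip(1) d by simp
    finally show ?thesis using True by simp
  next
    case False
    have "\<bar>g (P \<omega>) - g (Q \<omega>)\<bar> \<le> L * pair_dist (P \<omega>) (Q \<omega>)" by (intro lip(3) PQ that)
    also have "\<dots> \<le> L * d" using close[OF that False] lip(1) by (intro mult_left_mono) auto
    finally show ?thesis using False by simp
  qed
  have "\<bar>expectation (\<lambda>\<omega>. g (P \<omega>)) - expectation (\<lambda>\<omega>. g (Q \<omega>))\<bar> = \<bar>expectation (\<lambda>\<omega>. g (P \<omega>) - g (Q \<omega>))\<bar>"
    using int by simp
  also have "\<dots> \<le> expectation (\<lambda>\<omega>. \<bar>g (P \<omega>) - g (Q \<omega>)\<bar>)" by (rule integral_abs_bound)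
  also have "\<dots> \<le> expectation (\<lambda>\<omega>. L * d + 2 * C * indicator A \<omega>)"
    using int pt iA by (intro integral_mono) auto
  also have "\<dots> = L * d + 2 * C * prob A"
    using iA by (simp add: prob_space)
  finally show ?thesis .
qed

text \<open>The number of steps made by the rescaled walk up to time \<open>j / m\<close>.\<close>

definition block_end :: "real \<Rightarrow> nat \<Rightarrow> nat \<Rightarrow> nat" where
  "block_end \<epsilon> m j = nat \<lfloor>real j / (real m * \<epsilon>)\<rfloor>"

lemma block_end_0 [simp]: "block_end \<epsilon> m 0 = 0"
  by (simp add: block_end_def)

lemma block_end_mono:
  assumes "0 < \<epsilon>" "i \<le> j"
  shows "block_end \<epsilon> m i \<le> block_end \<epsilon> m j"
  unfolding block_end_def using assms by (intro nat_mono floor_mono divide_right_mono) auto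

text \<open>A difference of two floors misses the exact difference by at most one step, which is
  \<epsilon> in rescaled time.\<close>

lemma block_length:
  assumes "0 < \<epsilon>" "0 < m"
  shows "\<bar>\<epsilon> * real (block_end \<epsilon> m (Suc j) - block_end \<epsilon> m j) - 1 / real m\<bar> \<le> \<epsilon>"
proof -
  define x where "x = real j / (real m * \<epsilon>)"
  define y where "y = 1 / (real m * \<epsilon>)"
  have xy: "0 \<le> x" "0 \<le> y" using assms by (auto simp: x_def y_def)
  have y: "real (Suc j) / (real m * \<epsilon>) = x + y" by (simp add: x_def y_def add_divide_distrib)
  have le: "block_end \<epsilon> m j \<le> block_end \<epsilon> m (Suc j)" using assms by (intro block_end_mono) auto
  have "real (block_end \<epsilon> m (Suc j) - block_end \<epsilon> m j) = of_int \<lfloor>x + y\<rfloor> - of_int \<lfloor>x\<rfloor>"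
    using le xy unfolding block_end_def y x_def[symmetric] by (simp add: of_nat_diff)
  then have "\<bar>real (block_end \<epsilon> m (Suc j) - block_end \<epsilon> m j) - y\<bar> \<le> 1" by linarith
  then have "\<epsilon> * \<bar>real (block_end \<epsilon> m (Suc j) - block_end \<epsilon> m j) - y\<bar> \<le> \<epsilon> * 1"
    using assms by (intro mult_left_mono) auto
  also have "\<epsilon> * \<bar>real (block_end \<epsilon> m (Suc j) - block_end \<epsilon> m j) - y\<bar>
      = \<bar>\<epsilon> * (real (block_end \<epsilon> m (Suc j) - block_end \<epsilon> m j) - y)\<bar>"
    using assms by (simp add: abs_mult)
  also have "\<epsilon> * (real (block_end \<epsilon> m (Suc j) - block_end \<epsilon> m j) - y)
      = \<epsilon> * real (block_end \<epsilon> m (Suc j) - block_end \<epsilon> m j) - 1 / real m"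
    using assms by (simp add: y_def algebra_simps)
  finally show ?thesis by simp
qed

lemma block_end_floor:
  assumes "0 < \<epsilon>" "0 < m" "0 \<le> t"
  shows "block_end \<epsilon> m (nat \<lfloor>real m * t\<rfloor>) \<le> nat \<lfloor>1 / \<epsilon> * t\<rfloor>"
    and "nat \<lfloor>1 / \<epsilon> * t\<rfloor> \<le> block_end \<epsilon> m (Suc (nat \<lfloor>real m * t\<rfloor>))"
proof -
  have j: "real (nat \<lfloor>real m * t\<rfloor>) \<le> real m * t" "real m * t \<le> real (Suc (nat \<lfloor>real m * t\<rfloor>))"
    using assms by (auto simp: of_nat_nat) linarith
  have t: "real m * t / (real m * \<epsilon>) = 1 / \<epsilon> * t" using assms by simp
  show "block_end \<epsilon> m (nat \<lfloor>real m * t\<rfloor>) \<le> nat \<lfloor>1 / \<epsilon> * t\<rfloor>"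
    unfolding block_end_def t[symmetric] using j assms
    by (intro nat_mono floor_mono divide_right_mono) auto
  show "nat \<lfloor>1 / \<epsilon> * t\<rfloor> \<le> block_end \<epsilon> m (Suc (nat \<lfloor>real m * t\<rfloor>))"
    unfolding block_end_def t[symmetric] using j assms
    by (intro nat_mono floor_mono divide_right_mono) auto
qed

lemma sum_blocks:
  fixes f :: "nat \<Rightarrow> real"
  assumes "mono k" "k 0 = 0"
  shows "(\<Sum>l<j. \<Sum>i\<in>{k l..<k (Suc l)}. f i) = (\<Sum>i<k j. f i)"
proof (induction j)
  case (Suc j)
  have "(\<Sum>i<k (Suc j). f i) = (\<Sum>i\<in>{0..<k j}. f i) + (\<Sum>i\<in>{k j..<k (Suc j)}. f i)"
    using assms(1) by (subst sum.atLeastLessThan_concat) (auto simp: lessThan_atLeast0 mono_def)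
  then show ?case using Suc by (simp add: lessThan_atLeast0)
qed (simp add: assms)

text \<open>The truncation at \<open>m * m\<close> makes the path depend on finitely many increments, at the price of
  being an approximation on \<open>[0, m]\<close> only.\<close>

definition partial_sums_path :: "nat \<Rightarrow> (nat \<Rightarrow> real) \<Rightarrow> real \<Rightarrow> real" where
  "partial_sums_path m V = step_path (real m) (\<lambda>j. \<Sum>l<min j (m * m). V l) (\<lambda>_. 0)"

text \<open>The minimum with 1 makes the integrand bounded and continuous, as needed to transport
  the bound along weak convergence. The constant is 48 = 2^4 * 3, where 3 is the fourth moment of
  the standard normal law. For a block, \<open>c ^ 4\<close> is of order 1/m^2.\<close>

lemma std_normal_fourth_moment:
  assumes "0 < d"
  shows "(\<integral>x. min 1 ((2 * x / d) ^ 4) \<partial>normal_image c) \<le> 48 * c ^ 4 / d ^ 4"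
proof -
  interpret real_distribution std_normal_distribution by (rule real_dist_normal_dist)
  have m4: "(\<integral>x. x ^ 4 \<partial>std_normal_distribution) = 3"
    using std_normal_distribution_even_moments(1)[of 2] by (simp add: fact_numeral)
  have i4: "integrable std_normal_distribution (\<lambda>x. x ^ 4)"
    using std_normal_distribution_even_moments(2)[of 2] by simp
  have eq: "(2 * (c * x) / d) ^ 4 = 16 * c ^ 4 / d ^ 4 * x ^ 4" for x
    by (simp add: power_divide power_mult_distrib)
  have "(\<integral>x. min 1 ((2 * x / d) ^ 4) \<partial>normal_image c)
      = (\<integral>x. min 1 ((2 * (c * x) / d) ^ 4) \<partial>std_normal_distribution)"
    by (subst integral_distr) auto
  also have "\<dots> \<le> (\<integral>x. 16 * c ^ 4 / d ^ 4 * x ^ 4 \<partial>std_normal_distribution)"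
  proof (rule integral_mono)
    show "integrable std_normal_distribution (\<lambda>x. min 1 ((2 * (c * x) / d) ^ 4))"
      by (rule integrable_const_bound[where B = 1]) auto
    show "min 1 ((2 * (c * x) / d) ^ 4) \<le> 16 * c ^ 4 / d ^ 4 * x ^ 4" for x
      unfolding eq by (rule min.cobounded2)
  qed (use i4 in simp)
  also have "\<dots> = 48 * c ^ 4 / d ^ 4" using m4 by simp
  finally show ?thesis .
qed

context iid_centered
begin

text \<open>\<open>K\<close> is a time horizon, covered by \<open>m * K\<close> blocks. Deviations
  are measured from the left end of each block because the block path freezes the walk
  there.\<close>

definition oscillates :: "real \<Rightarrow> nat \<Rightarrow> nat \<Rightarrow> real \<Rightarrow> 'a \<Rightarrow> bool" where
  "oscillates \<epsilon> m K d \<omega> \<longleftrightarrow> (\<exists>j<m * K. \<exists>r\<le>block_end \<epsilon> m (Suc j) - block_end \<epsilon> m j.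
    d \<le> sqrt \<epsilon> * \<bar>\<Sum>i\<in>{block_end \<epsilon> m j..<block_end \<epsilon> m j + r}. Y i \<omega>\<bar>)"

lemma oscillates_measurable [measurable]: "Measurable.pred M (oscillates \<epsilon> m K d)"
  unfolding oscillates_def by measurable

definition block_increment :: "real \<Rightarrow> nat \<Rightarrow> nat \<Rightarrow> 'a \<Rightarrow> real" where
  "block_increment \<epsilon> m l \<omega> = sqrt \<epsilon> * (\<Sum>i\<in>{block_end \<epsilon> m l..<block_end \<epsilon> m (Suc l)}. Y i \<omega>)"

lemma block_increment_measurable [measurable]: "block_increment \<epsilon> m l \<in> borel_measurable M"
  unfolding block_increment_def by measurable

lemma block_increment_indep:
  assumes "0 < \<epsilon>"
  shows "indep_vars (\<lambda>_. borel) (block_increment \<epsilon> m) (I :: nat set)"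
proof -
  let ?K = "\<lambda>l. {block_end \<epsilon> m l..<block_end \<epsilon> m (Suc l)}"
  have disj: "disjoint_family_on ?K I"
    unfolding disjoint_family_on_def
  proof (intro ballI impI)
    fix i j :: nat assume "i \<noteq> j"
    then have "Suc i \<le> j \<or> Suc j \<le> i" by linarith
    then show "?K i \<inter> ?K j = {}"
      using block_end_mono[OF assms, of "Suc i" j m] block_end_mono[OF assms, of "Suc j" i m]
      by (auto simp: disjoint_iff)
  qed
  have "indep_vars (\<lambda>l. \<Pi>\<^sub>M i\<in>?K l. borel) (\<lambda>l \<omega>. restrict (\<lambda>i. Y i \<omega>) (?K l)) I"
    by (rule indep_vars_restrict[OF indep _ disj]) auto
  then have "indep_vars (\<lambda>_. borel) (\<lambda>l \<omega>. sqrt \<epsilon> * (\<Sum>i\<in>?K l. restrict (\<lambda>i. Y i \<omega>) (?K l) i)) I"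
    by (rule indep_vars_compose2) measurable
  then show ?thesis by (simp add: block_increment_def[abs_def])
qed

context
  fixes \<epsilon> :: "nat \<Rightarrow> real"
  assumes \<epsilon>_pos: "\<And>n. 0 < \<epsilon> n" and \<epsilon>_lim: "\<epsilon> \<longlonglongrightarrow> 0"
begin

lemma block_increment_weak_conv:
  assumes m: "0 < m"
  shows "weak_conv_m (\<lambda>n. distr M borel (block_increment (\<epsilon> n) m l))
    (normal_image (sqrt (v / real m)))"
proof -
  let ?a = "\<lambda>n. block_end (\<epsilon> n) m l" and ?b = "\<lambda>n. block_end (\<epsilon> n) m (Suc l)"
  have le: "?a n \<le> ?b n" for n by (intro block_end_mono \<epsilon>_pos) auto
  have lim: "(\<lambda>n. \<epsilon> n * real (?b n - ?a n)) \<longlonglongrightarrow> 1 / real m"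
    by (rule LIM_zero_cancel, rule Lim_null_comparison[OF _ \<epsilon>_lim])
       (use block_length[OF \<epsilon>_pos m] in auto)
  have inv: "filterlim (\<lambda>n. inverse (\<epsilon> n)) at_top sequentially"
    by (rule filterlim_inverse_at_top[OF \<epsilon>_lim]) (simp add: \<epsilon>_pos)
  \<comment> \<open>Block lengths diverge since their product with \<open>\<epsilon> n\<close> tends
    to the positive number \<open>1 / m\<close>.\<close>
  have "filterlim (\<lambda>n. \<epsilon> n * real (?b n - ?a n) * inverse (\<epsilon> n)) at_top sequentially"
    by (rule filterlim_tendsto_pos_mult_at_top[OF lim _ inv]) (use m in simp)
  moreover have "\<epsilon> n * real (?b n - ?a n) * inverse (\<epsilon> n) = real (?b n - ?a n)" for n
    using \<epsilon>_pos[of n] by simp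
  ultimately have "filterlim (\<lambda>n. real (?b n - ?a n)) at_top sequentially" by simp
  then have ks: "filterlim (\<lambda>n. ?b n - ?a n) at_top sequentially"
    by (simp add: filterlim_sequentially_iff_filterlim_real)
  have "(\<lambda>n. sqrt (\<epsilon> n * real (?b n - ?a n) * v)) \<longlonglongrightarrow> sqrt (1 / real m * v)"
    by (intro tendsto_intros lim)
  then have cs: "(\<lambda>n. sqrt (\<epsilon> n) * sqrt (real (?b n - ?a n) * v)) \<longlonglongrightarrow> sqrt (v / real m)"
    by (simp add: real_sqrt_mult mult.assoc)
  show ?thesis
    using scaled_block_sum_weak_conv[OF ks cs, of ?a] le by (simp add: block_increment_def[abs_def])
qed

text \<open>Each block contributes at most twice the tail of its own increment. In the limit over
  \<open>n\<close> this tail is bounded by a multiple of 1/m^2, so the union over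
  \<open>m * K\<close> blocks is of order 1/m.\<close>

lemma block_modulus:
  assumes d: "0 < d" and K: "0 < K" and e: "0 < e"
  shows "\<exists>m0. \<forall>m\<ge>m0. \<forall>\<^sub>F n in sequentially. prob {\<omega>\<in>space M. oscillates (\<epsilon> n) m K d \<omega>} \<le> e"
proof -
  \<comment> \<open>The first lower bound on \<open>m\<close> yields
    \<open>4 * v / (d^2 * m) < 1 / 2\<close>, the smallness condition of \<open>ottaviani\<close>.
    The second puts the Gaussian bound \<open>48 * v^2 / (m^2 * d^4)\<close> below the share
    \<open>q\<close> of one block.\<close>
  define m0 where "m0 = Suc (nat \<lceil>max (8 * v / d\<^sup>2) (96 * real K * v\<^sup>2 / (d ^ 4 * e))\<rceil>)"
  show ?thesis
  proof (intro exI[of _ m0] allI impI)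
    fix m assume "m0 \<le> m"
    then have m: "0 < m" "8 * v / d\<^sup>2 < real m" "96 * real K * v\<^sup>2 / (d ^ 4 * e) < real m"
      unfolding m0_def by linarith+
    \<comment> \<open>The 2 in the denominator compensates the factor 2 in
      \<open>ottaviani\<close>.\<close>
    define q where "q = e / (2 * (real m * real K))"
    let ?a = "\<lambda>n j. block_end (\<epsilon> n) m j"
    \<comment> \<open>A bounded continuous majorant of the indicator of
      \<open>\<bar>x\<bar> \<ge> d / 2\<close>, the event left over once the inequality of
      \<open>ottaviani\<close> has halved the threshold.\<close>
    define f :: "real \<Rightarrow> real" where "f x = min 1 ((2 * x / d) ^ 4)" for x
    have f: "0 \<le> f x" "f x \<le> 1" "isCont f x" for x
      unfolding f_def using d by (auto intro!: continuous_intros)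
    have f_meas [measurable]: "f \<in> borel_measurable borel" unfolding f_def by measurable
    have s4: "sqrt (v / real m) ^ 4 = v\<^sup>2 / (real m)\<^sup>2"
    proof -
      have "sqrt (v / real m) ^ 4 = ((sqrt (v / real m))\<^sup>2)\<^sup>2" by simp
      also have "(sqrt (v / real m))\<^sup>2 = v / real m" using v_pos by simp
      finally show ?thesis by (simp add: power_divide)
    qed
    have ev_block: "\<forall>\<^sub>F n in sequentially. expectation (\<lambda>\<omega>. f (block_increment (\<epsilon> n) m j \<omega>)) < q" for j
    proof -
      have "(\<integral>x. f x \<partial>normal_image (sqrt (v / real m))) \<le>
          48 * (v\<^sup>2 / (real m)\<^sup>2) / d ^ 4"
        unfolding f_def s4[symmetric] by (rule std_normal_fourth_moment[OF d])
      also have "\<dots> < q"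
        using m(1,3) d e K unfolding q_def by (simp add: field_simps power2_eq_square)
      finally have lt: "(\<integral>x. f x \<partial>normal_image (sqrt (v / real m))) < q" .
      interpret std_normal: real_distribution std_normal_distribution by (rule real_dist_normal_dist)
      have "(\<lambda>n. \<integral>x. f x \<partial>distr M borel (block_increment (\<epsilon> n) m j)) \<longlonglongrightarrow>
          (\<integral>x. f x \<partial>normal_image (sqrt (v / real m)))"
        by (rule weak_conv_imp_integral_bdd_continuous_conv[where B = 1, OF _ _ block_increment_weak_conv[OF m(1)]])
           (use f in \<open>auto intro!: real_distribution_distr std_normal.real_distribution_distr\<close>)
      then have "\<forall>\<^sub>F n in sequentially. (\<integral>x. f x \<partial>distr M borel (block_increment (\<epsilon> n) m j)) < q"
        using lt by (rule order_tendstoD(2))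
      then show ?thesis by (simp add: integral_distr)
    qed
    have "4 * v / d\<^sup>2 * (1 / real m + 0) < 1 / 2" using m d by (simp add: field_simps)
    moreover have "(\<lambda>n. 4 * v / d\<^sup>2 * (1 / real m + \<epsilon> n)) \<longlonglongrightarrow> 4 * v / d\<^sup>2 * (1 / real m + 0)"
      by (intro tendsto_intros \<epsilon>_lim)
    ultimately have ev_small: "\<forall>\<^sub>F n in sequentially. 4 * v / d\<^sup>2 * (1 / real m + \<epsilon> n) < 1 / 2"
      by (intro order_tendstoD(2))
    \<comment> \<open>As \<open>m\<close> is fixed, only finitely many blocks have to be close to
      their limit at the same time.\<close>
    have "\<forall>\<^sub>F n in sequentially. \<forall>j\<in>{..<m * K}. expectation (\<lambda>\<omega>. f (block_increment (\<epsilon> n) m j \<omega>)) < q"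
      by (intro eventually_ball_finite ballI ev_block) simp
    then show "\<forall>\<^sub>F n in sequentially. prob {\<omega>\<in>space M. oscillates (\<epsilon> n) m K d \<omega>} \<le> e"
      using ev_small
    proof eventually_elim
      case (elim n)
      let ?\<epsilon> = "\<epsilon> n"
      define A where "A j = {\<omega>\<in>space M. \<exists>r\<le>?a n (Suc j) - ?a n j.
        d \<le> sqrt ?\<epsilon> * \<bar>\<Sum>i\<in>{?a n j..<?a n j + r}. Y i \<omega>\<bar>}" for j
      have [measurable]: "A j \<in> sets M" for j unfolding A_def by measurable
      have PA: "prob (A j) \<le> 2 * q" if "j < m * K" for j
      proof -
        let ?l = "?a n (Suc j) - ?a n j"
        let ?S = "\<lambda>r \<omega>. \<Sum>i\<in>{?a n j..<?a n j + r}. Y i \<omega>"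
        define \<rho> where "\<rho> = d / (2 * sqrt ?\<epsilon>)"
        have s: "0 < sqrt ?\<epsilon>" using \<epsilon>_pos by simp
        have \<rho>: "0 < \<rho>" using d s by (simp add: \<rho>_def)
        have \<rho>_iff: "2 * \<rho> \<le> \<bar>x\<bar> \<longleftrightarrow> d \<le> sqrt ?\<epsilon> * \<bar>x\<bar>" for x
          using s by (simp add: \<rho>_def field_simps)
        have "real ?l * v / \<rho>\<^sup>2 = 4 * v / d\<^sup>2 * (?\<epsilon> * real ?l)"
          using s \<epsilon>_pos[of n] by (simp add: \<rho>_def power_divide power_mult_distrib)
        also have "\<dots> \<le> 4 * v / d\<^sup>2 * (1 / real m + ?\<epsilon>)"
          using block_length[OF \<epsilon>_pos[of n] m(1), of j] v_pos by (intro mult_left_mono) auto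
        also have "\<dots> \<le> 1 / 2" using elim(2) by simp
        finally have "prob {\<omega>\<in>space M. \<exists>r\<le>?l. 2 * \<rho> \<le> \<bar>?S r \<omega>\<bar>} \<le> 2 * prob {\<omega>\<in>space M. \<rho> \<le> \<bar>?S ?l \<omega>\<bar>}"
          by (rule ottaviani[OF \<rho>])
        then have "prob (A j) \<le> 2 * prob {\<omega>\<in>space M. \<rho> \<le> \<bar>?S ?l \<omega>\<bar>}"
          unfolding A_def \<rho>_iff .
        also have "prob {\<omega>\<in>space M. \<rho> \<le> \<bar>?S ?l \<omega>\<bar>} = expectation (indicator {\<omega>\<in>space M. \<rho> \<le> \<bar>?S ?l \<omega>\<bar>})"
          by simp
        also have "\<dots> \<le> expectation (\<lambda>\<omega>. f (block_increment ?\<epsilon> m j \<omega>))"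
        proof (rule integral_mono)
          show "integrable M (\<lambda>\<omega>. f (block_increment ?\<epsilon> m j \<omega>))"
            using f by (intro integrable_const_bound[where B = 1]) auto
          fix \<omega> assume "\<omega> \<in> space M"
          have inc: "block_increment ?\<epsilon> m j \<omega> = sqrt ?\<epsilon> * ?S ?l \<omega>"
            using block_end_mono[OF \<epsilon>_pos[of n], of j "Suc j" m] by (simp add: block_increment_def)
          show "indicator {\<omega>\<in>space M. \<rho> \<le> \<bar>?S ?l \<omega>\<bar>} \<omega> \<le> f (block_increment ?\<epsilon> m j \<omega>)"
          proof (cases "\<rho> \<le> \<bar>?S ?l \<omega>\<bar>")
            case True
            then have "d \<le> 2 * (sqrt ?\<epsilon> * \<bar>?S ?l \<omega>\<bar>)" using s by (simp add: \<rho>_def field_simps)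
            then have "1 \<le> \<bar>2 * block_increment ?\<epsilon> m j \<omega> / d\<bar>"
              using d s by (simp add: inc abs_mult field_simps)
            then have "1 ^ 4 \<le> \<bar>2 * block_increment ?\<epsilon> m j \<omega> / d\<bar> ^ 4" by (intro power_mono) auto
            then have "1 \<le> (2 * block_increment ?\<epsilon> m j \<omega> / d) ^ 4"
              by (simp only: power_one power_even_abs_numeral even_numeral)
            then have "f (block_increment ?\<epsilon> m j \<omega>) = 1" unfolding f_def by (rule min_absorb1)
            then show ?thesis by (simp add: indicator_def)
          qed (use f in auto)
        qed (rule integrable_const_bound[where B = 1], auto split: split_indicator)
        also have "\<dots> \<le> q"
          by (rule less_imp_le, rule bspec[OF elim(1)]) (use that in simp)
        finally show ?thesis by simp
      qed
      have "{\<omega>\<in>space M. oscillates (\<epsilon> n) m K d \<omega>} = (\<Union>j<m * K. A j)"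
        unfolding A_def oscillates_def by auto
      also have "prob \<dots> \<le> (\<Sum>j<m * K. prob (A j))"
        by (rule finite_measure_subadditive_finite) auto
      also have "\<dots> \<le> (\<Sum>j<m * K. 2 * q)" using PA by (intro sum_mono) auto
      also have "\<dots> = e" using m(1) K by (simp add: q_def)
      finally show ?case .
    qed
  qed
qed

end

end

section \<open>Discretization of the random walk and of Brownian motion\<close>

lemma partial_sums_path_cadlag:
  "0 < m \<Longrightarrow> partial_sums_path m V \<in> cadlag_paths"
  unfolding partial_sums_path_def by (intro step_path_cadlag) auto

lemma partial_sums_path_tendsto:
  assumes g: "bounded_lipschitz g C L" and m: "0 < m" and y: "y \<in> cadlag_paths"
    and V: "\<And>l. l < m * m \<Longrightarrow> (\<lambda>n. Vs n l) \<longlonglongrightarrow> V l"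
  shows "(\<lambda>n. g (partial_sums_path m (Vs n), y)) \<longlonglongrightarrow> g (partial_sums_path m V, y)"
proof (rule bounded_lipschitz_tendsto[OF g])
  have "(\<lambda>n. unif_dist (partial_sums_path m (Vs n)) (partial_sums_path m V)) \<longlonglongrightarrow> 0"
    unfolding partial_sums_path_def
    by (intro step_path_unif_dist_tendsto tendsto_sum V) (use m in auto)
  then show "(\<lambda>n. pair_dist (partial_sums_path m (Vs n), y) (partial_sums_path m V, y)) \<longlonglongrightarrow> 0"
    by (simp add: pair_dist_def)
qed (use m y in \<open>auto intro: partial_sums_path_cadlag\<close>)

lemma measurable_partial_sums_path:
  assumes g: "bounded_lipschitz g C L" and m: "0 < m" and b: "continuous_on UNIV b"
    and V: "\<And>l. V l \<in> borel_measurable M"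
  shows "(\<lambda>\<omega>. g (partial_sums_path m (\<lambda>l. V l \<omega>), drift_path b)) \<in> borel_measurable M"
proof -
  have "0 < real m" using m by simp
  moreover have "(\<lambda>\<omega>. \<Sum>l<min j (m * m). V l \<omega>) \<in> borel_measurable M" for j
    by (intro borel_measurable_sum V)
  ultimately show ?thesis
    unfolding partial_sums_path_def
    by (intro measurable_step_paths[OF g _ zero_less_one continuous_on_const b _ borel_measurable_const])
qed

context iid_centered
begin

abbreviation block_path :: "real \<Rightarrow> nat \<Rightarrow> 'a \<Rightarrow> real \<Rightarrow> real" where
  "block_path \<epsilon> m \<omega> \<equiv> partial_sums_path m (\<lambda>l. block_increment \<epsilon> m l \<omega>)"

definition walk_path :: "real \<Rightarrow> 'a \<Rightarrow> real \<Rightarrow> real" where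
  "walk_path \<epsilon> \<omega> = step_path (1 / \<epsilon>) (\<lambda>j. sqrt \<epsilon> * (\<Sum>i<j. Y i \<omega>)) (\<lambda>_. 0)"

lemma walk_path_cadlag: "0 < \<epsilon> \<Longrightarrow> walk_path \<epsilon> \<omega> \<in> cadlag_paths"
  unfolding walk_path_def by (intro step_path_cadlag) auto

lemma measurable_walk_path:
  assumes g: "bounded_lipschitz g C L" and \<epsilon>: "0 < \<epsilon>" and b: "continuous_on UNIV b"
  shows "(\<lambda>\<omega>. g (walk_path \<epsilon> \<omega>, drift_path b)) \<in> borel_measurable M"
proof -
  have "0 < 1 / \<epsilon>" using \<epsilon> by simp
  moreover have "(\<lambda>\<omega>. sqrt \<epsilon> * (\<Sum>i<j. Y i \<omega>)) \<in> borel_measurable M" for j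
    by measurable
  ultimately show ?thesis
    unfolding walk_path_def
    by (intro measurable_step_paths[OF g _ zero_less_one continuous_on_const b _ borel_measurable_const])
qed

text \<open>At time \<open>t\<close> the block path shows the walk at the last block end before
  \<open>t\<close>, so the difference is a partial block sum. \<open>1 / d < K\<close> keeps the
  tested times within the horizon of \<open>oscillates\<close>.\<close>

lemma walk_path_close:
  assumes \<epsilon>: "0 < \<epsilon>" and m: "0 < m" "K \<le> m" and d: "0 < d" "1 / d < real K"
    and small: "\<not> oscillates \<epsilon> m K d \<omega>"
  shows "unif_dist (walk_path \<epsilon> \<omega>) (block_path \<epsilon> m \<omega>) \<le> d"
proof (rule unif_dist_le[OF d(1)])
  fix t :: real assume t: "0 \<le> t" "t \<le> 1 / d"
  define j where "j = nat \<lfloor>real m * t\<rfloor>"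
  define k where "k = nat \<lfloor>1 / \<epsilon> * t\<rfloor>"
  have k: "block_end \<epsilon> m j \<le> k" "k \<le> block_end \<epsilon> m (Suc j)"
    unfolding j_def k_def using block_end_floor[OF \<epsilon> m(1) t(1)] by auto
  have "real j \<le> real m * t" using t unfolding j_def by (simp add: of_nat_nat)
  also have "\<dots> < real m * real K" using m t d by (intro mult_strict_left_mono) auto
  also have "\<dots> = real (m * K)" by simp
  finally have j: "j < m * K" by (simp only: of_nat_less_iff)
  \<comment> \<open>Here \<open>K \<le> m\<close> keeps the truncation in
    \<open>partial_sums_path\<close> inactive.\<close>
  also have "m * K \<le> m * m" using m by simp
  finally have "min j (m * m) = j" by simp
  then have "block_path \<epsilon> m \<omega> t = (\<Sum>l<j. block_increment \<epsilon> m l \<omega>)"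
    using t by (simp add: partial_sums_path_def step_path_def j_def)
  also have "\<dots> = sqrt \<epsilon> * (\<Sum>i<block_end \<epsilon> m j. Y i \<omega>)"
    unfolding block_increment_def sum_distrib_left[symmetric]
    by (subst sum_blocks) (use \<epsilon> in \<open>auto simp: mono_def intro: block_end_mono\<close>)
  finally have "walk_path \<epsilon> \<omega> t - block_path \<epsilon> m \<omega> t
      = sqrt \<epsilon> * ((\<Sum>i<k. Y i \<omega>) - (\<Sum>i<block_end \<epsilon> m j. Y i \<omega>))"
    using t by (simp add: walk_path_def step_path_def k_def algebra_simps)
  also have "(\<Sum>i<k. Y i \<omega>) - (\<Sum>i<block_end \<epsilon> m j. Y i \<omega>) = (\<Sum>i\<in>{block_end \<epsilon> m j..<k}. Y i \<omega>)"
    using sum.atLeastLessThan_concat[of 0 "block_end \<epsilon> m j" k "\<lambda>i. Y i \<omega>"] k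
    by (simp add: lessThan_atLeast0)
  also have "k = block_end \<epsilon> m j + (k - block_end \<epsilon> m j)" using k by simp
  finally have eq: "walk_path \<epsilon> \<omega> t - block_path \<epsilon> m \<omega> t
      = sqrt \<epsilon> * (\<Sum>i\<in>{block_end \<epsilon> m j..<block_end \<epsilon> m j + (k - block_end \<epsilon> m j)}. Y i \<omega>)" .
  have "k - block_end \<epsilon> m j \<le> block_end \<epsilon> m (Suc j) - block_end \<epsilon> m j" using k by simp
  then have "sqrt \<epsilon> * \<bar>\<Sum>i\<in>{block_end \<epsilon> m j..<block_end \<epsilon> m j + (k - block_end \<epsilon> m j)}. Y i \<omega>\<bar> < d"
    using small j unfolding oscillates_def by (meson not_le)
  then show "\<bar>walk_path \<epsilon> \<omega> t - block_path \<epsilon> m \<omega> t\<bar> \<le> d"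
    unfolding eq using \<epsilon> by (simp add: abs_mult)
qed

lemma walk_path_discretization:
  fixes \<epsilon> :: "nat \<Rightarrow> real"
  assumes \<epsilon>: "\<And>n. 0 < \<epsilon> n" "\<epsilon> \<longlonglongrightarrow> 0"
    and g: "bounded_lipschitz g C L" and b: "continuous_on UNIV b" and e: "0 < e"
  defines "y \<equiv> drift_path b"
  shows "\<exists>m0>0. \<forall>m\<ge>m0. \<forall>\<^sub>F n in sequentially.
    \<bar>expectation (\<lambda>\<omega>. g (walk_path (\<epsilon> n) \<omega>, y)) -
     expectation (\<lambda>\<omega>. g (block_path (\<epsilon> n) m \<omega>, y))\<bar> \<le> e"
proof -
  have y: "y \<in> cadlag_paths" unfolding y_def by (intro step_path_cadlag b) simp
  have L: "0 \<le> L" by (rule bounded_lipschitzD(1)[OF g])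
  \<comment> \<open>Half of \<open>e\<close> pays for the distance \<open>d\<close> outside the bad
    event, the other half for its probability; the added ones keep the denominators
    positive.\<close>
  define d where "d = e / (2 * (L + 1))"
  define e' where "e' = e / (4 * (\<bar>C\<bar> + 1))"
  define K where "K = Suc (nat \<lceil>1 / d\<rceil>)"
  have d: "0 < d" "L * d \<le> e / 2" using e L by (auto simp: d_def field_simps)
  have e': "0 < e'" "2 * \<bar>C\<bar> * e' \<le> e / 2" using e by (auto simp: e'_def field_simps)
  have K: "0 < K" "1 / d < real K" unfolding K_def by (auto, linarith)
  obtain m0 where m0: "\<And>m. m0 \<le> m \<Longrightarrow> \<forall>\<^sub>F n in sequentially. prob {\<omega>\<in>space M. oscillates (\<epsilon> n) m K d \<omega>} \<le> e'"
    using block_modulus[OF \<epsilon> d(1) K(1) e'(1)] by blast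
  show ?thesis
  proof (intro exI[of _ "max m0 K"] conjI allI impI)
    show "0 < max m0 K" using K by simp
    fix m assume "max m0 K \<le> m"
    then have m: "m0 \<le> m" "K \<le> m" "0 < m" using K by auto
    show "\<forall>\<^sub>F n in sequentially.
      \<bar>expectation (\<lambda>\<omega>. g (walk_path (\<epsilon> n) \<omega>, y)) -
       expectation (\<lambda>\<omega>. g (block_path (\<epsilon> n) m \<omega>, y))\<bar> \<le> e"
      using m0[OF m(1)]
    proof eventually_elim
      case (elim n)
      let ?A = "{\<omega>\<in>space M. oscillates (\<epsilon> n) m K d \<omega>}"
      have "\<bar>expectation (\<lambda>\<omega>. g (walk_path (\<epsilon> n) \<omega>, y)) -
        expectation (\<lambda>\<omega>. g (block_path (\<epsilon> n) m \<omega>, y))\<bar>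
        \<le> L * d + 2 * C * prob ?A"
      proof (rule lipschitz_expectation_close[OF g])
        show "(\<lambda>\<omega>. g (walk_path (\<epsilon> n) \<omega>, y)) \<in> borel_measurable M"
          unfolding y_def by (rule measurable_walk_path[OF g \<epsilon>(1) b])
        show "(\<lambda>\<omega>. g (block_path (\<epsilon> n) m \<omega>, y)) \<in> borel_measurable M"
          unfolding y_def by (rule measurable_partial_sums_path[OF g m(3) b]) measurable
        fix \<omega> assume "\<omega> \<in> space M" "\<omega> \<notin> ?A"
        then show "pair_dist (walk_path (\<epsilon> n) \<omega>, y) (block_path (\<epsilon> n) m \<omega>, y) \<le> d"
          using walk_path_close[OF \<epsilon>(1) m(3,2) d(1) K(2), of n \<omega>] by (simp add: pair_dist_def)
      qed (use y d m \<epsilon> in \<open>auto intro: walk_path_cadlag partial_sums_path_cadlag\<close>)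
      also have "\<dots> \<le> e / 2 + 2 * \<bar>C\<bar> * e'"
      proof (rule add_mono[OF d(2)])
        have "2 * C * prob ?A \<le> 2 * \<bar>C\<bar> * prob ?A" by (intro mult_right_mono) auto
        also have "\<dots> \<le> 2 * \<bar>C\<bar> * e'" using elim by (intro mult_left_mono) auto
        finally show "2 * C * prob ?A \<le> 2 * \<bar>C\<bar> * e'" .
      qed
      also have "\<dots> \<le> e" using e' by simp
      finally show ?case .
    qed
  qed
qed

end

section \<open>Brownian paths: increments, continuity, sampling on a grid\<close>

lemma brownian_increment_law:
  assumes B: "standard_brownian_motion N B" and st: "0 \<le> s" "s < t"
  shows "distr N borel (\<lambda>\<omega>. c * (B t \<omega> - B s \<omega>)) = normal_image (c * sqrt (t - s))"
proof -
  interpret N: prob_space N using B unfolding standard_brownian_motion_def by blast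
  have [measurable]: "B u \<in> borel_measurable N" if "0 \<le> u" for u
    using B that unfolding standard_brownian_motion_def by blast
  have sm [measurable]: "B s \<in> borel_measurable N" "B t \<in> borel_measurable N" using st by auto
  have r: "0 < sqrt (t - s)" using st by simp
  have "distributed N lborel (\<lambda>\<omega>. B t \<omega> - B s \<omega>) (normal_density 0 (sqrt (t - s)))"
    using B st unfolding standard_brownian_motion_def by blast
  then have "distributed N lborel (\<lambda>\<omega>. (B t \<omega> - B s \<omega>) / sqrt (t - s)) std_normal_density"
    using N.normal_standard_normal_convert[OF r, where X = "\<lambda>\<omega>. B t \<omega> - B s \<omega>" and \<mu> = 0] by simp
  then have std: "distr N lborel (\<lambda>\<omega>. (B t \<omega> - B s \<omega>) / sqrt (t - s)) = std_normal_distribution"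
    unfolding distributed_def by simp
  have "normal_image (c * sqrt (t - s))
      = distr N borel ((\<lambda>x. c * sqrt (t - s) * x) \<circ> (\<lambda>\<omega>. (B t \<omega> - B s \<omega>) / sqrt (t - s)))"
    unfolding std[symmetric] by (rule distr_distr) measurable
  also have "(\<lambda>x. c * sqrt (t - s) * x) \<circ> (\<lambda>\<omega>. (B t \<omega> - B s \<omega>) / sqrt (t - s)) = (\<lambda>\<omega>. c * (B t \<omega> - B s \<omega>))"
    using r by (auto simp: fun_eq_iff)
  finally show ?thesis by simp
qed

lemma continuous_path_at_left:
  fixes f :: "real \<Rightarrow> real"
  assumes cont: "continuous_on {0..} f" and t: "0 < t"
  shows "((\<lambda>t\<in>{0..}. f t) \<longlongrightarrow> f t) (at_left t)"
proof -
  have "(f \<longlongrightarrow> f t) (at t within {0..})" using cont t unfolding continuous_on_def by auto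
  then have "(f \<longlongrightarrow> f t) (at t within {0..<t})" by (rule tendsto_within_subset) auto
  moreover have "at t within {0..<t} = at_left t"
    using t by (intro at_within_nhd[of _ "{0<..}"]) auto
  ultimately have "(f \<longlongrightarrow> f t) (at_left t)" by simp
  moreover have "\<forall>\<^sub>F s in at_left t. f s = (\<lambda>t\<in>{0..}. f t) s"
    unfolding eventually_at_left_field using t by (intro exI[of _ 0]) auto
  ultimately show ?thesis by (rule Lim_transform_eventually)
qed

lemma continuous_path_cadlag:
  fixes f :: "real \<Rightarrow> real"
  assumes cont: "continuous_on {0..} f"
  shows "(\<lambda>t\<in>{0..}. f t) \<in> cadlag_paths"
  unfolding cadlag_paths_def
proof (intro CollectI conjI allI impI)
  fix t :: real assume t: "0 \<le> t"
  have "(f \<longlongrightarrow> f t) (at t within {0..})" using cont t unfolding continuous_on_def by auto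
  then have "(f \<longlongrightarrow> f t) (at_right t)" by (rule tendsto_within_subset) (use t in auto)
  moreover have "\<forall>\<^sub>F s in at_right t. f s = (\<lambda>t\<in>{0..}. f t) s"
    using t by (auto simp: eventually_at_filter)
  ultimately have "((\<lambda>t\<in>{0..}. f t) \<longlongrightarrow> f t) (at_right t)"
    by (rule Lim_transform_eventually)
  then show "((\<lambda>t\<in>{0..}. f t) \<longlongrightarrow> (\<lambda>t\<in>{0..}. f t) t) (at_right t)"
    using t by simp
qed (use continuous_path_at_left[OF cont] in auto)

text \<open>The source of both the quasi-left-continuity of the Brownian limit and the absence of
  negative jumps of its companion.\<close>

lemma jump_continuous_path:
  fixes f :: "real \<Rightarrow> real"
  assumes cont: "continuous_on {0..} f" and t: "0 \<le> t"
  shows "jump (\<lambda>t\<in>{0..}. f t) t = 0"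
proof (cases "t = 0")
  case False
  then have "0 < t" using t by simp
  from tendsto_unique[OF trivial_limit_at_left_real
      left_lim_tendsto[OF continuous_path_cadlag[OF cont] this] continuous_path_at_left[OF cont this]]
  show ?thesis using t by (simp add: jump_def)
qed (simp add: jump_def left_lim_def)

lemma brownian_continuous:
  assumes "standard_brownian_motion N B" "\<omega> \<in> space N"
  shows "continuous_on {0..} (\<lambda>t. c * B t \<omega>)"
  using assms unfolding standard_brownian_motion_def by (intro continuous_intros) blast

lemma brownian_path_cadlag:
  assumes "standard_brownian_motion N B" "\<omega> \<in> space N"
  shows "(\<lambda>t\<in>{0..}. c * B t \<omega>) \<in> cadlag_paths"
  by (rule continuous_path_cadlag[OF brownian_continuous[OF assms]])

text \<open>Brownian motion frozen at left grid points and stopped at time \<open>m\<close>, in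
  parallel with \<open>partial_sums_path\<close>, whose truncation index \<open>m * m\<close>
  corresponds to that time.\<close>

abbreviation sampled_path :: "(real \<Rightarrow> 'b \<Rightarrow> real) \<Rightarrow> real \<Rightarrow> nat \<Rightarrow> 'b \<Rightarrow> real \<Rightarrow> real" where
  "sampled_path B c m \<omega> \<equiv> step_path (real m) (\<lambda>j. c * B (real (min j (m * m)) / real m) \<omega>) (\<lambda>_. 0)"

lemma brownian_path_approximation:
  assumes B: "standard_brownian_motion N B" and \<omega>: "\<omega> \<in> space N"
  shows "(\<lambda>k. unif_dist (sampled_path B c (Suc k) \<omega>)
    (\<lambda>t\<in>{0..}. c * B t \<omega>)) \<longlonglongrightarrow> 0"
  unfolding unif_dist_tendsto_0_iff
proof (intro allI impI)
  fix T e :: real assume e: "0 < e"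
  have uc: "uniformly_continuous_on {0..T} (\<lambda>t. c * B t \<omega>)"
    by (intro compact_uniformly_continuous[OF continuous_on_subset[OF brownian_continuous[OF B \<omega>]]]) auto
  obtain d where d: "0 < d" "\<forall>t\<in>{0..T}. \<forall>s\<in>{0..T}. dist s t < d \<longrightarrow>
      dist (c * B s \<omega>) (c * B t \<omega>) < e"
    using uc[unfolded uniformly_continuous_on_def, THEN spec, THEN mp, OF e] by (elim exE conjE) (rule that)
  \<comment> \<open>Beyond \<open>T\<close> the stopping of the sampled path is invisible on
    \<open>[0, T]\<close>; beyond \<open>1 / d\<close> the mesh is finer than the modulus of
    continuity \<open>d\<close>.\<close>
  have "\<forall>\<^sub>F k in sequentially. max T (1 / d) < real (Suc k)"
    using filterlim_real_sequentially[THEN filterlim_at_top_dense[THEN iffD1], rule_format, of "max T (1 / d)"]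
    by eventually_elim simp
  then show "\<forall>\<^sub>F k in sequentially. \<forall>t. 0 \<le> t \<and> t \<le> T \<longrightarrow>
    \<bar>sampled_path B c (Suc k) \<omega> t -
     (\<lambda>t\<in>{0..}. c * B t \<omega>) t\<bar> \<le> e"
  proof (eventually_elim, intro allI impI, elim conjE)
    fix k t assume k: "max T (1 / d) < real (Suc k)" and t: "0 \<le> t" "t \<le> T"
    define m where "m = Suc k"
    have m: "0 < m" "T < real m" "1 / d < real m" using k by (auto simp: m_def)
    define j where "j = nat \<lfloor>real m * t\<rfloor>"
    have j: "real j \<le> real m * t" "real m * t < real j + 1"
      using t unfolding j_def by (auto simp: of_nat_nat)
    have "real j \<le> real m * real m" using j(1) t m by (meson less_imp_le mult_left_mono of_nat_0_le_iff order_trans)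
    then have "j \<le> m * m" by (simp flip: of_nat_mult)
    then have "min j (m * m) = j" by simp
    have "t < (real j + 1) / real m" using j m by (simp add: pos_less_divide_eq mult.commute)
    then have s: "0 \<le> real j / real m" "real j / real m \<le> t" "t - real j / real m < 1 / real m"
      using j m by (auto simp: add_divide_distrib pos_divide_le_eq mult.commute)
    have "1 / real m < d" using m d(1) by (simp add: field_simps)
    then have "dist (c * B (real j / real m) \<omega>) (c * B t \<omega>) < e"
      using s t by (intro d(2)[rule_format]) (auto simp: dist_real_def)
    then show "\<bar>sampled_path B c (Suc k) \<omega> t -
     (\<lambda>t\<in>{0..}. c * B t \<omega>) t\<bar> \<le> e"
      using t \<open>min j (m * m) = j\<close> unfolding m_def[symmetric]
      by (simp add: step_path_def j_def[symmetric] dist_real_def)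
  qed
qed

section \<open>Donsker's theorem for bounded Lipschitz functions\<close>

text \<open>Path continuity makes the functional a pointwise limit of functionals of sampled paths,
  each of which depends on finitely many values of \<open>B\<close>.\<close>

lemma measurable_brownian_path:
  assumes g: "bounded_lipschitz g C L" and B: "standard_brownian_motion N B" and b: "continuous_on UNIV b"
  shows "(\<lambda>\<omega>. g (\<lambda>t\<in>{0..}. c * B t \<omega>, drift_path b)) \<in> borel_measurable N"
proof (rule borel_measurable_LIMSEQ_real)
  let ?P = "\<lambda>k \<omega>. sampled_path B c (Suc k) \<omega>"
  have Bm: "B t \<in> borel_measurable N" if "0 \<le> t" for t
    using B that unfolding standard_brownian_motion_def by blast
  show "(\<lambda>\<omega>. g (?P k \<omega>, drift_path b)) \<in> borel_measurable N" for k
    by (intro measurable_step_paths[OF g _ zero_less_one continuous_on_const b _ borel_measurable_const]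
        borel_measurable_times borel_measurable_const Bm) auto
  fix \<omega> assume \<omega>: "\<omega> \<in> space N"
  have y: "drift_path b \<in> cadlag_paths" by (intro step_path_cadlag b) simp
  show "(\<lambda>k. g (?P k \<omega>, drift_path b)) \<longlonglongrightarrow> g (\<lambda>t\<in>{0..}. c * B t \<omega>, drift_path b)"
  proof (rule bounded_lipschitz_tendsto[OF g])
    show "(\<lambda>k. pair_dist (?P k \<omega>, drift_path b) (\<lambda>t\<in>{0..}. c * B t \<omega>, drift_path b)) \<longlonglongrightarrow> 0"
      using brownian_path_approximation[OF B \<omega>, of c] by (simp add: pair_dist_def del: of_nat_Suc mult_Suc mult_Suc_right)
  qed (use y brownian_path_cadlag[OF B \<omega>] in \<open>auto intro!: step_path_cadlag\<close>)
qed

definition brownian_increment :: "(real \<Rightarrow> 'b \<Rightarrow> real) \<Rightarrow> real \<Rightarrow> nat \<Rightarrow> nat \<Rightarrow> 'b \<Rightarrow> real" where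
  "brownian_increment B c m l \<omega> = c * (B (real (Suc l) / real m) \<omega> - B (real l / real m) \<omega>)"

lemma brownian_discretization_tendsto:
  assumes g: "bounded_lipschitz g C L" and B: "standard_brownian_motion N B" and b: "continuous_on UNIV b"
  shows "(\<lambda>k. \<integral>\<omega>. g (partial_sums_path (Suc k) (\<lambda>l. brownian_increment B c (Suc k) l \<omega>), drift_path b) \<partial>N)
    \<longlonglongrightarrow> (\<integral>\<omega>. g (\<lambda>t\<in>{0..}. c * B t \<omega>, drift_path b) \<partial>N)"
proof (rule integral_dominated_convergence[where w = "\<lambda>_. C"])
  interpret N: prob_space N using B unfolding standard_brownian_motion_def by blast
  let ?y = "drift_path b"
  have y: "?y \<in> cadlag_paths" by (intro step_path_cadlag b) simp
  have Bm: "B t \<in> borel_measurable N" if "0 \<le> t" for t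
    using B that unfolding standard_brownian_motion_def by blast
  show "(\<lambda>\<omega>. g (\<lambda>t\<in>{0..}. c * B t \<omega>, ?y)) \<in> borel_measurable N"
    by (rule measurable_brownian_path[OF g B b])
  have "brownian_increment B c m l \<in> borel_measurable N" for m l
    unfolding brownian_increment_def using Bm
    by (intro borel_measurable_times borel_measurable_diff borel_measurable_const Bm) auto
  then show "(\<lambda>\<omega>. g (partial_sums_path (Suc k) (\<lambda>l. brownian_increment B c (Suc k) l \<omega>), ?y)) \<in> borel_measurable N" for k
    by (intro measurable_partial_sums_path[OF g _ b]) auto
  show "integrable N (\<lambda>_. C)" by simp
  show "AE \<omega> in N. norm (g (partial_sums_path (Suc k) (\<lambda>l. brownian_increment B c (Suc k) l \<omega>), ?y)) \<le> C" for k
    using y unfolding real_norm_def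
    by (intro AE_I2 bounded_lipschitzD(2)[OF g]) (simp add: partial_sums_path_cadlag)
  \<comment> \<open>Increments telescope to the path only up to its starting value, which is 0
    almost surely; hence convergence almost everywhere.\<close>
  have "AE \<omega> in N. B 0 \<omega> = 0" using B unfolding standard_brownian_motion_def by blast
  then show "AE \<omega> in N. (\<lambda>k. g (partial_sums_path (Suc k) (\<lambda>l. brownian_increment B c (Suc k) l \<omega>), ?y))
      \<longlonglongrightarrow> g (\<lambda>t\<in>{0..}. c * B t \<omega>, ?y)"
  proof (rule AE_mp, intro AE_I2 impI)
    fix \<omega> assume \<omega>: "\<omega> \<in> space N" and B0: "B 0 \<omega> = 0"
    have "(\<Sum>l<n. brownian_increment B c m l \<omega>) = c * B (real n / real m) \<omega>" for n m
      unfolding brownian_increment_def sum_distrib_left[symmetric]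
      using sum_lessThan_telescope[of "\<lambda>l. B (real l / real m) \<omega>" n] B0 by simp
    then have eq: "partial_sums_path (Suc k) (\<lambda>l. brownian_increment B c (Suc k) l \<omega>) =
      sampled_path B c (Suc k) \<omega>" for k
      unfolding partial_sums_path_def by simp
    show "(\<lambda>k. g (partial_sums_path (Suc k) (\<lambda>l. brownian_increment B c (Suc k) l \<omega>), ?y))
      \<longlonglongrightarrow> g (\<lambda>t\<in>{0..}. c * B t \<omega>, ?y)"
    proof (rule bounded_lipschitz_tendsto[OF g])
      show "(\<lambda>k. pair_dist (partial_sums_path (Suc k) (\<lambda>l. brownian_increment B c (Suc k) l \<omega>), ?y)
          (\<lambda>t\<in>{0..}. c * B t \<omega>, ?y)) \<longlonglongrightarrow> 0"
        unfolding pair_dist_def eq fst_conv snd_conv unif_dist_refl add_0_right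
        by (rule brownian_path_approximation[OF B \<omega>])
    qed (use y brownian_path_cadlag[OF B \<omega>] in \<open>auto intro!: partial_sums_path_cadlag\<close>)
  qed
qed

lemma brownian_increment_indep:
  assumes B: "standard_brownian_motion N B"
  shows "prob_space.indep_vars N (\<lambda>_. borel) (brownian_increment B c m) {..<n}"
proof -
  interpret N: prob_space N using B unfolding standard_brownian_motion_def by blast
  have "N.indep_vars (\<lambda>_. borel) (\<lambda>i \<omega>. B (real (Suc i) / real m) \<omega> - B (real i / real m) \<omega>) {..<n}"
    using B unfolding standard_brownian_motion_def
    by (elim conjE allE[of _ "\<lambda>i. real i / real m"]) (auto simp: mono_def divide_right_mono)
  then have "N.indep_vars (\<lambda>_. borel) (\<lambda>i \<omega>. c * (B (real (Suc i) / real m) \<omega> - B (real i / real m) \<omega>)) {..<n}"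
    by (rule N.indep_vars_compose2[where Y = "\<lambda>_ x. c * x"]) simp
  then show ?thesis by (simp add: brownian_increment_def[abs_def])
qed

context iid_centered
begin

text \<open>Three comparisons: walk with block path, block path with its Gaussian counterpart, and
  the latter with Brownian motion. The number of blocks has to be chosen first, since the first two
  hold only for \<open>n\<close> large depending on it.\<close>

lemma donsker_walk:
  fixes \<epsilon> :: "nat \<Rightarrow> real"
  assumes \<epsilon>: "\<And>n. 0 < \<epsilon> n" "\<epsilon> \<longlonglongrightarrow> 0"
    and g: "bounded_lipschitz g C L" and B: "standard_brownian_motion N B" and b: "continuous_on UNIV b"
  shows "(\<lambda>n. expectation (\<lambda>\<omega>. g (walk_path (\<epsilon> n) \<omega>, drift_path b)))
    \<longlonglongrightarrow> (\<integral>\<omega>. g (\<lambda>t\<in>{0..}. sqrt v * B t \<omega>, drift_path b) \<partial>N)"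
proof (rule LIMSEQ_I)
  interpret N: prob_space N using B unfolding standard_brownian_motion_def by blast
  let ?y = "drift_path b"
  have y: "?y \<in> cadlag_paths" by (intro step_path_cadlag b) simp
  define a where "a n = expectation (\<lambda>\<omega>. g (walk_path (\<epsilon> n) \<omega>, ?y))" for n
  define a' where "a' m n = expectation (\<lambda>\<omega>. g (block_path (\<epsilon> n) m \<omega>, ?y))" for m n
  define l' where "l' m = (\<integral>\<omega>. g (partial_sums_path m (\<lambda>l. brownian_increment B (sqrt v) m l \<omega>), ?y) \<partial>N)" for m
  define l where "l = (\<integral>\<omega>. g (\<lambda>t\<in>{0..}. sqrt v * B t \<omega>, ?y) \<partial>N)"
  have fixed: "a' m \<longlonglongrightarrow> l' m" if m: "0 < m" for m
    unfolding a'_def l'_def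
  proof (rule tendsto_expectation_indep[where I = "{..<m * m}" and C = C and G = "\<lambda>V. g (partial_sums_path m V, ?y)"])
    show "\<bar>g (partial_sums_path m w, ?y)\<bar> \<le> C" for w
      using y m by (intro bounded_lipschitzD(2)[OF g]) (simp add: partial_sums_path_cadlag)
    show "weak_conv_m (\<lambda>n. distr M borel (block_increment (\<epsilon> n) m i)) (distr N borel (brownian_increment B (sqrt v) m i))" for i
    proof -
      have "real (Suc i) / real m - real i / real m = 1 / real m" by (simp add: diff_divide_distrib[symmetric])
      then have "distr N borel (brownian_increment B (sqrt v) m i) =
          normal_image (sqrt v * sqrt (1 / real m))"
        using brownian_increment_law[OF B, of "real i / real m" "real (Suc i) / real m" "sqrt v"] m
        by (simp add: brownian_increment_def[abs_def] divide_strict_right_mono)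
      also have "sqrt v * sqrt (1 / real m) = sqrt (v / real m)" by (simp flip: real_sqrt_mult)
      finally show ?thesis using block_increment_weak_conv[OF \<epsilon> m, of i] by simp
    qed
    show "(\<lambda>n. g (partial_sums_path m (ws n), ?y)) \<longlonglongrightarrow> g (partial_sums_path m w, ?y)"
      if "\<And>i. i \<in> {..<m * m} \<Longrightarrow> (\<lambda>n. ws n i) \<longlonglongrightarrow> w i" for ws w
      by (rule partial_sums_path_tendsto[OF g m y]) (use that in auto)
  qed (auto intro: block_increment_indep \<epsilon> brownian_increment_indep[OF B] prob_space_axioms N.prob_space_axioms)
  have l'_lim: "(\<lambda>k. l' (Suc k)) \<longlonglongrightarrow> l"
    unfolding l'_def l_def by (rule brownian_discretization_tendsto[OF g B b])
  fix r :: real assume r: "0 < r"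
  obtain m0 where m0: "0 < m0" "\<And>m. m0 \<le> m \<Longrightarrow> \<forall>\<^sub>F n in sequentially. \<bar>a n - a' m n\<bar> \<le> r / 4"
    using walk_path_discretization[OF \<epsilon> g b, of "r / 4"] r unfolding a_def a'_def by auto
  have "\<forall>\<^sub>F k in sequentially. \<bar>l' (Suc k) - l\<bar> < r / 4"
    using tendstoD[OF l'_lim, of "r / 4"] r by (simp add: dist_real_def)
  then obtain k where k: "m0 \<le> k" "\<bar>l' (Suc k) - l\<bar> < r / 4"
    unfolding eventually_sequentially by (meson nle_le)
  have "\<forall>\<^sub>F n in sequentially. \<bar>a' (Suc k) n - l' (Suc k)\<bar> < r / 4"
    using tendstoD[OF fixed[of "Suc k"], of "r / 4"] r by (simp add: dist_real_def)
  moreover have "\<forall>\<^sub>F n in sequentially. \<bar>a n - a' (Suc k) n\<bar> \<le> r / 4"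
    using m0(2)[of "Suc k"] k(1) by simp
  ultimately have "\<forall>\<^sub>F n in sequentially. norm (a n - l) < r"
  proof eventually_elim
    case (elim n)
    then show ?case using k(2) r unfolding real_norm_def by linarith
  qed
  then show "\<exists>no. \<forall>n\<ge>no. norm (expectation (\<lambda>\<omega>. g (walk_path (\<epsilon> n) \<omega>, ?y)) -
      (\<integral>\<omega>. g (\<lambda>t\<in>{0..}. sqrt v * B t \<omega>, ?y) \<partial>N)) < r"
    unfolding eventually_sequentially a_def l_def .
qed

text \<open>The rescaled process exactly as the limit condition has it: the jumps carry uncentred
  sums and the centring is a continuous drift, whereas \<open>walk_path\<close> centres at the
  jumps.\<close>

definition drifted_walk_path :: "real \<Rightarrow> real \<Rightarrow> 'a \<Rightarrow> real \<Rightarrow> real" where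
  "drifted_walk_path \<mu> \<epsilon> \<omega> = step_path (1 / \<epsilon>)
     (\<lambda>j. sqrt \<epsilon> * ((\<Sum>i<j. Y i \<omega>) + real j * \<mu>)) (\<lambda>t. - (sqrt \<epsilon> * (1 / \<epsilon> * t * \<mu>)))"

definition deviation_path :: "real \<Rightarrow> 'a \<Rightarrow> real \<Rightarrow> real" where
  "deviation_path \<epsilon> \<omega> = step_path (1 / \<epsilon>) (\<lambda>j. sqrt \<epsilon> * sqrt (sample_squares j \<omega>)) (\<lambda>_. 0)"

lemma drifted_walk_path_cadlag: "0 < \<epsilon> \<Longrightarrow> drifted_walk_path \<mu> \<epsilon> \<omega> \<in> cadlag_paths"
  unfolding drifted_walk_path_def by (intro step_path_cadlag continuous_intros) auto

lemma deviation_path_cadlag: "0 < \<epsilon> \<Longrightarrow> deviation_path \<epsilon> \<omega> \<in> cadlag_paths"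
  unfolding deviation_path_def by (intro step_path_cadlag continuous_intros) auto

lemma measurable_sample_paths:
  assumes g: "bounded_lipschitz g C L" and \<epsilon>: "0 < \<epsilon>"
  shows "(\<lambda>\<omega>. g (drifted_walk_path \<mu> \<epsilon> \<omega>, deviation_path \<epsilon> \<omega>)) \<in> borel_measurable M"
proof -
  have "0 < 1 / \<epsilon>" using \<epsilon> by simp
  moreover have "continuous_on UNIV (\<lambda>t. - (sqrt \<epsilon> * (1 / \<epsilon> * t * \<mu>)))" by (intro continuous_intros)
  moreover have "(\<lambda>\<omega>. sqrt \<epsilon> * ((\<Sum>i<j. Y i \<omega>) + real j * \<mu>)) \<in> borel_measurable M"
    "(\<lambda>\<omega>. sqrt \<epsilon> * sqrt (sample_squares j \<omega>)) \<in> borel_measurable M" for j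
    by measurable
  ultimately show ?thesis
    unfolding drifted_walk_path_def deviation_path_def
    by (intro measurable_step_paths[OF g]) auto
qed

text \<open>The two centrings differ by \<open>\<mu>\<close> times the fractional part of
  \<open>t / \<epsilon>\<close>, scaled by \<open>sqrt \<epsilon>\<close>.\<close>

lemma drifted_walk_path_close:
  assumes \<epsilon>: "0 < \<epsilon>" and d: "0 < d" "sqrt \<epsilon> * \<bar>\<mu>\<bar> \<le> d"
  shows "unif_dist (drifted_walk_path \<mu> \<epsilon> \<omega>) (walk_path \<epsilon> \<omega>) \<le> d"
proof (rule unif_dist_le[OF d(1)])
  fix t :: real assume t: "0 \<le> t"
  define x where "x = t / \<epsilon>"
  have x: "0 \<le> x" using t \<epsilon> by (simp add: x_def)
  have "drifted_walk_path \<mu> \<epsilon> \<omega> t - walk_path \<epsilon> \<omega> t = sqrt \<epsilon> * (\<mu> * (real (nat \<lfloor>x\<rfloor>) - x))"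
    using t by (simp add: drifted_walk_path_def walk_path_def step_path_def x_def algebra_simps)
  also have "\<bar>\<dots>\<bar> = sqrt \<epsilon> * \<bar>\<mu>\<bar> * \<bar>real (nat \<lfloor>x\<rfloor>) - x\<bar>"
    using \<epsilon> by (simp add: abs_mult)
  also have "\<dots> \<le> sqrt \<epsilon> * \<bar>\<mu>\<bar> * 1"
  proof (rule mult_left_mono)
    show "\<bar>real (nat \<lfloor>x\<rfloor>) - x\<bar> \<le> 1" using x by (simp add: of_nat_nat abs_if) linarith
  qed (use \<epsilon> in simp)
  also have "\<dots> \<le> d" using d(2) by simp
  finally show "\<bar>drifted_walk_path \<mu> \<epsilon> \<omega> t - walk_path \<epsilon> \<omega> t\<bar> \<le> d" .
qed

text \<open>Hoelder continuity of the square root, used because it is uniform down to 0, where the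
  derivative is unbounded.\<close>

lemma abs_sqrt_diff_le:
  assumes "0 \<le> a" "0 \<le> (b::real)"
  shows "\<bar>sqrt a - sqrt b\<bar> \<le> sqrt \<bar>a - b\<bar>"
proof (rule real_le_rsqrt)
  have "\<bar>sqrt a - sqrt b\<bar> * \<bar>sqrt a - sqrt b\<bar> \<le> \<bar>sqrt a - sqrt b\<bar> * (sqrt a + sqrt b)"
    using assms by (intro mult_left_mono) (auto simp: abs_le_iff)
  also have "\<dots> = \<bar>(sqrt a - sqrt b) * (sqrt a + sqrt b)\<bar>" using assms by (simp add: abs_mult)
  also have "(sqrt a - sqrt b) * (sqrt a + sqrt b) = a - b" using assms by (simp add: algebra_simps)
  finally show "\<bar>sqrt a - sqrt b\<bar>\<^sup>2 \<le> \<bar>a - b\<bar>" by (simp add: power2_eq_square)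
qed

lemma sample_squares_eq:
  assumes "0 < n"
  shows "sample_squares n \<omega> = (\<Sum>i<n. (Y i \<omega> - (\<Sum>i<n. Y i \<omega>) / real n)\<^sup>2)"
proof -
  let ?S = "\<Sum>i<n. Y i \<omega>"
  have "(\<Sum>i<n. (Y i \<omega> - ?S / real n)\<^sup>2) = (\<Sum>i<n. (Y i \<omega>)\<^sup>2 - 2 * (?S / real n) * Y i \<omega> + (?S / real n)\<^sup>2)"
    by (intro sum.cong refl) (simp add: power2_diff algebra_simps)
  also have "\<dots> = (\<Sum>i<n. (Y i \<omega>)\<^sup>2) - 2 * (?S / real n) * ?S + real n * (?S / real n)\<^sup>2"
    by (simp add: sum.distrib sum_subtractf sum_distrib_left)
  also have "\<dots> = sample_squares n \<omega>"
    using assms by (simp add: sample_squares_def power2_eq_square field_simps)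
  finally show ?thesis by simp
qed

lemma sample_squares_nonneg: "0 \<le> sample_squares n \<omega>"
  by (cases "n = 0") (simp add: sample_squares_def, simp add: sample_squares_eq sum_nonneg)

text \<open>Below the square root an error of \<open>d^2\<close> is allowed. Half of it covers the
  rounding of \<open>t / \<epsilon>\<close> to an integer. The other half covers the deviation of
  the sample squares: up to time \<open>1 / d\<close> there are at most
  \<open>1 / (\<epsilon> * d)\<close> steps, so \<open>d ^ 3 / 2\<close> per step becomes
  \<open>d^2 / 2\<close> after rescaling.\<close>

lemma deviation_path_close:
  assumes \<epsilon>: "0 < \<epsilon>" "v * \<epsilon> \<le> d\<^sup>2 / 2" and d: "0 < d"
    and small: "\<And>k. k \<le> nat \<lfloor>1 / \<epsilon> * (1 / d)\<rfloor> \<Longrightarrow>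
      \<bar>sample_squares k \<omega> - real k * v\<bar> \<le> d ^ 3 / 2 * real (nat \<lfloor>1 / \<epsilon> * (1 / d)\<rfloor>)"
  shows "unif_dist (deviation_path \<epsilon> \<omega>) (drift_path (\<lambda>t. sqrt v * sqrt t)) \<le> d"
proof (rule unif_dist_le[OF d])
  fix t :: real assume t: "0 \<le> t" "t \<le> 1 / d"
  define x where "x = t / \<epsilon>"
  define k where "k = nat \<lfloor>x\<rfloor>"
  define K where "K = nat \<lfloor>1 / \<epsilon> * (1 / d)\<rfloor>"
  have x: "0 \<le> x" "\<epsilon> * x = t" using t \<epsilon> by (auto simp: x_def)
  have kK: "k \<le> K" unfolding k_def K_def x_def
    using mult_left_mono[OF t(2), of "1 / \<epsilon>"] \<epsilon> by (intro nat_mono floor_mono) simp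
  have k: "real k \<le> x" "x \<le> real k + 1" using x by (auto simp: k_def of_nat_nat)
  have "real K \<le> 1 / \<epsilon> * (1 / d)" using \<epsilon> d by (auto simp: K_def of_nat_nat)
  then have K: "\<epsilon> * (d ^ 3 / 2 * real K) \<le> d\<^sup>2 / 2"
    using \<epsilon> d by (simp add: field_simps power2_eq_square power3_eq_cube)
  have "\<bar>\<epsilon> * sample_squares k \<omega> - v * t\<bar> \<le> \<bar>\<epsilon> * (sample_squares k \<omega> - real k * v)\<bar> + \<bar>v * \<epsilon> * (real k - x)\<bar>"
  proof -
    have "v * t = v * (\<epsilon> * x)" using x(2) by simp
    then have "\<epsilon> * sample_squares k \<omega> - v * t = \<epsilon> * (sample_squares k \<omega> - real k * v) + v * \<epsilon> * (real k - x)"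
      using x(2) by (simp add: algebra_simps)
    then show ?thesis by (simp only: abs_triangle_ineq)
  qed
  also have "\<bar>\<epsilon> * (sample_squares k \<omega> - real k * v)\<bar> = \<epsilon> * \<bar>sample_squares k \<omega> - real k * v\<bar>"
    using \<epsilon> by (simp add: abs_mult)
  also have "\<dots> \<le> \<epsilon> * (d ^ 3 / 2 * real K)"
    using \<epsilon> small[OF kK[unfolded K_def]] by (intro mult_left_mono) (auto simp: K_def)
  also have "\<bar>v * \<epsilon> * (real k - x)\<bar> = v * \<epsilon> * \<bar>real k - x\<bar>"
    using \<epsilon> v_pos by (simp add: abs_mult)
  also have "\<dots> \<le> v * \<epsilon> * 1" using \<epsilon> v_pos k by (intro mult_left_mono) auto
  finally have "\<bar>\<epsilon> * sample_squares k \<omega> - v * t\<bar> \<le> d\<^sup>2" using K \<epsilon>(2) by linarith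
  then have "sqrt \<bar>\<epsilon> * sample_squares k \<omega> - v * t\<bar> \<le> sqrt (d\<^sup>2)" by (rule real_sqrt_le_mono)
  also have "\<dots> = d" using d by simp
  finally have le: "sqrt \<bar>\<epsilon> * sample_squares k \<omega> - v * t\<bar> \<le> d" .
  have "\<bar>sqrt (\<epsilon> * sample_squares k \<omega>) - sqrt (v * t)\<bar> \<le> d"
    using \<epsilon> t v_pos sample_squares_nonneg
    by (intro order_trans[OF abs_sqrt_diff_le le] mult_nonneg_nonneg) auto
  then show "\<bar>deviation_path \<epsilon> \<omega> t - drift_path (\<lambda>t. sqrt v * sqrt t) t\<bar> \<le> d"
    using t by (simp add: deviation_path_def step_path_def k_def[symmetric] x_def[symmetric] real_sqrt_mult)
qed

text \<open>Slutsky's argument: since the second coordinate has a deterministic limit, joint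
  convergence reduces to that of the first. This is why \<open>donsker_walk\<close> carries a frozen
  second coordinate.\<close>

lemma donsker_sample_paths:
  fixes \<epsilon> :: "nat \<Rightarrow> real"
  assumes \<epsilon>: "\<And>n. 0 < \<epsilon> n" "\<epsilon> \<longlonglongrightarrow> 0"
    and g: "bounded_lipschitz g C L" and B: "standard_brownian_motion N B"
  shows "(\<lambda>n. expectation (\<lambda>\<omega>. g (drifted_walk_path \<mu> (\<epsilon> n) \<omega>, deviation_path (\<epsilon> n) \<omega>)))
    \<longlonglongrightarrow> (\<integral>\<omega>. g (\<lambda>t\<in>{0..}. sqrt v * B t \<omega>, drift_path (\<lambda>t. sqrt v * sqrt t)) \<partial>N)"
proof -
  let ?y = "drift_path (\<lambda>t. sqrt v * sqrt t)"
  have b: "continuous_on UNIV (\<lambda>t. sqrt v * sqrt t)" by (intro continuous_intros)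
  have y: "?y \<in> cadlag_paths" by (intro step_path_cadlag b) simp
  have L: "0 \<le> L" by (rule bounded_lipschitzD(1)[OF g])
  let ?a = "\<lambda>n. expectation (\<lambda>\<omega>. g (drifted_walk_path \<mu> (\<epsilon> n) \<omega>, deviation_path (\<epsilon> n) \<omega>))"
  let ?b = "\<lambda>n. expectation (\<lambda>\<omega>. g (walk_path (\<epsilon> n) \<omega>, ?y))"
  have "(\<lambda>n. ?a n - ?b n) \<longlonglongrightarrow> 0"
  proof (rule tendstoI)
    fix e :: real assume e: "0 < e"
    \<comment> \<open>Both coordinates may be off by \<open>d\<close>, so the pair is off by
      \<open>2 * d\<close>; hence the 4.\<close>
    define d where "d = e / (4 * (L + 1))"
    have d: "0 < d" "L * (2 * d) \<le> e / 2" using e L by (auto simp: d_def field_simps)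
    define K where "K n = nat \<lfloor>1 / \<epsilon> n * (1 / d)\<rfloor>" for n
    define A where "A k = {\<omega>\<in>space M. \<exists>j\<le>k. d ^ 3 / 2 * real k < \<bar>sample_squares j \<omega> - real j * v\<bar>}" for k
    have "filterlim (\<lambda>n. 1 / \<epsilon> n) at_top sequentially"
      using filterlim_inverse_at_top[OF \<epsilon>(2)] \<epsilon>(1) by (simp add: inverse_eq_divide)
    then have "filterlim (\<lambda>n. (1 / d) * (1 / \<epsilon> n)) at_top sequentially"
      using d by (intro filterlim_tendsto_pos_mult_at_top[OF tendsto_const]) auto
    then have Klim: "filterlim K at_top sequentially"
      unfolding K_def
      by (intro filterlim_compose[OF filterlim_nat_sequentially] filterlim_compose[OF filterlim_floor_sequentially])
         (simp add: mult.commute)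
    have "(\<lambda>k. prob (A k)) \<longlonglongrightarrow> 0"
      unfolding A_def using d by (intro sample_squares_uniform) simp
    then have "(\<lambda>n. 2 * \<bar>C\<bar> * prob (A (K n))) \<longlonglongrightarrow> 2 * \<bar>C\<bar> * 0"
      by (intro tendsto_intros filterlim_compose[OF _ Klim])
    then have ev1: "\<forall>\<^sub>F n in sequentially. 2 * \<bar>C\<bar> * prob (A (K n)) < e / 2"
      using e by (intro order_tendstoD(2)) auto
    have "(\<lambda>n. sqrt (\<epsilon> n) * \<bar>\<mu>\<bar>) \<longlonglongrightarrow> sqrt 0 * \<bar>\<mu>\<bar>" by (intro tendsto_intros \<epsilon>)
    then have ev2: "\<forall>\<^sub>F n in sequentially. sqrt (\<epsilon> n) * \<bar>\<mu>\<bar> < d"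
      using d by (intro order_tendstoD(2)) auto
    have "(\<lambda>n. v * \<epsilon> n) \<longlonglongrightarrow> v * 0" by (intro tendsto_intros \<epsilon>)
    then have ev3: "\<forall>\<^sub>F n in sequentially. v * \<epsilon> n < d\<^sup>2 / 2"
      using d by (intro order_tendstoD(2)) auto
    show "\<forall>\<^sub>F n in sequentially. dist (?a n - ?b n) 0 < e"
      using ev1 ev2 ev3
    proof eventually_elim
      case (elim n)
      have "\<bar>?a n - ?b n\<bar> \<le> L * (2 * d) + 2 * C * prob (A (K n))"
      proof (rule lipschitz_expectation_close[OF g])
        show "(\<lambda>\<omega>. g (drifted_walk_path \<mu> (\<epsilon> n) \<omega>, deviation_path (\<epsilon> n) \<omega>)) \<in> borel_measurable M"
          by (rule measurable_sample_paths[OF g \<epsilon>(1)])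
        show "(\<lambda>\<omega>. g (walk_path (\<epsilon> n) \<omega>, ?y)) \<in> borel_measurable M"
          by (rule measurable_walk_path[OF g \<epsilon>(1) b])
        show "A (K n) \<in> sets M" unfolding A_def by measurable
        fix \<omega> assume \<omega>: "\<omega> \<in> space M" "\<omega> \<notin> A (K n)"
        have "unif_dist (drifted_walk_path \<mu> (\<epsilon> n) \<omega>) (walk_path (\<epsilon> n) \<omega>) \<le> d"
          using elim by (intro drifted_walk_path_close \<epsilon> d) simp
        moreover have "unif_dist (deviation_path (\<epsilon> n) \<omega>) ?y \<le> d"
          using \<omega> elim by (intro deviation_path_close \<epsilon> d) (auto simp: A_def K_def not_less)
        ultimately show "pair_dist (drifted_walk_path \<mu> (\<epsilon> n) \<omega>, deviation_path (\<epsilon> n) \<omega>) (walk_path (\<epsilon> n) \<omega>, ?y) \<le> 2 * d"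
          by (simp add: pair_dist_def)
      qed (use y d \<epsilon> in \<open>auto intro: walk_path_cadlag drifted_walk_path_cadlag deviation_path_cadlag\<close>)
      also have "\<dots> \<le> L * (2 * d) + 2 * \<bar>C\<bar> * prob (A (K n))"
        by (intro add_left_mono mult_right_mono) auto
      also have "\<dots> < e" using d(2) elim(1) by linarith
      finally show ?case by simp
    qed
  qed
  from tendsto_add[OF this donsker_walk[OF \<epsilon> g B b]] show ?thesis by simp
qed

end

section \<open>Scaling invariance, laws of large numbers, early stopping\<close>

text \<open>Both vectors are, almost surely, the same partial-sum map \<open>\<Psi>\<close> applied
  to independent increments along the sorted times, and the increments agree in law one by
  one.\<close>

lemma brownian_scaling_finite:
  assumes B: "standard_brownian_motion N B" and a: "0 < a" and J: "finite J" "J \<subseteq> {0..}"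
  shows "distr N (\<Pi>\<^sub>M t\<in>J. borel) (\<lambda>\<omega>. \<lambda>t\<in>J. B (a * t) \<omega>) =
    distr N (\<Pi>\<^sub>M t\<in>J. borel) (\<lambda>\<omega>. \<lambda>t\<in>J. sqrt a * B t \<omega>)"
proof -
  interpret N: prob_space N using B unfolding standard_brownian_motion_def by blast
  have Bm: "B t \<in> borel_measurable N" if "0 \<le> t" for t
    using B that unfolding standard_brownian_motion_def by blast
  \<comment> \<open>Time 0 is added so that the telescoping sums start at \<open>B 0\<close>, which
    vanishes almost surely.\<close>
  define xs where "xs = sorted_list_of_set (insert 0 J)"
  define n where "n = length xs"
  \<comment> \<open>Constant after the last time: independence of increments is available for
    sequences that are monotone on all naturals.\<close>
  define ts where "ts i = xs ! min i (n - 1)" for i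
  have xs: "sorted xs" "set xs = insert 0 J"
    unfolding xs_def using J by (simp_all only: sorted_sorted_list_of_set set_sorted_list_of_set finite_insert)
  have n: "0 < n" using xs(2) by (auto simp: n_def)
  have min_n: "min i (n - 1) < length xs" for i 
    by (rule le_less_trans[OF min.cobounded2]) (use n in \<open>simp add: n_def\<close>)
  have mono: "mono ts"
    unfolding ts_def by (intro monoI sorted_nth_mono[OF xs(1)] min_n) auto
  have ts_in: "ts i \<in> insert 0 J" for i
    using xs(2) nth_mem[OF min_n[of i]] by (simp add: ts_def)
  then have "ts i \<in> {0..}" for i using J(2) by (metis atLeast_iff insertE order_refl subsetD)
  then have ts_nonneg: "0 \<le> ts i" for i by simp
  have "0 \<in> set xs" using xs(2) by simp
  then obtain i0 where i0: "i0 < n" "xs ! i0 = 0" unfolding in_set_conv_nth n_def by blast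
  have "ts 0 \<le> ts i0" using mono by (auto simp: mono_def)
  also have "ts i0 = 0" using i0 by (simp add: ts_def min_def)
  finally have ts0: "ts 0 = 0" using ts_nonneg[of 0] by simp
  have "\<exists>k<n. ts k = t" if "t \<in> J" for t
  proof -
    have "t \<in> set xs" using xs(2) that by simp
    then obtain k where "k < n" "xs ! k = t" unfolding in_set_conv_nth n_def by blast
    then show ?thesis by (intro exI[of _ k]) (auto simp: ts_def min_def)
  qed
  then have "\<forall>t\<in>J. \<exists>k. k < n \<and> ts k = t" by (rule ballI)
  from bchoice[OF this] obtain idx where "\<forall>t\<in>J. idx t < n \<and> ts (idx t) = t" by (elim exE)
  then have idx: "\<And>t. t \<in> J \<Longrightarrow> idx t < n" "\<And>t. t \<in> J \<Longrightarrow> ts (idx t) = t" by simp_all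
  define U where "U i \<omega> = B (a * ts (Suc i)) \<omega> - B (a * ts i) \<omega>" for i \<omega>
  define W where "W i \<omega> = sqrt a * (B (ts (Suc i)) \<omega> - B (ts i) \<omega>)" for i \<omega>
  have indep: "N.indep_vars (\<lambda>_. borel) (\<lambda>i \<omega>. B (s (Suc i)) \<omega> - B (s i) \<omega>) {..<n}"
    if "0 \<le> s 0" "mono s" for s :: "nat \<Rightarrow> real"
    using B that unfolding standard_brownian_motion_def by blast
  have indU: "N.indep_vars (\<lambda>_. borel) U {..<n}"
    unfolding U_def[abs_def] using indep[of "\<lambda>i. a * ts i"] mono a ts0 by (simp add: mono_def)
  have "N.indep_vars (\<lambda>_. borel) (\<lambda>i \<omega>. B (ts (Suc i)) \<omega> - B (ts i) \<omega>) {..<n}"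
    using indep[of ts] mono ts0 by simp
  then have indW: "N.indep_vars (\<lambda>_. borel) W {..<n}"
    unfolding W_def[abs_def] by (rule N.indep_vars_compose2[where Y = "\<lambda>_ x. sqrt a * x"]) simp
  have law: "distr N borel (U i) = distr N borel (W i)" for i
  proof (cases "ts i = ts (Suc i)")
    \<comment> \<open>This occurs at the last index, where \<open>ts\<close> has become constant;
      both increments are then identically 0.\<close>
    case True
    then have "U i = W i" by (simp add: U_def W_def fun_eq_iff)
    then show ?thesis by simp
  next
    case False
    then have lt: "ts i < ts (Suc i)" using mono by (simp add: mono_def order_less_le)
    have "distr N borel (U i) = normal_image (1 * sqrt (a * ts (Suc i) - a * ts i))"
      using brownian_increment_law[OF B, of "a * ts i" "a * ts (Suc i)" 1] a lt ts_nonneg[of i]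
      by (simp add: U_def[abs_def])
    also have "1 * sqrt (a * ts (Suc i) - a * ts i) = sqrt a * sqrt (ts (Suc i) - ts i)"
      by (simp flip: real_sqrt_mult add: right_diff_distrib)
    also have "normal_image (sqrt a * sqrt (ts (Suc i) - ts i)) = distr N borel (W i)"
      using brownian_increment_law[OF B ts_nonneg lt, of "sqrt a"] by (simp add: W_def[abs_def])
    finally show ?thesis .
  qed
  define \<Psi> :: "(nat \<Rightarrow> real) \<Rightarrow> real \<Rightarrow> real" where "\<Psi> u = (\<lambda>t\<in>J. \<Sum>i<idx t. u i)" for u
  have \<Psi>: "\<Psi> \<in> (\<Pi>\<^sub>M i\<in>{..<n}. borel) \<rightarrow>\<^sub>M (\<Pi>\<^sub>M t\<in>J. borel)"
    unfolding \<Psi>_def[abs_def]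
    by (intro measurable_restrict borel_measurable_sum measurable_component_singleton)
       (use idx(1) in \<open>auto intro: less_trans\<close>)
  have \<Psi>_restrict: "\<Psi> (\<lambda>i\<in>{..<n}. u i) = \<Psi> u" for u
    unfolding \<Psi>_def using idx(1) by (intro restrict_ext sum.cong) (auto intro: less_trans)
  have UWm: "(\<lambda>\<omega>. \<lambda>i\<in>{..<n}. U i \<omega>) \<in> N \<rightarrow>\<^sub>M (\<Pi>\<^sub>M i\<in>{..<n}. borel)"
    "(\<lambda>\<omega>. \<lambda>i\<in>{..<n}. W i \<omega>) \<in> N \<rightarrow>\<^sub>M (\<Pi>\<^sub>M i\<in>{..<n}. borel)"
    using indU indW unfolding N.indep_vars_def by (auto intro!: measurable_restrict)
  have B0: "AE \<omega> in N. B 0 \<omega> = 0" using B unfolding standard_brownian_motion_def by blast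
  have "distr N (\<Pi>\<^sub>M t\<in>J. borel) (\<lambda>\<omega>. \<lambda>t\<in>J. B (a * t) \<omega>) = distr N (\<Pi>\<^sub>M t\<in>J. borel) (\<Psi> \<circ> (\<lambda>\<omega>. \<lambda>i\<in>{..<n}. U i \<omega>))"
  proof (rule distr_cong_AE[OF refl refl])
    show "AE \<omega> in N. (\<lambda>t\<in>J. B (a * t) \<omega>) = (\<Psi> \<circ> (\<lambda>\<omega>. \<lambda>i\<in>{..<n}. U i \<omega>)) \<omega>"
      using B0
    proof eventually_elim
      case (elim \<omega>)
      show ?case
        unfolding o_def \<Psi>_restrict unfolding \<Psi>_def
        using sum_lessThan_telescope[of "\<lambda>i. B (a * ts i) \<omega>"] idx ts0 elim
        by (intro restrict_ext) (simp add: U_def)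
    qed
    show "(\<lambda>\<omega>. \<lambda>t\<in>J. B (a * t) \<omega>) \<in> N \<rightarrow>\<^sub>M (\<Pi>\<^sub>M t\<in>J. borel)"
      using J a by (intro measurable_restrict Bm) auto
  qed (rule measurable_comp[OF UWm(1) \<Psi>])
  also have "\<dots> = distr (distr N (\<Pi>\<^sub>M i\<in>{..<n}. borel) (\<lambda>\<omega>. \<lambda>i\<in>{..<n}. U i \<omega>)) (\<Pi>\<^sub>M t\<in>J. borel) \<Psi>"
    by (rule distr_distr[OF \<Psi> UWm(1), symmetric])
  also have "distr N (\<Pi>\<^sub>M i\<in>{..<n}. borel) (\<lambda>\<omega>. \<lambda>i\<in>{..<n}. U i \<omega>) = distr N (\<Pi>\<^sub>M i\<in>{..<n}. borel) (\<lambda>\<omega>. \<lambda>i\<in>{..<n}. W i \<omega>)"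
    by (rule joint_law_eq[OF N.prob_space_axioms N.prob_space_axioms indU indW law])
  also have "distr \<dots> (\<Pi>\<^sub>M t\<in>J. borel) \<Psi> = distr N (\<Pi>\<^sub>M t\<in>J. borel) (\<Psi> \<circ> (\<lambda>\<omega>. \<lambda>i\<in>{..<n}. W i \<omega>))"
    by (rule distr_distr[OF \<Psi> UWm(2)])
  also have "\<dots> = distr N (\<Pi>\<^sub>M t\<in>J. borel) (\<lambda>\<omega>. \<lambda>t\<in>J. sqrt a * B t \<omega>)"
  proof (rule distr_cong_AE[OF refl refl])
    show "AE \<omega> in N. (\<Psi> \<circ> (\<lambda>\<omega>. \<lambda>i\<in>{..<n}. W i \<omega>)) \<omega> = (\<lambda>t\<in>J. sqrt a * B t \<omega>)"
      using B0
    proof eventually_elim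
      case (elim \<omega>)
      show ?case
        unfolding o_def \<Psi>_restrict unfolding \<Psi>_def
        using sum_lessThan_telescope[of "\<lambda>i. B (ts i) \<omega>"] idx ts0 elim
        by (intro restrict_ext) (simp add: W_def flip: sum_distrib_left)
    qed
    show "(\<lambda>\<omega>. \<lambda>t\<in>J. sqrt a * B t \<omega>) \<in> N \<rightarrow>\<^sub>M (\<Pi>\<^sub>M t\<in>J. borel)"
      using J by (intro measurable_restrict borel_measurable_times borel_measurable_const Bm) auto
  qed (rule measurable_comp[OF UWm(2) \<Psi>])
  finally show ?thesis .
qed

lemma brownian_scaling:
  assumes B: "standard_brownian_motion N B" and a: "0 < a"
  shows "distr N (\<Pi>\<^sub>M t\<in>{0..}. borel) (\<lambda>\<omega>. \<lambda>t\<in>{0..}. B (a * t) \<omega>) =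
    distr N (\<Pi>\<^sub>M t\<in>{0..}. borel) (\<lambda>\<omega>. \<lambda>t\<in>{0..}. sqrt a * B t \<omega>)"
proof (rule measure_eqI_PiM_infinite)
  interpret N: prob_space N using B unfolding standard_brownian_motion_def by blast
  have Bm: "B t \<in> borel_measurable N" if "0 \<le> t" for t
    using B that unfolding standard_brownian_motion_def by blast
  have m: "(\<lambda>\<omega>. \<lambda>t\<in>I. B (a * t) \<omega>) \<in> N \<rightarrow>\<^sub>M (\<Pi>\<^sub>M t\<in>I. borel)"
    "(\<lambda>\<omega>. \<lambda>t\<in>I. sqrt a * B t \<omega>) \<in> N \<rightarrow>\<^sub>M (\<Pi>\<^sub>M t\<in>I. borel)" if "I \<subseteq> {0..}" for I
    using that a by (auto intro!: measurable_restrict borel_measurable_times Bm)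
  show "finite_measure (distr N (\<Pi>\<^sub>M t\<in>{0..}. borel :: real measure) (\<lambda>\<omega>. \<lambda>t\<in>{0..}. B (a * t) \<omega>))"
    using N.prob_space_distr[OF m(1)[OF order_refl]] by (rule prob_space.axioms(1))
  fix A :: "real \<Rightarrow> real set" and J :: "real set"
  assume J: "finite J" "J \<subseteq> {0..}" and A: "\<And>i. i \<in> J \<Longrightarrow> A i \<in> sets borel"
  have PA: "Pi\<^sub>E J A \<in> sets (\<Pi>\<^sub>M t\<in>J. borel)" using J A by (intro sets_PiM_I_finite) auto
  then have emb: "prod_emb {0..} (\<lambda>_. borel) J (Pi\<^sub>E J A) \<in> sets (\<Pi>\<^sub>M t\<in>{0..}. borel)"
    using J by (intro measurable_prod_emb) auto
  have eq: "emeasure (distr N (\<Pi>\<^sub>M t\<in>{0..}. borel) (\<lambda>\<omega>. \<lambda>t\<in>{0..}. f t \<omega>)) (prod_emb {0..} (\<lambda>_. borel) J (Pi\<^sub>E J A))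
    = emeasure (distr N (\<Pi>\<^sub>M t\<in>J. borel) (\<lambda>\<omega>. \<lambda>t\<in>J. f t \<omega>)) (Pi\<^sub>E J A)"
    if f: "\<And>I. I \<subseteq> {0..} \<Longrightarrow> (\<lambda>\<omega>. \<lambda>t\<in>I. f t \<omega>) \<in> N \<rightarrow>\<^sub>M (\<Pi>\<^sub>M t\<in>I. borel)" for f :: "real \<Rightarrow> _ \<Rightarrow> real"
  proof -
    have "restrict (\<lambda>t\<in>{0..}. f t \<omega>) J = (\<lambda>t\<in>J. f t \<omega>)" for \<omega>
      using J(2) by (auto simp: restrict_def fun_eq_iff)
    then have "(\<lambda>\<omega>. \<lambda>t\<in>{0..}. f t \<omega>) -` prod_emb {0..} (\<lambda>_. borel) J (Pi\<^sub>E J A) \<inter> space N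
      = (\<lambda>\<omega>. \<lambda>t\<in>J. f t \<omega>) -` Pi\<^sub>E J A \<inter> space N"
      by (auto simp: prod_emb_def space_PiM)
    then show ?thesis
      using f[OF order_refl] f[OF J(2)] emb PA by (simp add: emeasure_distr)
  qed
  show "emeasure (distr N (\<Pi>\<^sub>M t\<in>{0..}. borel) (\<lambda>\<omega>. \<lambda>t\<in>{0..}. B (a * t) \<omega>)) (prod_emb {0..} (\<lambda>_. borel) J (Pi\<^sub>E J A))
    = emeasure (distr N (\<Pi>\<^sub>M t\<in>{0..}. borel) (\<lambda>\<omega>. \<lambda>t\<in>{0..}. sqrt a * B t \<omega>)) (prod_emb {0..} (\<lambda>_. borel) J (Pi\<^sub>E J A))"
    using m by (simp add: eq brownian_scaling_finite[OF B a J])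
qed simp_all

text \<open>The second component is deterministic and \<open>a powr (2 * (1 / 2)) = a\<close>, so
  the two pairs are images of the two laws in \<open>brownian_scaling\<close> under one map
  \<open>\<Phi>\<close>.\<close>

lemma brownian_pair_scaling:
  assumes B: "standard_brownian_motion N B" and a: "0 < a"
  shows "same_law N (\<lambda>t \<omega>. (\<sigma> * B (a * t) \<omega>, \<sigma>\<^sup>2 * (a * t)))
    N (\<lambda>t \<omega>. (a powr (1 / 2) * (\<sigma> * B t \<omega>), a powr (2 * (1 / 2)) * (\<sigma>\<^sup>2 * t)))"
proof -
  have Bm: "B t \<in> borel_measurable N" if "0 \<le> t" for t
    using B that unfolding standard_brownian_motion_def by blast
  define \<Phi> :: "(real \<Rightarrow> real) \<Rightarrow> real \<Rightarrow> real \<times> real" where "\<Phi> x = (\<lambda>t\<in>{0..}. (\<sigma> * x t, \<sigma>\<^sup>2 * (a * t)))" for x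
  have \<Phi>: "\<Phi> \<in> (\<Pi>\<^sub>M t\<in>{0..}. borel) \<rightarrow>\<^sub>M (\<Pi>\<^sub>M t\<in>{0..}. borel)"
    unfolding \<Phi>_def[abs_def]
    by (intro measurable_restrict borel_measurable_Pair borel_measurable_times borel_measurable_const
        measurable_component_singleton)
  have m: "(\<lambda>\<omega>. \<lambda>t\<in>{0..}. B (a * t) \<omega>) \<in> N \<rightarrow>\<^sub>M (\<Pi>\<^sub>M t\<in>{0..}. borel)"
    "(\<lambda>\<omega>. \<lambda>t\<in>{0..}. sqrt a * B t \<omega>) \<in> N \<rightarrow>\<^sub>M (\<Pi>\<^sub>M t\<in>{0..}. borel)"
    using a by (auto intro!: measurable_restrict borel_measurable_times Bm)
  have "path (\<lambda>t \<omega>. (\<sigma> * B (a * t) \<omega>, \<sigma>\<^sup>2 * (a * t))) = \<Phi> \<circ> (\<lambda>\<omega>. \<lambda>t\<in>{0..}. B (a * t) \<omega>)"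
    "path (\<lambda>t \<omega>. (a powr (1 / 2) * (\<sigma> * B t \<omega>), a powr (2 * (1 / 2)) * (\<sigma>\<^sup>2 * t))) = \<Phi> \<circ> (\<lambda>\<omega>. \<lambda>t\<in>{0..}. sqrt a * B t \<omega>)"
    using a by (auto simp: path_def \<Phi>_def fun_eq_iff powr_half_sqrt)
  then show ?thesis
    unfolding same_law_def
    using distr_distr[OF \<Phi> m(1)] distr_distr[OF \<Phi> m(2)] brownian_scaling[OF B a] by simp
qed

section \<open>Almost sure limits in continuous time and early stopping\<close>

context iid_centered
begin

text \<open>Beyond the strong law along integers there is only the mismatch between
  \<open>\<mu> * t\<close> and its value at the floor of \<open>t\<close>, at most
  \<open>\<bar>\<mu>\<bar>\<close>.\<close>

lemma strong_law_real_time: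
  "AE \<omega> in M. ((\<lambda>t. ((\<Sum>i<nat \<lfloor>t\<rfloor>. Y i \<omega>) + real (nat \<lfloor>t\<rfloor>) * \<mu> - \<mu> * t) / t) \<longlongrightarrow> 0) at_top"
  using strong_law
proof eventually_elim
  case (elim \<omega>)
  have fl: "filterlim (\<lambda>t::real. nat \<lfloor>t\<rfloor>) at_top at_top"
    by (rule filterlim_compose[OF filterlim_nat_sequentially filterlim_floor_sequentially])
  have "((\<lambda>t::real. (\<Sum>i<nat \<lfloor>t\<rfloor>. Y i \<omega>) / real (nat \<lfloor>t\<rfloor>)) \<longlongrightarrow> 0) at_top"
    using filterlim_compose[OF elim fl] .
  moreover have "((\<lambda>t::real. \<bar>\<mu>\<bar> / t) \<longlongrightarrow> 0) at_top"
    by (intro tendsto_divide_0[OF tendsto_const] filterlim_at_top_imp_at_infinity filterlim_ident)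
  ultimately have lim: "((\<lambda>t. \<bar>(\<Sum>i<nat \<lfloor>t\<rfloor>. Y i \<omega>) / real (nat \<lfloor>t\<rfloor>)\<bar> + \<bar>\<mu>\<bar> / t) \<longlongrightarrow> 0) at_top"
    by (intro tendsto_add_zero tendsto_rabs_zero)
  show ?case
  proof (rule Lim_null_comparison[OF _ lim])
    show "\<forall>\<^sub>F t in at_top. norm (((\<Sum>i<nat \<lfloor>t\<rfloor>. Y i \<omega>) + real (nat \<lfloor>t\<rfloor>) * \<mu> - \<mu> * t) / t)
      \<le> \<bar>(\<Sum>i<nat \<lfloor>t\<rfloor>. Y i \<omega>) / real (nat \<lfloor>t\<rfloor>)\<bar> + \<bar>\<mu>\<bar> / t"
      using eventually_ge_at_top[of 1]
    proof eventually_elim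
      case (elim t)
      define n where "n = nat \<lfloor>t\<rfloor>"
      define S where "S = (\<Sum>i<n. Y i \<omega>)"
      have n: "1 \<le> real n" "real n \<le> t" "t \<le> real n + 1" using elim by (auto simp: n_def of_nat_nat)
      have "(S + real n * \<mu> - \<mu> * t) / t = S / t + \<mu> * (real n - t) / t"
        by (simp add: algebra_simps add_divide_distrib diff_divide_distrib)
      then have "\<bar>(S + real n * \<mu> - \<mu> * t) / t\<bar> \<le> \<bar>S / t\<bar> + \<bar>\<mu> * (real n - t) / t\<bar>"
        by (simp only: abs_triangle_ineq)
      also have "\<bar>S / t\<bar> \<le> \<bar>S / real n\<bar>" using n by (simp add: frac_le)
      also have "\<bar>\<mu> * (real n - t) / t\<bar> = \<bar>\<mu>\<bar> * \<bar>real n - t\<bar> / t" using elim by (simp add: abs_mult)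
      also have "\<dots> \<le> \<bar>\<mu>\<bar> * 1 / t" using n by (intro divide_right_mono mult_left_mono) auto
      finally show ?case by (simp add: n_def S_def)
    qed
  qed
qed

lemma sample_squares_over_square_real_time:
  "AE \<omega> in M. ((\<lambda>t. sample_squares (nat \<lfloor>t\<rfloor>) \<omega> / t\<^sup>2) \<longlongrightarrow> 0) at_top"
  using sum_squares_over_square
proof eventually_elim
  case (elim \<omega>)
  have fl: "filterlim (\<lambda>t::real. nat \<lfloor>t\<rfloor>) at_top at_top"
    by (rule filterlim_compose[OF filterlim_nat_sequentially filterlim_floor_sequentially])
  have lim: "((\<lambda>t::real. (\<Sum>i<nat \<lfloor>t\<rfloor>. (Y i \<omega>)\<^sup>2) / (real (nat \<lfloor>t\<rfloor>))\<^sup>2) \<longlongrightarrow> 0) at_top"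
    using filterlim_compose[OF elim fl] .
  show ?case
  proof (rule Lim_null_comparison[OF _ lim])
    show "\<forall>\<^sub>F t in at_top. norm (sample_squares (nat \<lfloor>t\<rfloor>) \<omega> / t\<^sup>2)
      \<le> (\<Sum>i<nat \<lfloor>t\<rfloor>. (Y i \<omega>)\<^sup>2) / (real (nat \<lfloor>t\<rfloor>))\<^sup>2"
      using eventually_ge_at_top[of 1]
    proof eventually_elim
      case (elim t)
      define n where "n = nat \<lfloor>t\<rfloor>"
      have n: "1 \<le> real n" "real n \<le> t" using elim by (auto simp: n_def of_nat_nat)
      have "sample_squares n \<omega> \<le> (\<Sum>i<n. (Y i \<omega>)\<^sup>2)" by (simp add: sample_squares_def)
      moreover have "(real n)\<^sup>2 \<le> t\<^sup>2" using n by (intro power_mono) auto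
      ultimately have "sample_squares n \<omega> / t\<^sup>2 \<le> (\<Sum>i<n. (Y i \<omega>)\<^sup>2) / (real n)\<^sup>2"
        using n by (intro frac_le sum_nonneg) auto
      then show ?case using sample_squares_nonneg[of n \<omega>] by (simp add: n_def)
    qed
  qed
qed

text \<open>If the ratio at some \<open>n\<close> is below \<open>2 * K * \<epsilon>\<close>, then
  \<open>sample_squares n / n\<close> is at most \<open>4 * K^2 * \<epsilon>^2 * n\<close>. With
  \<open>n \<le> \<eta> * (4 / \<epsilon>^2)\<close> this is at most
  \<open>16 * K^2 * \<eta>\<close>, which does not exceed \<open>v / 2\<close> once
  \<open>32 * K^2 * \<eta> \<le> v\<close>. For such \<eta> the upper limit over \<epsilon> is
  exactly 0.\<close>

lemma no_early_stopping_sample_squares: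
  assumes Z2: "\<And>n \<omega>. Z2 (real n) \<omega> = sample_squares n \<omega>"
    and \<nu>: "0 < \<nu>" and Ainv: "asymptotic_inverse (time_scale (1/2) (\<lambda>_. 1)) Ainv"
  shows "no_early_stopping M Z2 Ainv \<nu>"
  unfolding no_early_stopping_def
proof (intro allI impI)
  fix K :: real assume K: "0 < K"
  let ?E = "\<lambda>\<eta> \<epsilon>. {\<omega> \<in> space M. (INF n\<in>{n::nat. \<epsilon> powr (-\<nu>) \<le> real n \<and> real n \<le> \<eta> * Ainv (1 / \<epsilon>)}.
    ereal (sqrt (Z2 (real n) \<omega>) / real n)) \<le> ereal (K * \<epsilon>)}"
  define A where "A N = {\<omega> \<in> space M. \<exists>n\<ge>N. sample_squares n \<omega> / real n \<le> v / 2}" for N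
  have A_meas: "A N \<in> sets M" for N unfolding A_def by measurable
  have A_lim: "(\<lambda>N. prob (A N)) \<longlonglongrightarrow> 0"
  proof (rule prob_tendsto_0_if_AE[OF A_meas])
    have "AE \<omega> in M. \<forall>\<^sub>F n in sequentially. v / 2 < sample_squares n \<omega> / real n"
      using v_pos by (intro sample_squares_lower) simp
    then show "AE \<omega> in M. \<forall>\<^sub>F N in sequentially. \<omega> \<notin> A N"
    proof eventually_elim
      case (elim \<omega>)
      then obtain N0 where "\<And>n. n \<ge> N0 \<Longrightarrow> \<not> sample_squares n \<omega> / real n \<le> v / 2"
        unfolding eventually_sequentially not_le by blast
      then show ?case
        unfolding A_def by (intro eventually_sequentiallyI[of N0]) (blast intro: order_trans)
    qed
  qed
  have inv: "filterlim (\<lambda>\<epsilon>::real. 1 / \<epsilon>) at_top (at_right 0)"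
    using filterlim_inverse_at_top_right by (simp add: inverse_eq_divide)
  \<comment> \<open>The square root of \<open>Ainv x\<close> is asymptotic to \<open>x\<close>,
    hence eventually below \<open>2 * x\<close>.\<close>
  have "\<forall>\<^sub>F x in at_top. Ainv x \<le> 4 * x\<^sup>2"
  proof -
    have half: "(1::real) - 1 / 2 = 1 / 2" by simp
    have "((\<lambda>x. if Ainv x powr (1 / 2) = 0 \<and> x = 0 then 1 else Ainv x powr (1 / 2) / x) \<longlongrightarrow> 1) at_top"
      using Ainv unfolding asymptotic_inverse_def time_scale_def asymp_equiv_def half mult_1_right by blast
    then have "\<forall>\<^sub>F x in at_top. (if Ainv x powr (1 / 2) = 0 \<and> x = 0 then 1 else Ainv x powr (1 / 2) / x) < 2"
      by (rule order_tendstoD(2)) simp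
    moreover have "\<forall>\<^sub>F x in at_top. 0 < Ainv x"
      using Ainv unfolding asymptotic_inverse_def filterlim_at_top_dense by blast
    ultimately show ?thesis using eventually_gt_at_top[of 0]
    proof eventually_elim
      case (elim x)
      then have "sqrt (Ainv x) \<le> 2 * x" by (simp add: powr_half_sqrt field_simps)
      then have "(sqrt (Ainv x))\<^sup>2 \<le> (2 * x)\<^sup>2" using elim by (intro power_mono) auto
      then show ?case using elim by (simp add: power_mult_distrib)
    qed
  qed
  then have ev_inv: "\<forall>\<^sub>F \<epsilon> in at_right 0. Ainv (1 / \<epsilon>) \<le> 4 * (1 / \<epsilon>)\<^sup>2"
    using inv by (rule eventually_compose_filterlim)
  have zero: "Limsup (at_right 0) (\<lambda>\<epsilon>. ereal (prob (?E \<eta> \<epsilon>))) = 0"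
    if \<eta>: "0 < \<eta>" "32 * K\<^sup>2 * \<eta> \<le> v" for \<eta>
  proof (rule lim_imp_Limsup)
    have sub: "\<forall>\<^sub>F \<epsilon> in at_right 0. ?E \<eta> \<epsilon> \<subseteq> A N" for N
    proof -
      have "filterlim (\<lambda>\<epsilon>::real. exp (\<nu> * ln (1 / \<epsilon>))) at_top (at_right 0)"
        by (intro filterlim_compose[OF exp_at_top] filterlim_compose[OF ln_at_top inv]
            filterlim_tendsto_pos_mult_at_top[OF tendsto_const \<nu>])
      \<comment> \<open>\<open>Suc N\<close> instead of \<open>N\<close> makes \<open>n\<close>
        positive, so that dividing by it is meaningful.\<close>
      then have "\<forall>\<^sub>F \<epsilon> in at_right 0. real (Suc N) \<le> exp (\<nu> * ln (1 / \<epsilon>))"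
        unfolding filterlim_at_top by blast
      moreover have "\<forall>\<^sub>F \<epsilon>::real in at_right 0. 0 < \<epsilon>" by (simp add: eventually_at_filter)
      ultimately show ?thesis using ev_inv
      proof eventually_elim
        case (elim \<epsilon>)
        show ?case
        proof
          fix \<omega> assume "\<omega> \<in> ?E \<eta> \<epsilon>"
          then have \<omega>: "\<omega> \<in> space M"
            and le: "(INF n\<in>{n::nat. \<epsilon> powr (-\<nu>) \<le> real n \<and> real n \<le> \<eta> * Ainv (1 / \<epsilon>)}.
              ereal (sqrt (Z2 (real n) \<omega>) / real n)) \<le> ereal (K * \<epsilon>)" by auto
          \<comment> \<open>Doubling \<open>K\<close> makes the inequality strict, so that the
            infimum produces an actual \<open>n\<close> in the range; over an empty range it is
            infinite and the event cannot occur.\<close>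
          have "ereal (K * \<epsilon>) < ereal (2 * K * \<epsilon>)" using K elim by simp
          with le have "(INF n\<in>{n::nat. \<epsilon> powr (-\<nu>) \<le> real n \<and> real n \<le> \<eta> * Ainv (1 / \<epsilon>)}.
              ereal (sqrt (Z2 (real n) \<omega>) / real n)) < ereal (2 * K * \<epsilon>)" by (rule order_le_less_trans)
          then obtain n where n: "\<epsilon> powr (-\<nu>) \<le> real n" "real n \<le> \<eta> * Ainv (1 / \<epsilon>)"
            "sqrt (sample_squares n \<omega>) / real n < 2 * K * \<epsilon>"
            unfolding INF_less_iff by (auto simp: Z2)
          have "exp (\<nu> * ln (1 / \<epsilon>)) = \<epsilon> powr (-\<nu>)"
            using elim by (simp add: powr_def ln_div)
          then have "real (Suc N) \<le> real n" using elim n by linarith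
          then have N: "N \<le> n" "0 < n" by auto
          have "sqrt (sample_squares n \<omega>) < 2 * K * \<epsilon> * real n" using n(3) N by (simp add: pos_divide_less_eq)
          then have "(sqrt (sample_squares n \<omega>))\<^sup>2 \<le> (2 * K * \<epsilon> * real n)\<^sup>2"
            using sample_squares_nonneg by (intro power_mono) auto
          then have "sample_squares n \<omega> \<le> 4 * K\<^sup>2 * \<epsilon>\<^sup>2 * (real n)\<^sup>2"
            using sample_squares_nonneg by (simp add: power_mult_distrib)
          then have "sample_squares n \<omega> / real n \<le> 4 * K\<^sup>2 * \<epsilon>\<^sup>2 * real n"
            using N by (simp add: field_simps power2_eq_square)
          also have "\<dots> \<le> 4 * K\<^sup>2 * \<epsilon>\<^sup>2 * (\<eta> * (4 * (1 / \<epsilon>)\<^sup>2))"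
          proof (rule mult_left_mono)
            have "\<eta> * Ainv (1 / \<epsilon>) \<le> \<eta> * (4 * (1 / \<epsilon>)\<^sup>2)"
              using elim \<eta> by (intro mult_left_mono) auto
            with n(2) show "real n \<le> \<eta> * (4 * (1 / \<epsilon>)\<^sup>2)" by linarith
          qed simp
          also have "\<dots> = 16 * K\<^sup>2 * \<eta>" using elim by (simp add: power_divide)
          also have "\<dots> \<le> v / 2" using \<eta> by simp
          finally show "\<omega> \<in> A N" using \<omega> N by (auto simp: A_def)
        qed
      qed
    qed
    have "((\<lambda>\<epsilon>. prob (?E \<eta> \<epsilon>)) \<longlongrightarrow> 0) (at_right 0)"
    proof (rule tendstoI)
      fix e :: real assume "0 < e"
      then have "\<forall>\<^sub>F N in sequentially. prob (A N) < e" using A_lim by (intro order_tendstoD(2))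
      then obtain N where N: "prob (A N) < e" by (auto simp: eventually_sequentially)
      show "\<forall>\<^sub>F \<epsilon> in at_right 0. dist (prob (?E \<eta> \<epsilon>)) 0 < e"
        using sub[of N]
      proof eventually_elim
        case (elim \<epsilon>)
        have "prob (?E \<eta> \<epsilon>) \<le> prob (A N)" by (rule finite_measure_mono[OF elim A_meas])
        then show ?case using N by simp
      qed
    qed
    then show "((\<lambda>\<epsilon>. ereal (prob (?E \<eta> \<epsilon>))) \<longlongrightarrow> 0) (at_right 0)"
      unfolding zero_ereal_def by (rule tendsto_ereal)
  qed simp
  have "\<forall>\<^sub>F \<eta> in at_right 0. Limsup (at_right 0) (\<lambda>\<epsilon>. ereal (prob (?E \<eta> \<epsilon>))) = 0"
    unfolding eventually_at_right_field
  proof (intro exI[of _ "v / (32 * K\<^sup>2)"] conjI allI impI)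
    show "0 < v / (32 * K\<^sup>2)" using K v_pos by simp
    fix \<eta> assume "0 < \<eta>" "\<eta> < v / (32 * K\<^sup>2)"
    then show "Limsup (at_right 0) (\<lambda>\<epsilon>. ereal (prob (?E \<eta> \<epsilon>))) = 0"
      using K by (intro zero) (auto simp: field_simps)
  qed
  then show "((\<lambda>\<eta>. Limsup (at_right 0) (\<lambda>\<epsilon>. ereal (prob (?E \<eta> \<epsilon>)))) \<longlongrightarrow> 0) (at_right 0)"
    by (rule tendsto_eventually)
qed

end

section \<open>The i.i.d. sample\<close>

lemma (in prob_space) indep_vars_Suc:
  fixes X :: "nat \<Rightarrow> 'a \<Rightarrow> real"
  assumes "indep_vars (\<lambda>_. borel) X {1..}"
  shows "indep_vars (\<lambda>_. borel) (\<lambda>i. X (Suc i)) UNIV"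
proof -
  have "indep_vars (\<lambda>i. \<Pi>\<^sub>M j\<in>{Suc i}. borel) (\<lambda>i \<omega>. restrict (\<lambda>j. X j \<omega>) {Suc i}) UNIV"
    by (rule indep_vars_restrict[OF assms]) (auto simp: disjoint_family_on_def)
  then have "indep_vars (\<lambda>_. borel) (\<lambda>i \<omega>. (restrict (\<lambda>j. X j \<omega>) {Suc i}) (Suc i)) UNIV"
    by (rule indep_vars_compose2) (intro measurable_component_singleton, simp)
  then show ?thesis by simp
qed

text \<open>The sample is indexed from 1 and uncentred, the locale from 0 and centred. Centring is
  harmless for the squares, which are taken around the sample mean.\<close>

lemma iid_centered_shift:
  assumes "prob_space M"
    and indep: "prob_space.indep_vars M (\<lambda>_. borel) X {1..}"
    and ident: "\<forall>i\<ge>1. distr M borel (X i) = distr M borel (X 1)"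
    and int1: "integrable M (X 1)" and int2: "integrable M (\<lambda>\<omega>. (X 1 \<omega>)\<^sup>2)"
    and mean: "prob_space.expectation M (X 1) = \<mu>"
    and var: "prob_space.variance M (X 1) = \<sigma>\<^sup>2" and "0 < (\<sigma>::real)"
  shows "iid_centered M (\<lambda>i \<omega>. X (Suc i) \<omega> - \<mu>) (\<sigma>\<^sup>2)"
proof -
  interpret prob_space M by fact
  have Xm [measurable]: "X (Suc i) \<in> borel_measurable M" for i
    using indep unfolding indep_vars_def by auto
  have d: "distr M borel (X (Suc i)) = distr M borel (X 1)" for i by (rule ident[rule_format]) simp
  have "X 1 \<in> borel_measurable M" using Xm[of 0] by simp
  note law = expectation_eq_if_distr_eq[OF d Xm this]
  have sq: "(X 1 \<omega> - \<mu>)\<^sup>2 = (X 1 \<omega>)\<^sup>2 - 2 * \<mu> * X 1 \<omega> + \<mu>\<^sup>2" for \<omega>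
    by (simp add: power2_diff algebra_simps)
  have int_sq: "integrable M (\<lambda>\<omega>. (X 1 \<omega> - \<mu>)\<^sup>2)"
    unfolding sq using int1 int2 by (intro Bochner_Integration.integrable_add Bochner_Integration.integrable_diff) auto
  show ?thesis
  proof unfold_locales
    show "indep_vars (\<lambda>_. borel) (\<lambda>i \<omega>. X (Suc i) \<omega> - \<mu>) UNIV"
      by (rule indep_vars_compose2[OF indep_vars_Suc[OF indep], where Y = "\<lambda>_ x. x - \<mu>"]) simp
    show "integrable M (\<lambda>\<omega>. (X (Suc i) \<omega> - \<mu>)\<^sup>2)" for i
      by (subst law(2)[of "\<lambda>x. (x - \<mu>)\<^sup>2"]) (simp, rule int_sq)
    show "expectation (\<lambda>\<omega>. X (Suc i) \<omega> - \<mu>) = 0" for i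
      by (subst law(1)[of "\<lambda>x. x - \<mu>"]) (use int1 mean in \<open>auto simp: prob_space\<close>)
    show "expectation (\<lambda>\<omega>. (X (Suc i) \<omega> - \<mu>)\<^sup>2) = \<sigma>\<^sup>2" for i
      by (subst law(1)[of "\<lambda>x. (x - \<mu>)\<^sup>2"]) (use var mean in auto)
    show "distr M borel (\<lambda>\<omega>. X (Suc i) \<omega> - \<mu>) = distr M borel (\<lambda>\<omega>. X (Suc 0) \<omega> - \<mu>)" for i
    proof -
      have "distr M borel (\<lambda>\<omega>. X (Suc j) \<omega> - \<mu>) = distr (distr M borel (X (Suc j))) borel (\<lambda>x. x - \<mu>)" for j
        by (subst distr_distr) (auto simp: o_def)
      then show ?thesis unfolding d by simp
    qed
    show "0 < \<sigma>\<^sup>2" using \<open>0 < \<sigma>\<close> by simp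
  qed
qed

theorem theorem4p1:
  fixes M :: "'a measure" and N :: "'b measure"
    and X :: "nat \<Rightarrow> 'a \<Rightarrow> real" and B :: "real \<Rightarrow> 'b \<Rightarrow> real" and \<mu> \<sigma> :: real
  assumes "prob_space M"
    and indep: "prob_space.indep_vars M (\<lambda>_. borel) X {1..}"
    and ident: "\<forall>i\<ge>1. distr M borel (X i) = distr M borel (X 1)"
    and "integrable M (X 1)" and "integrable M (\<lambda>\<omega>. (X 1 \<omega>)\<^sup>2)"
    and mean: "prob_space.expectation M (X 1) = \<mu>"
    and var: "prob_space.variance M (X 1) = \<sigma>\<^sup>2" and "0 < \<sigma>"
    and "standard_brownian_motion N B"
  shows "functional_limit_condition M (sum_process X) (centered_square_process X)
           \<mu> (1/2) (\<lambda>_. 1) N (\<lambda>t \<omega>. \<sigma> * B t \<omega>) (\<lambda>t \<omega>. \<sigma>\<^sup>2 * t) \<and>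
         (\<forall>\<nu> Ainv. 0 < \<nu> \<and> \<nu> < 2 \<and> asymptotic_inverse (time_scale (1/2) (\<lambda>_. 1)) Ainv \<longrightarrow>
            no_early_stopping M (centered_square_process X) Ainv \<nu>)"
proof -
  interpret iid_centered M "\<lambda>i \<omega>. X (Suc i) \<omega> - \<mu>" "\<sigma>\<^sup>2"
    by (rule iid_centered_shift; fact)
  note B = \<open>standard_brownian_motion N B\<close>
  interpret N: prob_space N using B unfolding standard_brownian_motion_def by blast
  have Bm: "B t \<in> borel_measurable N" if "0 \<le> t" for t
    using B that unfolding standard_brownian_motion_def by blast
  have sqrt_v: "sqrt (\<sigma>\<^sup>2) = \<sigma>" using \<open>0 < \<sigma>\<close> by simp
  have sum_eq: "sum_process X t \<omega> = (\<Sum>i<nat \<lfloor>t\<rfloor>. X (Suc i) \<omega> - \<mu>) + real (nat \<lfloor>t\<rfloor>) * \<mu>" for t \<omega>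
    unfolding sum_process_def by (simp add: sum.atLeast1_atMost_eq sum_subtractf)
  \<comment> \<open>The sample mean shifts with the data, so the deviations of \<open>X\<close> and
    of \<open>X - \<mu>\<close> coincide. For \<open>t < 1\<close> both sides are 0.\<close>
  have square_eq: "centered_square_process X t \<omega> = sample_squares (nat \<lfloor>t\<rfloor>) \<omega>" if "0 \<le> t" for t \<omega>
  proof (cases "t < 1")
    case True
    then have "\<lfloor>t\<rfloor> = 0" using that by linarith
    then show ?thesis using True by (simp add: centered_square_process_def sample_squares_def)
  next
    case False
    define n where "n = nat \<lfloor>t\<rfloor>"
    have n: "0 < n" "of_int \<lfloor>t\<rfloor> = real n" using False by (auto simp: n_def of_nat_nat)
    define S where "S = (\<Sum>i<n. X (Suc i) \<omega> - \<mu>)"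
    have "sum_process X t \<omega> / of_int \<lfloor>t\<rfloor> = S / real n + \<mu>"
      using n unfolding sum_eq n_def[symmetric] S_def by (simp add: add_divide_distrib)
    then have "centered_square_process X t \<omega> = (\<Sum>i<n. (X (Suc i) \<omega> - (S / real n + \<mu>))\<^sup>2)"
      using False by (simp add: centered_square_process_def n_def sum.atLeast1_atMost_eq)
    also have "\<dots> = sample_squares n \<omega>"
      unfolding sample_squares_eq[OF n(1)] S_def[symmetric] by (intro sum.cong refl) (simp add: algebra_simps)
    finally show ?thesis by (simp add: n_def)
  qed
  have sum_path: "path (sum_process X) \<omega> = step_path 1 (\<lambda>j. (\<Sum>i<j. X (Suc i) \<omega> - \<mu>) + real j * \<mu>) (\<lambda>_. 0)" for \<omega>
    by (auto simp: path_def step_path_def sum_eq)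
  have square_path: "path (centered_square_process X) \<omega> = step_path 1 (\<lambda>j. sample_squares j \<omega>) (\<lambda>_. 0)" for \<omega>
    by (auto simp: path_def step_path_def square_eq)
  have Y2_cont: "continuous_on S (\<lambda>t. \<sigma>\<^sup>2 * t)" for S by (intro continuous_intros)
  \<comment> \<open>The factor 1 is the value of the slowly varying function, kept so that the
    equation matches the limit condition literally.\<close>
  have scaled_sum: "(\<lambda>t\<in>{0..}. \<epsilon> powr (1/2) * 1 * (sum_process X (t / \<epsilon>) \<omega> - t / \<epsilon> * \<mu>)) = drifted_walk_path \<mu> \<epsilon> \<omega>"
    if "0 < \<epsilon>" for \<epsilon> \<omega>
    using that unfolding drifted_walk_path_def step_path_def
    by (intro restrict_ext) (simp add: sum_eq powr_half_sqrt algebra_simps)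
  have scaled_square: "(\<lambda>t\<in>{0..}. \<epsilon> powr (1/2) * 1 * sqrt (centered_square_process X (t / \<epsilon>) \<omega>)) = deviation_path \<epsilon> \<omega>"
    if "0 < \<epsilon>" for \<epsilon> \<omega>
    using that unfolding deviation_path_def step_path_def
    by (intro restrict_ext) (simp add: square_eq powr_half_sqrt)
  have limit_eq: "(path (\<lambda>t \<omega>. \<sigma> * B t \<omega>) \<omega>, \<lambda>t\<in>{0..}. sqrt (\<sigma>\<^sup>2 * t)) =
      (\<lambda>t\<in>{0..}. \<sigma> * B t \<omega>, drift_path (\<lambda>t. \<sigma> * sqrt t))" for \<omega>
    using \<open>0 < \<sigma>\<close> by (simp add: path_def step_path_def real_sqrt_mult)
  have sq_cont: "continuous_on UNIV (\<lambda>t. \<sigma> * sqrt t)" by (intro continuous_intros)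
  let ?W = "\<lambda>\<epsilon> \<omega>. (\<lambda>t\<in>{0..}. \<epsilon> powr (1/2) * 1 * (sum_process X (t / \<epsilon>) \<omega> - t / \<epsilon> * \<mu>),
    \<lambda>t\<in>{0..}. \<epsilon> powr (1/2) * 1 * sqrt (centered_square_process X (t / \<epsilon>) \<omega>))"
  have W_eq: "?W \<epsilon> \<omega> = (drifted_walk_path \<mu> \<epsilon> \<omega>, deviation_path \<epsilon> \<omega>)" if "0 < \<epsilon>" for \<epsilon> \<omega>
    by (simp only: scaled_sum[OF that] scaled_square[OF that])
  have "converges_weakly wm2_topology M ?W N
    (\<lambda>\<omega>. (path (\<lambda>t \<omega>. \<sigma> * B t \<omega>) \<omega>, \<lambda>t\<in>{0..}. sqrt (\<sigma>\<^sup>2 * t))) (at_right 0)"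
    unfolding limit_eq
  proof (rule converges_weakly_wm2[OF prob_space_axioms N.prob_space_axioms])
    have "\<forall>\<^sub>F \<epsilon>::real in at_right 0. 0 < \<epsilon>" by (simp add: eventually_at_filter)
    then show "\<forall>\<^sub>F \<epsilon> in at_right 0. (\<forall>\<omega>\<in>space M. ?W \<epsilon> \<omega> \<in> path_pairs) \<and>
      (\<forall>g C L. bounded_lipschitz g C L \<longrightarrow> (\<lambda>\<omega>. g (?W \<epsilon> \<omega>)) \<in> borel_measurable M)"
    proof eventually_elim
      case (elim \<epsilon>)
      show ?case unfolding W_eq[OF elim]
        using drifted_walk_path_cadlag[OF elim] deviation_path_cadlag[OF elim] measurable_sample_paths[OF _ elim]
        by auto
    qed
    show "(\<lambda>t\<in>{0..}. \<sigma> * B t \<omega>, drift_path (\<lambda>t. \<sigma> * sqrt t)) \<in> path_pairs" if "\<omega> \<in> space N" for \<omega>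
      using brownian_path_cadlag[OF B that] step_path_cadlag[OF zero_less_one sq_cont] by simp
    fix g C L assume g: "bounded_lipschitz g C L"
    show "(\<lambda>\<omega>. g (\<lambda>t\<in>{0..}. \<sigma> * B t \<omega>, drift_path (\<lambda>t. \<sigma> * sqrt t))) \<in> borel_measurable N"
      by (rule measurable_brownian_path[OF g B sq_cont])
    show "((\<lambda>\<epsilon>. \<integral>\<omega>. g (?W \<epsilon> \<omega>) \<partial>M) \<longlongrightarrow>
      (\<integral>\<omega>. g (\<lambda>t\<in>{0..}. \<sigma> * B t \<omega>, drift_path (\<lambda>t. \<sigma> * sqrt t)) \<partial>N)) (at_right 0)"
      \<comment> \<open>The limit at 0 from the right is tested along sequences, since the central
        limit theorem and dominated convergence enter in sequential form.\<close>
      unfolding tendsto_at_iff_sequentially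
    proof (intro allI impI)
      fix \<epsilon> :: "nat \<Rightarrow> real" assume "\<forall>i. \<epsilon> i \<in> {0<..} - {0}" and lim: "\<epsilon> \<longlonglongrightarrow> 0"
      then have pos: "\<And>i. 0 < \<epsilon> i" by auto
      show "((\<lambda>\<epsilon>. \<integral>\<omega>. g (?W \<epsilon> \<omega>) \<partial>M) \<circ> \<epsilon>) \<longlonglongrightarrow>
        (\<integral>\<omega>. g (\<lambda>t\<in>{0..}. \<sigma> * B t \<omega>, drift_path (\<lambda>t. \<sigma> * sqrt t)) \<partial>N)"
        unfolding o_def W_eq[OF pos]
        using donsker_sample_paths[OF pos lim g B, of \<mu>] by (simp only: sqrt_v)
    qed
  qed
  moreover have "process_in M cadlag_paths (sum_process X)"
    unfolding process_in_def
  proof (intro conjI allI impI ballI)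
    show "sum_process X t \<in> borel_measurable M" for t
      unfolding sum_eq[abs_def] by (intro borel_measurable_add borel_measurable_sum Y_measurable borel_measurable_const)
    show "path (sum_process X) \<omega> \<in> cadlag_paths" for \<omega>
      unfolding sum_path by (intro step_path_cadlag) auto
  qed
  moreover have "process_in M nonneg_cadlag_paths (centered_square_process X)"
    unfolding process_in_def
  proof (intro conjI allI impI ballI)
    show "centered_square_process X t \<in> borel_measurable M" if "0 \<le> t" for t
      using sample_squares_measurable[of "nat \<lfloor>t\<rfloor>"] square_eq[OF that] by (simp cong: measurable_cong)
    show "path (centered_square_process X) \<omega> \<in> nonneg_cadlag_paths" for \<omega>
      unfolding square_path nonneg_cadlag_paths_def
      using step_path_cadlag[of 1 "\<lambda>_. 0" "\<lambda>j. sample_squares j \<omega>"] sample_squares_nonneg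
      by (simp add: step_path_def)
  qed
  moreover have "process_in N cadlag_paths (\<lambda>t \<omega>. \<sigma> * B t \<omega>)"
    unfolding process_in_def path_def using Bm brownian_path_cadlag[OF B] by auto
  moreover have "process_in N nonneg_cadlag_paths (\<lambda>t \<omega>. \<sigma>\<^sup>2 * t)"
    unfolding process_in_def path_def nonneg_cadlag_paths_def
    using continuous_path_cadlag[OF Y2_cont] by auto
  moreover have "AE \<omega> in M. sum_process X 0 \<omega> = 0" by (simp add: sum_process_def)
  moreover have "slowly_varying (\<lambda>_. 1)" by (simp add: slowly_varying_def)
  moreover have "AE \<omega> in M. ((\<lambda>t. (sum_process X t \<omega> - \<mu> * t) / t) \<longlongrightarrow> 0) at_top \<and>
      ((\<lambda>t. centered_square_process X t \<omega> / t\<^sup>2) \<longlongrightarrow> 0) at_top"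
    using strong_law_real_time[of \<mu>] sample_squares_over_square_real_time
  proof eventually_elim
    case (elim \<omega>)
    have "\<forall>\<^sub>F t in at_top. sample_squares (nat \<lfloor>t\<rfloor>) \<omega> / t\<^sup>2 = centered_square_process X t \<omega> / t\<^sup>2"
      using eventually_ge_at_top[of 0] by eventually_elim (simp add: square_eq)
    with elim show ?case unfolding sum_eq by (auto intro: Lim_transform_eventually)
  qed
  moreover have "\<forall>a>0. same_law N (\<lambda>t \<omega>. (\<sigma> * B (a * t) \<omega>, \<sigma>\<^sup>2 * (a * t)))
      N (\<lambda>t \<omega>. (a powr (1/2) * (\<sigma> * B t \<omega>), a powr (2 * (1/2)) * (\<sigma>\<^sup>2 * t)))"
    using brownian_pair_scaling[OF B] by blast
  moreover have "quasi_left_continuous N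
      (usual_augmentation N (natural_filtration N (\<lambda>t \<omega>. (\<sigma> * B t \<omega>, \<sigma>\<^sup>2 * t)))) (\<lambda>t \<omega>. \<sigma> * B t \<omega>)"
    unfolding quasi_left_continuous_def finite_predictable_time_def path_def
    using jump_continuous_path[OF brownian_continuous[OF B]] by auto
  moreover have "AE \<omega> in N. (\<forall>t>0. 0 < \<sigma>\<^sup>2 * t) \<and> (\<forall>t\<ge>0. 0 \<le> jump (path (\<lambda>t \<omega>. \<sigma>\<^sup>2 * t) \<omega>) t)"
    unfolding path_def using jump_continuous_path[OF Y2_cont] \<open>0 < \<sigma>\<close> by simp
  ultimately have "functional_limit_condition M (sum_process X) (centered_square_process X)
           \<mu> (1/2) (\<lambda>_. 1) N (\<lambda>t \<omega>. \<sigma> * B t \<omega>) (\<lambda>t \<omega>. \<sigma>\<^sup>2 * t)"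
    unfolding functional_limit_condition_def using prob_space_axioms N.prob_space_axioms by simp
  moreover have "no_early_stopping M (centered_square_process X) Ainv \<nu>"
    if "0 < \<nu>" "asymptotic_inverse (time_scale (1/2) (\<lambda>_. 1)) Ainv" for \<nu> Ainv
    using that by (intro no_early_stopping_sample_squares) (simp_all add: square_eq)
  ultimately show ?thesis by blast
qed

end
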